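(* Let $G$ be a graph with $n$ vertices and $m$ edges, and let $A(G)$ be the set of avoidable vertices of $G$. There is an $O(n+m)$-time algorithm that (1) computes a typical collection $\mathcal{G}$ of maximal vertex-disjoint induced subgraphs of $G$, and (2) for every vertex $v\in V(G)\setminus V(\mathcal{G})$ decides whether $v\in A(G)$, where $V(\mathcal{G})$ is the union of the vertex sets of the graphs in $\mathcal{G}$.
   Context: All graphs are finite, simple and undirected. A vertex $v$ of a graph $G$ is avoidable if every induced path on three vertices with middle vertex $v$ is contained in an induced cycle of $G$. A graph is co-connected if its complement is connected. A collection $\mathcal{G}$ of maximal vertex-disjoint induced subgraphs of $G$ that are both connected and co-connected is called a typical collection of $G$ if every $H\in\mathcal{G}$ satisfies: $H$ is connected and co-connected; $|V(H)|\le|E(H)|$ and $|V(H)|\le|E(\overline{H})|$; and every avoidable vertex of $H$ is an avoidable vertex of $G$. *)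

theory Defs
  imports Main
begin

section \<open>Finite simple undirected graphs\<close>

type_synonym 'a ugraph = "'a set \<times> 'a set set"

abbreviation verts :: "'a ugraph \<Rightarrow> 'a set" where "verts G \<equiv> fst G"
abbreviation edges :: "'a ugraph \<Rightarrow> 'a set set" where "edges G \<equiv> snd G"

definition simple_graph :: "'a ugraph \<Rightarrow> bool" where
  "simple_graph G \<longleftrightarrow> finite (verts G) \<and> (\<forall>e \<in> edges G. e \<subseteq> verts G \<and> card e = 2)"

definition complement :: "'a ugraph \<Rightarrow> 'a ugraph" where
  "complement G = (verts G, {e. e \<subseteq> verts G \<and> card e = 2} - edges G)"

definition induced :: "'a ugraph \<Rightarrow> 'a set \<Rightarrow> 'a ugraph" where
  "induced G S = (S, {e \<in> edges G. e \<subseteq> S})"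

definition induced_subgraph :: "'a ugraph \<Rightarrow> 'a ugraph \<Rightarrow> bool" where
  "induced_subgraph H G \<longleftrightarrow> verts H \<subseteq> verts G \<and> H = induced G (verts H)"

definition connected :: "'a ugraph \<Rightarrow> bool" where
  "connected G \<longleftrightarrow> verts G \<noteq> {} \<and>
     (\<forall>u \<in> verts G. \<forall>v \<in> verts G. (u, v) \<in> {(x, y). {x, y} \<in> edges G}\<^sup>*)"

definition co_connected :: "'a ugraph \<Rightarrow> bool" where
  "co_connected G \<longleftrightarrow> connected (complement G)"

definition induced_path :: "'a ugraph \<Rightarrow> 'a list \<Rightarrow> bool" where
  "induced_path G ps \<longleftrightarrow> ps \<noteq> [] \<and> distinct ps \<and> set ps \<subseteq> verts G \<and>
     edges (induced G (set ps)) = {{ps ! i, ps ! Suc i} | i. Suc i < length ps}"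

definition induced_cycle :: "'a ugraph \<Rightarrow> 'a list \<Rightarrow> bool" where
  "induced_cycle G cs \<longleftrightarrow> 3 \<le> length cs \<and> distinct cs \<and> set cs \<subseteq> verts G \<and>
     edges (induced G (set cs)) =
       {{cs ! i, cs ! (Suc i mod length cs)} | i. i < length cs}"

text \<open>
  Containment of the path in the cycle is containment of vertex sets: both are induced subgraphs
  of the same graph, so the edges of the path are then edges of the cycle.
\<close>

definition avoidable :: "'a ugraph \<Rightarrow> 'a \<Rightarrow> bool" where
  "avoidable G v \<longleftrightarrow> v \<in> verts G \<and>
     (\<forall>a b. induced_path G [a, v, b] \<longrightarrow>
        (\<exists>cs. induced_cycle G cs \<and> set [a, v, b] \<subseteq> set cs))"

definition avoidable_set :: "'a ugraph \<Rightarrow> 'a set" where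
  "avoidable_set G = {v. avoidable G v}"

definition maximal_conn_coconn :: "'a ugraph \<Rightarrow> 'a ugraph \<Rightarrow> bool" where
  "maximal_conn_coconn G H \<longleftrightarrow>
     induced_subgraph H G \<and> connected H \<and> co_connected H \<and>
     (\<forall>H'. induced_subgraph H' G \<and> connected H' \<and> co_connected H' \<and> verts H \<subseteq> verts H'
        \<longrightarrow> H' = H)"

definition typical_collection :: "'a ugraph \<Rightarrow> 'a ugraph set \<Rightarrow> bool" where
  "typical_collection G \<G> \<longleftrightarrow>
     (\<forall>H \<in> \<G>. maximal_conn_coconn G H) \<and>
     (\<forall>H \<in> \<G>. \<forall>H' \<in> \<G>. H \<noteq> H' \<longrightarrow> verts H \<inter> verts H' = {}) \<and>
     (\<forall>H \<in> \<G>. connected H \<and> co_connected H \<and>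
        card (verts H) \<le> card (edges H) \<and>
        card (verts H) \<le> card (edges (complement H)) \<and>
        avoidable_set H \<subseteq> avoidable_set G)"

definition collection_verts :: "'a ugraph set \<Rightarrow> 'a set" where
  "collection_verts \<G> = (\<Union>H \<in> \<G>. verts H)"


section \<open>A random access machine\<close>

text \<open>
  Algorithms are programs of a structured language over natural-number registers and finitely many
  arrays, every elementary operation having unit cost. As usual for the unit-cost measure, numbers
  have to fit into a machine word: \<^term>\<open>W\<close> is the number of values of a word, and a program
  has no execution if it produces a constant, intermediate result or address that is
  not below \<^term>\<open>W\<close>.
\<close>

datatype aexp =
    N nat
  | V string
  | Get string aexp
  | Plus aexp aexp
  | Minus aexp aexp

datatype bexp =
    Less aexp aexp
  | Eq aexp aexp
  | Not bexp
  | And bexp bexp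

datatype com =
    SKIP
  | Assign string aexp
  | Put string aexp aexp
  | Seq com com
  | If bexp com com
  | While bexp com

record state =
  reg :: "string \<Rightarrow> nat"
  arr :: "string \<Rightarrow> nat \<Rightarrow> nat"

fun aval :: "aexp \<Rightarrow> state \<Rightarrow> nat" where
  "aval (N k) s = k"
| "aval (V x) s = reg s x"
| "aval (Get a e) s = arr s a (aval e s)"
| "aval (Plus e f) s = aval e s + aval f s"
| "aval (Minus e f) s = aval e s - aval f s"

fun bval :: "bexp \<Rightarrow> state \<Rightarrow> bool" where
  "bval (Less e f) s \<longleftrightarrow> aval e s < aval f s"
| "bval (Eq e f) s \<longleftrightarrow> aval e s = aval f s"
| "bval (Not b) s \<longleftrightarrow> \<not> bval b s"
| "bval (And b d) s \<longleftrightarrow> bval b s \<and> bval d s"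

fun acost :: "aexp \<Rightarrow> nat" where
  "acost (N k) = 1"
| "acost (V x) = 1"
| "acost (Get a e) = acost e + 1"
| "acost (Plus e f) = acost e + acost f + 1"
| "acost (Minus e f) = acost e + acost f + 1"

fun bcost :: "bexp \<Rightarrow> nat" where
  "bcost (Less e f) = acost e + acost f + 1"
| "bcost (Eq e f) = acost e + acost f + 1"
| "bcost (Not b) = bcost b + 1"
| "bcost (And b d) = bcost b + bcost d + 1"

fun afits :: "nat \<Rightarrow> aexp \<Rightarrow> state \<Rightarrow> bool" where
  "afits W (N k) s \<longleftrightarrow> k < W"
| "afits W (V x) s \<longleftrightarrow> reg s x < W"
| "afits W (Get a e) s \<longleftrightarrow> afits W e s \<and> arr s a (aval e s) < W"
| "afits W (Plus e f) s \<longleftrightarrow> afits W e s \<and> afits W f s \<and> aval e s + aval f s < W"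
| "afits W (Minus e f) s \<longleftrightarrow> afits W e s \<and> afits W f s"

fun bfits :: "nat \<Rightarrow> bexp \<Rightarrow> state \<Rightarrow> bool" where
  "bfits W (Less e f) s \<longleftrightarrow> afits W e s \<and> afits W f s"
| "bfits W (Eq e f) s \<longleftrightarrow> afits W e s \<and> afits W f s"
| "bfits W (Not b) s \<longleftrightarrow> bfits W b s"
| "bfits W (And b d) s \<longleftrightarrow> bfits W b s \<and> bfits W d s"

text \<open>
  \<^term>\<open>exec W p s t s'\<close>: started in \<^term>\<open>s\<close>, the program \<^term>\<open>p\<close> halts in
  \<^term>\<open>s'\<close> after \<^term>\<open>t\<close> elementary operations, all numbers being below \<^term>\<open>W\<close>.
\<close>

inductive exec :: "nat \<Rightarrow> com \<Rightarrow> state \<Rightarrow> nat \<Rightarrow> state \<Rightarrow> bool" for W where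
  Skip: "exec W SKIP s 1 s"
| Assign: "afits W e s \<Longrightarrow>
    exec W (Assign x e) s (acost e + 1) (s\<lparr>reg := (reg s)(x := aval e s)\<rparr>)"
| Put: "afits W i s \<Longrightarrow> afits W e s \<Longrightarrow>
    exec W (Put a i e) s (acost i + acost e + 1)
      (s\<lparr>arr := (arr s)(a := (arr s a)(aval i s := aval e s))\<rparr>)"
| Seq: "exec W p s t s' \<Longrightarrow> exec W q s' t' s'' \<Longrightarrow> exec W (Seq p q) s (t + t') s''"
| IfTrue: "bfits W b s \<Longrightarrow> bval b s \<Longrightarrow> exec W p s t s' \<Longrightarrow>
    exec W (If b p q) s (bcost b + t + 1) s'"
| IfFalse: "bfits W b s \<Longrightarrow> \<not> bval b s \<Longrightarrow> exec W q s t s' \<Longrightarrow>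
    exec W (If b p q) s (bcost b + t + 1) s'"
| WhileFalse: "bfits W b s \<Longrightarrow> \<not> bval b s \<Longrightarrow> exec W (While b p) s (bcost b + 1) s"
| WhileTrue: "bfits W b s \<Longrightarrow> bval b s \<Longrightarrow> exec W p s t s' \<Longrightarrow>
    exec W (While b p) s' t' s'' \<Longrightarrow> exec W (While b p) s (bcost b + t + t' + 1) s''"

lemma exec_deterministic:
  "exec W p s t s' \<Longrightarrow> exec W p s u s'' \<Longrightarrow> t = u \<and> s' = s''"
proof (induction arbitrary: u s'' rule: exec.induct)
  case (Seq p s t s' q t' s2)
  from Seq.prems show ?case
    by cases (use Seq.IH in blast)
next
  case (WhileTrue b s p t s' t' s2)
  from WhileTrue.prems show ?case
    by cases (use WhileTrue.hyps WhileTrue.IH in blast)+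
qed (erule exec.cases; force)+


section \<open>Input and output\<close>

definition adjacency_lists :: "nat ugraph \<Rightarrow> nat list list \<Rightarrow> bool" where
  "adjacency_lists G adj \<longleftrightarrow> verts G = {..<length adj} \<and>
     (\<forall>v < length adj. distinct (adj ! v) \<and> set (adj ! v) = {u. {u, v} \<in> edges G})"

text \<open>
  The neighbours of \<^term>\<open>v\<close> are stored in the array \<open>adj\<close> at the positions from
  \<open>off[v]\<close> to \<open>off[v+1] - 1\<close>; all other memory is zero.
\<close>

definition input_state :: "nat list list \<Rightarrow> state" where
  "input_state adj = \<lparr>
     reg = (\<lambda>_. 0)(''n'' := length adj),
     arr = (\<lambda>_ _. 0)(
       ''off'' := (\<lambda>v. if v \<le> length adj then length (concat (take v adj)) else 0),
       ''adj'' := (\<lambda>i. if i < length (concat adj) then concat adj ! i else 0))\<rparr>"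

text \<open>
  The register \<open>k\<close> holds the number of computed subgraphs; the vertex set of the \<open>i\<close>-th
  one, for \<open>i\<close> from 1 to \<open>k\<close>, consists of the vertices labelled \<open>i\<close> in the array \<open>label\<close>.
\<close>

definition output_subgraph :: "nat ugraph \<Rightarrow> state \<Rightarrow> nat \<Rightarrow> nat ugraph" where
  "output_subgraph G s i = induced G {v \<in> verts G. arr s ''label'' v = i}"

definition output_collection :: "nat ugraph \<Rightarrow> state \<Rightarrow> nat ugraph set" where
  "output_collection G s = output_subgraph G s ` {1..reg s ''k''}"

definition decides_at :: "state \<Rightarrow> nat \<Rightarrow> bool \<Rightarrow> bool" where
  "decides_at s v P \<longleftrightarrow> arr s ''answer'' v = (if P then 1 else 0)"

end

theory Submission
  imports Defs
begin

text \<open>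
  Split \<^term>\<open>G\<close> into its components, these into their co-components, and so on alternately. The
  parts that cannot be split any further are the maximal connected and co-connected induced
  subgraphs. Splitting preserves avoidability, except that a universal vertex of a connected part is
  avoidable only if the part is complete. An unsplittable part that is a tree or the complement of a
  tree has too few edges or non-edges for the collection; there the avoidable vertices are the
  leaves, respectively the non-leaves of the complement, and these are read off from the degrees.

  Every part is a module of \<^term>\<open>G\<close>, so a maximum cardinality search order of \<^term>\<open>G\<close> restricts
  to one of each part. In such an order the components of a part are consecutive, and a component
  starts at every vertex without an earlier neighbour in the part. With an order of \<^term>\<open>G\<close>, one
  of the complement, and the numbers of earlier (non-)neighbours at hand, a part \<open>X\<close> is thus split in
  time \<open>O(|X|)\<close> without looking at edges. Splitting into co-components separates at least \<open>|X| - 1\<close>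
  adjacent pairs, which pays for the split itself and for the next one.
\<close>

section \<open>Weakest preconditions with running time\<close>

text \<open>Listing the non-edges may take quadratic time, so the complement is never built: a
  vertex with few visited neighbours has many visited non-neighbours, and this preference needs only
  the edges. Maximum cardinality search fits because its choices depend on comparisons of counters,
  and the vertices of a module get the same contribution to their counters from outside. For the
  same reason the degrees in the whole graph and inside a part differ by a constant, so the leaves
  of a tree, or of the complement of one, are recognised as the vertices of extremal degree although
  the constant is never computed. The sum of the earlier-(non-)neighbour counts over a part is its
  number of (non-)edges; such sums can be of order n^2, which forces words of that size. The
  exception for universal vertices concerns parts of one vertex, and one bit per part, fixed when
  the part is split off, records it.\<close>

definition wp :: "nat \<Rightarrow> com \<Rightarrow> (nat \<Rightarrow> state \<Rightarrow> bool) \<Rightarrow> state \<Rightarrow> bool" where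
  "wp W p Q s \<longleftrightarrow> (\<exists>t s'. exec W p s t s' \<and> Q t s')"

lemma wp_mono:
  "wp W p Q s \<Longrightarrow> (\<And>t s'. Q t s' \<Longrightarrow> Q' t s') \<Longrightarrow> wp W p Q' s"
  unfolding wp_def by blast

inductive_cases exec_SKIP: "exec W SKIP s t s'"
inductive_cases exec_Assign: "exec W (Assign x e) s t s'"
inductive_cases exec_Put: "exec W (Put a i e) s t s'"
inductive_cases exec_Seq: "exec W (Seq p q) s t s'"
inductive_cases exec_If: "exec W (If b p q) s t s'"

lemma wp_SKIP [simp]: "wp W SKIP Q s \<longleftrightarrow> Q 1 s"
  unfolding wp_def by (metis exec.Skip exec_SKIP)

lemma wp_Assign [simp]:
  "wp W (Assign x e) Q s \<longleftrightarrow>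
     afits W e s \<and> Q (acost e + 1) (s\<lparr>reg := (reg s)(x := aval e s)\<rparr>)"
  unfolding wp_def by (metis exec.Assign exec_Assign)

lemma wp_Put [simp]:
  "wp W (Put a i e) Q s \<longleftrightarrow> afits W i s \<and> afits W e s \<and>
     Q (acost i + acost e + 1) (s\<lparr>arr := (arr s)(a := (arr s a)(aval i s := aval e s))\<rparr>)"
  unfolding wp_def by (metis exec.Put exec_Put)

lemma wp_Seq [simp]:
  "wp W (Seq p q) Q s \<longleftrightarrow> wp W p (\<lambda>t. wp W q (\<lambda>t'. Q (t + t'))) s"
  unfolding wp_def by (auto elim!: exec_Seq intro: exec.Seq)

lemma wp_If [simp]:
  "wp W (If b p q) Q s \<longleftrightarrow> bfits W b s \<and>
     (bval b s \<longrightarrow> wp W p (\<lambda>t. Q (bcost b + t + 1)) s) \<and>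
     (\<not> bval b s \<longrightarrow> wp W q (\<lambda>t. Q (bcost b + t + 1)) s)"
  unfolding wp_def by (auto elim!: exec_If; metis exec.IfTrue exec.IfFalse Suc_eq_plus1)

section \<open>Frame conditions and the loop rule\<close>

fun rmod :: "com \<Rightarrow> string set" where
  "rmod (Assign x e) = {x}"
| "rmod (Seq p q) = rmod p \<union> rmod q"
| "rmod (If b p q) = rmod p \<union> rmod q"
| "rmod (While b p) = rmod p"
| "rmod _ = {}"

fun amod :: "com \<Rightarrow> string set" where
  "amod (Put a i e) = {a}"
| "amod (Seq p q) = amod p \<union> amod q"
| "amod (If b p q) = amod p \<union> amod q"
| "amod (While b p) = amod p"
| "amod _ = {}"

text \<open>A program cannot change what it never names as a target. With this syntactic condition
  at hand, invariants and specifications only speak of what is written.\<close>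

definition frame :: "com \<Rightarrow> state \<Rightarrow> state \<Rightarrow> bool" where
  "frame p s s' \<longleftrightarrow> (\<forall>x. x \<notin> rmod p \<longrightarrow> reg s' x = reg s x) \<and>
     (\<forall>a. a \<notin> amod p \<longrightarrow> arr s' a = arr s a)"

lemma frame_refl: "frame p s s"
  by (simp add: frame_def)

lemma frame_trans: "frame p s s' \<Longrightarrow> frame p s' s'' \<Longrightarrow> frame p s s''"
  by (simp add: frame_def)

lemma frame_reg: "frame p s s' \<Longrightarrow> x \<notin> rmod p \<Longrightarrow> reg s' x = reg s x"
  by (simp add: frame_def)

lemma frame_arr: "frame p s s' \<Longrightarrow> a \<notin> amod p \<Longrightarrow> arr s' a = arr s a"
  by (simp add: frame_def)

lemma exec_frame: "exec W p s t s' \<Longrightarrow> frame p s s'"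
  by (induction rule: exec.induct) (auto simp: frame_def)

lemma wp_frame: "wp W p Q s \<Longrightarrow> wp W p (\<lambda>t s'. Q t s' \<and> frame p s s') s"
  unfolding wp_def using exec_frame by blast

text \<open>The number \<^term>\<open>k\<close> is the time credit that is left.\<close>

lemma wp_While:
  assumes "I k s0"
    and fits: "\<And>s k. I k s \<Longrightarrow> frame p s0 s \<Longrightarrow> bfits W b s"
    and step: "\<And>s k. I k s \<Longrightarrow> frame p s0 s \<Longrightarrow> bval b s \<Longrightarrow>
      wp W p (\<lambda>t s'. \<exists>k'. I k' s' \<and> k' + t + bcost b + 1 \<le> k) s"
  shows "wp W (While b p) (\<lambda>t s'. (\<exists>k'. I k' s' \<and> k' + t \<le> k + bcost b + 1)
    \<and> \<not> bval b s' \<and> frame p s0 s') s0"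
proof -
  have "I k s \<Longrightarrow> frame p s0 s \<Longrightarrow>
      wp W (While b p) (\<lambda>t s'. (\<exists>k'. I k' s' \<and> k' + t \<le> k + bcost b + 1)
        \<and> \<not> bval b s' \<and> frame p s0 s') s" for s
  \<comment> \<open>Every iteration consumes at least one unit of credit, so the credit is also the
    termination measure.\<close>
  proof (induction k arbitrary: s rule: less_induct)
    case (less k)
    show ?case
    proof (cases "bval b s")
      case False
      then have "exec W (While b p) s (bcost b + 1) s"
        using fits less.prems by (blast intro: exec.WhileFalse)
      then show ?thesis unfolding wp_def using less.prems False by (metis add.assoc order_refl)
    next
      case True
      from step[OF less.prems True] obtain t s' k' where
        1: "exec W p s t s'" "I k' s'" "k' + t + bcost b + 1 \<le> k"
        unfolding wp_def by blast
      have fr: "frame p s0 s'" using 1(1) exec_frame frame_trans less.prems(2) by blast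
      from less.IH[OF _ 1(2) fr] 1(3) obtain t' s'' k'' where
        2: "exec W (While b p) s' t' s''" "I k'' s''" "k'' + t' \<le> k' + bcost b + 1"
          "\<not> bval b s''" "frame p s0 s''"
        unfolding wp_def by auto
      have "exec W (While b p) s (bcost b + t + t' + 1) s''"
        using fits less.prems True 1(1) 2(1) by (blast intro: exec.WhileTrue)
      moreover have "k'' + (bcost b + t + t' + 1) \<le> k + bcost b + 1" using 1(3) 2(3) by linarith
      ultimately show ?thesis unfolding wp_def using 2 by blast
    qed
  qed
  then show ?thesis using assms(1) frame_refl by blast
qed

section \<open>Sequences and counted loops\<close>

fun seqs :: "com list \<Rightarrow> com" where
  "seqs [] = SKIP"
| "seqs [p] = p"
| "seqs (p # q # ps) = Seq p (seqs (q # ps))"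

lemma wp_seqs:
  assumes "wp W p R s" "\<And>t s'. R t s' \<Longrightarrow> wp W (seqs (q # ps)) (\<lambda>t'. Q (t + t')) s'"
  shows "wp W (seqs (p # q # ps)) Q s"
  using wp_mono[OF assms] by simp

lemma wp_seqs_single: "wp W p Q s \<Longrightarrow> wp W (seqs [p]) Q s"
  by simp

definition For :: "string \<Rightarrow> string \<Rightarrow> com \<Rightarrow> com" where
  "For x h p = While (Less (V x) (V h)) (Seq p (Assign x (Plus (V x) (N 1))))"

lemma rmod_For [simp]: "rmod (For x h p) = insert x (rmod p)"
  by (auto simp: For_def)

lemma amod_For [simp]: "amod (For x h p) = amod p"
  by (auto simp: For_def)

text \<open>Each round costs 4 for the test and 4 for advancing the counter, hence the 8; the last 4
  pays for the failing test. The invariant has the counter as an argument and is re-established for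
  the state in which the counter is already advanced, since the body itself must not write
  it.\<close>

lemma wp_For:
  assumes I0: "I (reg s0 x) s0"
    and le: "reg s0 x \<le> reg s0 h" and W: "reg s0 h < W" "1 < W"
    and h: "h \<noteq> x" "h \<notin> rmod p" and x: "x \<notin> rmod p"
    and step: "\<And>s i. I i s \<Longrightarrow> frame (For x h p) s0 s \<Longrightarrow> reg s x = i \<Longrightarrow> reg s0 x \<le> i \<Longrightarrow>
      i < reg s0 h \<Longrightarrow> wp W p (\<lambda>t s'. t \<le> K \<and> I (Suc i) (s'\<lparr>reg := (reg s')(x := Suc i)\<rparr>)) s"
  shows "wp W (For x h p) (\<lambda>t s'. t \<le> (K + 8) * (reg s0 h - reg s0 x) + 4 \<and>
    I (reg s0 h) s' \<and> reg s' x = reg s0 h \<and> frame (For x h p) s0 s') s0"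
proof -
  let ?q = "Seq p (Assign x (Plus (V x) (N 1)))"
  let ?b = "Less (V x) (V h)"
  let ?J = "\<lambda>k s. I (reg s x) s \<and> reg s0 x \<le> reg s x \<and> reg s x \<le> reg s0 h \<and>
    k = (K + 8) * (reg s0 h - reg s x)"
  have fr: "frame ?q = frame (For x h p)"
    by (auto simp: frame_def fun_eq_iff)
  have "wp W (While ?b ?q) (\<lambda>t s'. (\<exists>k'. ?J k' s' \<and> k' + t \<le>
      (K + 8) * (reg s0 h - reg s0 x) + bcost ?b + 1) \<and> \<not> bval ?b s' \<and> frame ?q s0 s') s0"
  proof (rule wp_While)
    show "?J ((K + 8) * (reg s0 h - reg s0 x)) s0" using I0 le by simp
  next
    fix s k assume "?J k s" "frame ?q s0 s"
    then show "bfits W ?b s" using W h by (auto simp: frame_def)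
  next
    fix s k assume J: "?J k s" and f: "frame ?q s0 s" and b: "bval ?b s"
    have hh: "reg s h = reg s0 h" using f h by (auto simp: frame_def)
    then have lt: "reg s x < reg s0 h" using b by simp
    have "wp W p (\<lambda>t s'. (t \<le> K \<and>
        I (Suc (reg s x)) (s'\<lparr>reg := (reg s')(x := Suc (reg s x))\<rparr>)) \<and> frame p s s') s"
      using step[of "reg s x" s] J f lt fr by (intro wp_frame) auto
    then show "wp W ?q (\<lambda>t s'. \<exists>k'. ?J k' s' \<and> k' + t + bcost ?b + 1 \<le> k) s"
      unfolding wp_Seq
    proof (rule wp_mono, elim conjE)
      fix t s' assume t: "t \<le> K"
        and I: "I (Suc (reg s x)) (s'\<lparr>reg := (reg s')(x := Suc (reg s x))\<rparr>)"
        and f': "frame p s s'"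
      have xx: "reg s' x = reg s x" using f' x by (simp add: frame_def)
      have "(K + 8) * (reg s0 h - Suc (reg s x)) + (K + 8) = (K + 8) * (reg s0 h - reg s x)"
        using lt by (metis Suc_diff_Suc add.commute mult_Suc_right)
      then show "wp W (Assign x (Plus (V x) (N 1)))
        (\<lambda>t'. (\<lambda>s'. \<exists>k'. ?J k' s' \<and> k' + (t + t') + bcost ?b + 1 \<le> k)) s'"
        using t I xx lt J W by auto
    qed
  qed
  then show ?thesis unfolding For_def[symmetric]
    by (rule wp_mono) (use h fr in \<open>auto simp: frame_def\<close>)
qed

section \<open>Connectivity and edge counts\<close>

text \<open>Connectivity by cuts instead of paths. It is mostly used in this form, as an edge that
  leaves a given proper part, and being stated for a relation it serves the graph and the complement
  alike.\<close>

definition conn :: "('a \<Rightarrow> 'a \<Rightarrow> bool) \<Rightarrow> 'a set \<Rightarrow> bool" where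
  "conn R X \<longleftrightarrow> X \<noteq> {} \<and> (\<forall>Y. Y \<subset> X \<and> Y \<noteq> {} \<longrightarrow> (\<exists>u\<in>Y. \<exists>v\<in>X - Y. R u v))"

lemma conn_cong:
  assumes "\<And>u v. u \<in> X \<Longrightarrow> v \<in> X \<Longrightarrow> u \<noteq> v \<Longrightarrow> R u v = R' u v"
  shows "conn R X \<longleftrightarrow> conn R' X"
proof -
  have "(\<exists>u\<in>Y. \<exists>v\<in>X - Y. R u v) \<longleftrightarrow> (\<exists>u\<in>Y. \<exists>v\<in>X - Y. R' u v)" if "Y \<subset> X" for Y
  proof (intro bex_cong refl)
    fix u v assume "u \<in> Y" "v \<in> X - Y"
    then show "R u v = R' u v" using assms[of u v] that by auto
  qed
  then show ?thesis unfolding conn_def by auto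
qed

lemma conn_singleton: "conn R {x}"
  unfolding conn_def by auto

lemma conn_insert:
  assumes "conn R A" "u \<in> A" "R u x" "R x u"
  shows "conn R (insert x A)"
  unfolding conn_def
proof (intro conjI allI impI)
  fix Y assume Y: "Y \<subset> insert x A \<and> Y \<noteq> {}"
  show "\<exists>u\<in>Y. \<exists>v\<in>insert x A - Y. R u v"
  proof (cases "Y \<inter> A = {} \<or> A \<subseteq> Y")
    case True
    then show ?thesis
    proof
      assume "Y \<inter> A = {}"
      then have "x \<in> Y" "u \<in> insert x A - Y" using Y assms(2) by auto
      then show ?thesis using assms(4) by (intro bexI)
    next
      assume "A \<subseteq> Y"
      then have "u \<in> Y" "x \<in> insert x A - Y" using Y assms(2) by auto
      then show ?thesis using assms(3) by (intro bexI)
    qed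
  next
    case False
    then have "Y \<inter> A \<subset> A \<and> Y \<inter> A \<noteq> {}" by auto
    then obtain v w where "v \<in> Y \<inter> A" "w \<in> A - (Y \<inter> A)" "R v w"
      using assms(1) unfolding conn_def by meson
    then show ?thesis by auto
  qed
qed simp

lemma conn_neighbour:
  assumes "conn R X" "v \<in> X" "2 \<le> card X"
  obtains w where "w \<in> X" "w \<noteq> v" "R v w"
proof -
  have "{v} \<subset> X \<and> {v} \<noteq> {}" using assms by auto
  then obtain u w where "u \<in> {v}" "w \<in> X - {v}" "R u w"
    using assms(1) unfolding conn_def by meson
  then show ?thesis using that by auto
qed

text \<open>A walk that ends outside \<open>Y\<close> has a step that leaves \<open>Y\<close>.
  Conversely no edge leaves the set of vertices reachable from \<open>u\<close>, so by the cut
  property that set is everything.\<close>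

lemma connected_iff_conn:
  assumes "\<forall>e\<in>edges H. e \<subseteq> verts H"
  shows "connected H \<longleftrightarrow> conn (\<lambda>u v. {u, v} \<in> edges H) (verts H)"
proof
  assume H: "connected H"
  show "conn (\<lambda>u v. {u, v} \<in> edges H) (verts H)"
    unfolding conn_def
  proof (intro conjI allI impI)
    show "verts H \<noteq> {}" using H by (simp add: connected_def)
  next
    fix Y assume Y: "Y \<subset> verts H \<and> Y \<noteq> {}"
    then obtain u v where uv: "u \<in> Y" "v \<in> verts H - Y" by blast
    then have "u \<in> verts H" "v \<in> verts H" using Y by auto
    then have "(u, v) \<in> {(x, y). {x, y} \<in> edges H}\<^sup>*"
      using H unfolding connected_def by simp
    then have "v \<notin> Y \<longrightarrow> (\<exists>u\<in>Y. \<exists>v\<in>verts H - Y. {u, v} \<in> edges H)"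
    proof (induction rule: rtrancl_induct)
      case base
      then show ?case using uv by simp
    next
      case (step y z)
      then show ?case using assms by auto
    qed
    then show "\<exists>u\<in>Y. \<exists>v\<in>verts H - Y. {u, v} \<in> edges H" using uv by simp
  qed
next
  assume c: "conn (\<lambda>u v. {u, v} \<in> edges H) (verts H)"
  show "connected H" unfolding connected_def
  proof (intro conjI ballI)
    show "verts H \<noteq> {}" using c by (simp add: conn_def)
  next
    fix u v assume uv: "u \<in> verts H" "v \<in> verts H"
    let ?r = "{(x, y). {x, y} \<in> edges H}"
    let ?Y = "{w \<in> verts H. (u, w) \<in> ?r\<^sup>*}"
    have "?Y = verts H"
    proof (rule ccontr)
      assume "?Y \<noteq> verts H"
      then have "?Y \<subset> verts H \<and> ?Y \<noteq> {}" using uv by auto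
      then obtain x y where "x \<in> ?Y" "y \<in> verts H - ?Y" "{x, y} \<in> edges H"
        using c unfolding conn_def by meson
      moreover then have "(u, y) \<in> ?r\<^sup>*" by (auto intro: rtrancl_into_rtrancl)
      ultimately show False by blast
    qed
    then show "(u, v) \<in> ?r\<^sup>*" using uv by blast
  qed
qed

section \<open>Degree sums and numbers of edges\<close>

definition num_nbrs :: "('a \<Rightarrow> 'a \<Rightarrow> bool) \<Rightarrow> 'a set \<Rightarrow> 'a \<Rightarrow> nat" where
  "num_nbrs R A y = card {z \<in> A. R z y}"

text \<open>Ordered pairs, so every edge counts twice: this makes the count equal to the degree sum
  and keeps comparisons of edges with vertices free of division.\<close>

definition arcs :: "('a \<Rightarrow> 'a \<Rightarrow> bool) \<Rightarrow> 'a set \<Rightarrow> ('a \<times> 'a) set" where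
  "arcs R X = {(u, v). u \<in> X \<and> v \<in> X \<and> R u v}"

lemma finite_arcs [simp]: "finite X \<Longrightarrow> finite (arcs R X)"
  by (rule finite_subset[of _ "X \<times> X"]) (auto simp: arcs_def)

lemma card_arcs:
  assumes "finite X"
  shows "card (arcs R X) = (\<Sum>x\<in>X. num_nbrs R X x)"
proof -
  have "arcs R X = prod.swap ` (SIGMA x:X. {z \<in> X. R z x})" by (force simp: arcs_def)
  then have "card (arcs R X) = card (SIGMA x:X. {z \<in> X. R z x})" by (simp add: card_image)
  then show ?thesis using assms by (simp add: num_nbrs_def)
qed

lemma card_arcs_insert:
  assumes "finite X" "x \<notin> X" "symp R" "\<not> R x x"
  shows "card (arcs R (insert x X)) = card (arcs R X) + 2 * num_nbrs R X x"
proof -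
  let ?Z = "{z \<in> X. R z x}"
  have s: "R u v = R v u" for u v using assms(3) by (metis sympD)
  have eq: "arcs R (insert x X) = arcs R X \<union> ((\<lambda>z. (z, x)) ` ?Z \<union> (\<lambda>z. (x, z)) ` ?Z)"
    using assms(4) s by (auto simp: arcs_def)
  have "card ((\<lambda>z. (z, x)) ` ?Z \<union> (\<lambda>z. (x, z)) ` ?Z) = card ?Z + card ?Z"
    using assms by (subst card_Un_disjoint) (auto simp: card_image inj_on_def)
  moreover have "card (arcs R (insert x X)) =
      card (arcs R X) + card ((\<lambda>z. (z, x)) ` ?Z \<union> (\<lambda>z. (x, z)) ` ?Z)"
    unfolding eq by (rule card_Un_disjoint) (use assms in \<open>simp_all, auto simp: arcs_def\<close>)
  ultimately show ?thesis by (simp add: num_nbrs_def)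
qed

lemma card_edges_arcs:
  assumes "finite X" "symp R" "\<And>x. \<not> R x x"
  shows "2 * card {{u, v} | u v. u \<in> X \<and> v \<in> X \<and> R u v} = card (arcs R X)"
  using assms(1)
proof (induction X rule: finite_induct)
  case empty
  then show ?case by (simp add: arcs_def)
next
  case (insert x X)
  let ?E = "\<lambda>X. {{u, v} | u v. u \<in> X \<and> v \<in> X \<and> R u v}"
  let ?Z = "{z \<in> X. R z x}"
  have s: "R u v = R v u" for u v using assms(2) by (metis sympD)
  have eq: "?E (insert x X) = ?E X \<union> (\<lambda>z. {z, x}) ` ?Z"
  proof (intro set_eqI iffI)
    fix e assume "e \<in> ?E (insert x X)"
    then obtain u v where "e = {u, v}" "u \<in> insert x X" "v \<in> insert x X" "R u v" by blast
    then show "e \<in> ?E X \<union> (\<lambda>z. {z, x}) ` ?Z"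
      using assms(3)[of x] s[of x v] by (cases "u = x"; cases "v = x") (auto simp: insert_commute)
  qed auto
  have "?E X \<subseteq> Pow X" by auto
  then have fin: "finite (?E X)" using insert.hyps(1) finite_subset by blast
  have "card (?E (insert x X)) = card (?E X) + card ((\<lambda>z. {z, x}) ` ?Z)"
    unfolding eq by (rule card_Un_disjoint) (use fin insert.hyps in \<open>auto simp: doubleton_eq_iff\<close>)
  also have "card ((\<lambda>z. {z, x}) ` ?Z) = num_nbrs R X x"
    unfolding num_nbrs_def by (rule card_image) (auto simp: inj_on_def doubleton_eq_iff)
  finally show ?case using insert card_arcs_insert[of X x R] assms by simp
qed

text \<open>By connectivity \<open>Y\<close> can be extended by one vertex at a time along an edge
  leaving it. Each new vertex brings at least one edge, so once there are as many edges as vertices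
  this remains so up to \<open>X\<close>.\<close>

lemma card_arcs_ge_growth:
  assumes "finite X" "symp R" "\<And>x. \<not> R x x" "conn R X"
    "Y \<subseteq> X" "Y \<noteq> {}" "2 * card Y \<le> card (arcs R Y)"
  shows "2 * card X \<le> card (arcs R X)"
  using assms(5-)
proof (induction "card (X - Y)" arbitrary: Y)
  case 0
  then have "X - Y = {}" using assms(1) by simp
  then have "Y = X" using 0(2) by auto
  then show ?case using 0(4) by simp
next
  case (Suc k)
  have "X - Y \<noteq> {}" using Suc.hyps(2) by (metis card.empty nat.distinct(1))
  then have "Y \<subset> X \<and> Y \<noteq> {}" using Suc.prems(1,2) by auto
  then obtain u v where uv: "u \<in> Y" "v \<in> X - Y" "R u v"
    using assms(4) unfolding conn_def by meson
  have fin: "finite Y" using Suc.prems assms(1) finite_subset by blast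
  have "u \<in> {z \<in> Y. R z v}" using uv by simp
  then have "1 \<le> num_nbrs R Y v" unfolding num_nbrs_def using fin
    by (auto simp: Suc_le_eq card_gt_0_iff)
  then have "2 * card (insert v Y) \<le> card (arcs R (insert v Y))"
    using card_arcs_insert[of Y v R] fin uv assms(2,3) Suc.prems(3) by auto
  moreover have "k = card (X - insert v Y)"
  proof -
    have "X - Y = insert v (X - insert v Y)" using uv by auto
    then have "card (X - Y) = card (insert v (X - insert v Y))" by (rule arg_cong)
    also have "\<dots> = Suc (card (X - insert v Y))" by (rule card_insert_disjoint) (use assms(1) in auto)
    finally have "card (X - Y) = Suc (card (X - insert v Y))" .
    then show ?thesis using Suc.hyps(2) by simp
  qed
  moreover have "insert v Y \<subseteq> X" "insert v Y \<noteq> {}" using uv Suc.prems(1) by auto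
  ultimately show ?case using Suc.hyps(1) by presburger
qed

lemma num_nbrs_ge_2:
  assumes "finite Y" "p \<in> Y" "q \<in> Y" "p \<noteq> q" "R p y" "R q y"
  shows "2 \<le> num_nbrs R Y y"
proof -
  have "card {p, q} \<le> card {z \<in> Y. R z y}" by (rule card_mono) (use assms in auto)
  then show ?thesis using assms by (simp add: num_nbrs_def)
qed

text \<open>A set in which every vertex has two neighbours contains a cycle.\<close>

lemma card_arcs_ge_cycle:
  assumes "finite X" "symp R" "\<And>x. \<not> R x x" "conn R X" "Y \<subseteq> X" "Y \<noteq> {}"
    and two: "\<And>y. y \<in> Y \<Longrightarrow> \<exists>p\<in>Y. \<exists>q\<in>Y. p \<noteq> q \<and> R p y \<and> R q y"
  shows "2 * card X \<le> card (arcs R X)"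
proof -
  have fin: "finite Y" using assms finite_subset by blast
  have "(\<Sum>y\<in>Y. 2) \<le> (\<Sum>y\<in>Y. num_nbrs R Y y)"
  proof (rule sum_mono)
    fix y assume "y \<in> Y"
    then obtain p q where "p \<in> Y" "q \<in> Y" "p \<noteq> q" "R p y" "R q y" using two by blast
    then show "2 \<le> num_nbrs R Y y" by (rule num_nbrs_ge_2[OF fin])
  qed
  then have "2 * card Y \<le> card (arcs R Y)" using card_arcs[OF fin, of R] by simp
  then show ?thesis by (rule card_arcs_ge_growth[OF assms(1-6)])
qed

section \<open>Maximum cardinality search orders\<close>

definition mcs :: "('a \<Rightarrow> 'a \<Rightarrow> bool) \<Rightarrow> 'a list \<Rightarrow> bool" where
  "mcs R xs \<longleftrightarrow>
     (\<forall>ys x zs. xs = ys @ x # zs \<longrightarrow> (\<forall>y\<in>set zs. num_nbrs R (set ys) y \<le> num_nbrs R (set ys) x))"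

text \<open>The counts \<open>d\<close> travel with the order because they are all that the later
  steps consult: a zero marks the start of a component, and their sum is the number of
  edges.\<close>

definition search_order ::
    "('a \<Rightarrow> 'a \<Rightarrow> bool) \<Rightarrow> 'a set \<Rightarrow> 'a list \<Rightarrow> ('a \<Rightarrow> nat) \<Rightarrow> bool" where
  "search_order R X xs d \<longleftrightarrow> distinct xs \<and> set xs = X \<and> mcs R xs \<and>
     (\<forall>ys x zs. xs = ys @ x # zs \<longrightarrow> d x = num_nbrs R (set ys) x)"

lemma search_orderD:
  assumes "search_order R X xs d"
  shows "distinct xs" "set xs = X" "mcs R xs"
  using assms unfolding search_order_def by simp_all

lemma search_order_d:
  assumes "search_order R X (ys @ x # zs) d"
  shows "d x = num_nbrs R (set ys) x"
proof -
  have "\<forall>us y vs. ys @ x # zs = us @ y # vs \<longrightarrow> d y = num_nbrs R (set us) y"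
    using assms unfolding search_order_def by (elim conjE)
  then show ?thesis by (elim allE) (erule mp, rule refl)
qed

lemma mcsD:
  assumes "mcs R (ys @ x # zs)" "y \<in> set zs"
  shows "num_nbrs R (set ys) y \<le> num_nbrs R (set ys) x"
proof -
  have "ys @ x # zs = ys @ x # zs \<longrightarrow> (\<forall>y\<in>set zs. num_nbrs R (set ys) y \<le> num_nbrs R (set ys) x)"
    using assms(1) unfolding mcs_def by (elim allE)
  then show ?thesis using assms(2) by simp
qed

lemma filter_eq_append_ConsD:
  "filter P xs = ys @ x # zs \<Longrightarrow>
     \<exists>ys' zs'. xs = ys' @ x # zs' \<and> filter P ys' = ys \<and> filter P zs' = zs \<and> P x"
proof (induction xs arbitrary: ys)
  case (Cons a xs)
  show ?case
  proof (cases "P a \<and> ys = []")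
    case True
    then show ?thesis using Cons.prems by (intro exI[of _ "[]"] exI[of _ xs]) simp
  next
    case False
    then obtain ys1 where ys1: "filter P xs = ys1 @ x # zs" "ys = (if P a then a # ys1 else ys1)"
      using Cons.prems by (cases ys) (auto split: if_splits)
    then obtain ys' zs' where
      "xs = ys' @ x # zs' \<and> filter P ys' = ys1 \<and> filter P zs' = zs \<and> P x"
      using Cons.IH by blast
    then show ?thesis using ys1 by (intro exI[of _ "a # ys'"] exI[of _ zs']) simp
  qed
qed simp

text \<open>All vertices of a module \<^term>\<open>Y\<close> see the same visited vertices outside, so the search
  restricted to \<^term>\<open>Y\<close> is a search of \<^term>\<open>Y\<close>.\<close>

lemma search_order_filter:
  assumes so: "search_order R X xs d" and "Y \<subseteq> X"
    and t: "\<And>u y. u \<in> X - Y \<Longrightarrow> y \<in> Y \<Longrightarrow> R u y = t"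
    and d': "\<And>ys x zs. xs = ys @ x # zs \<Longrightarrow> x \<in> Y \<Longrightarrow>
      d' x = d x - (if t then card (set ys - Y) else 0)"
  shows "search_order R Y (filter (\<lambda>v. v \<in> Y) xs) d'"
proof -
  have dx: "distinct xs" and sx: "set xs = X" and m: "mcs R xs"
    and dd: "\<And>ys x zs. xs = ys @ x # zs \<Longrightarrow> d x = num_nbrs R (set ys) x"
    using search_orderD[OF so] search_order_d[of R X _ _ _ d] so by simp_all
  \<comment> \<open>Seen from any \<open>y\<close> in \<open>Y\<close>, the visited vertices outside
    \<open>Y\<close> are all adjacent or all non-adjacent. Their contribution is independent of
    \<open>y\<close> and cancels when two candidates are compared.\<close>
  have num_nbrs: "num_nbrs R A y = num_nbrs R (A \<inter> Y) y + (if t then card (A - Y) else 0)"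
    if "A \<subseteq> X" "y \<in> Y" for A y
  proof -
    have finA: "finite A" using that sx finite_subset by blast
    show ?thesis
    proof (cases t)
      case True
      have "{z \<in> A. R z y} = {z \<in> A \<inter> Y. R z y} \<union> (A - Y)"
        using t[of _ y] that True by blast
      then have "card {z \<in> A. R z y} = card ({z \<in> A \<inter> Y. R z y} \<union> (A - Y))" by (rule arg_cong)
      also have "\<dots> = card {z \<in> A \<inter> Y. R z y} + card (A - Y)"
        by (rule card_Un_disjoint) (use finA in auto)
      finally show ?thesis using True by (simp add: num_nbrs_def)
    next
      case False
      have "{z \<in> A. R z y} = {z \<in> A \<inter> Y. R z y}" using t[of _ y] that False by blast
      then show ?thesis using False unfolding num_nbrs_def by presburger
    qed
  qed
  have dec: "\<exists>ys' zs'. xs = ys' @ x # zs' \<and> set ys = set ys' \<inter> Y \<and> set zs \<subseteq> set zs' \<inter> Y \<and> x \<in> Y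
      \<and> set ys' \<subseteq> X"
    if eq: "filter (\<lambda>v. v \<in> Y) xs = ys @ x # zs" for ys x zs
  proof -
    obtain ys' zs' where "xs = ys' @ x # zs'" "filter (\<lambda>v. v \<in> Y) ys' = ys"
      "filter (\<lambda>v. v \<in> Y) zs' = zs" "x \<in> Y"
      using filter_eq_append_ConsD[OF eq] by blast
    then show ?thesis using sx by (intro exI[of _ ys'] exI[of _ zs']) auto
  qed
  show ?thesis unfolding search_order_def
  proof (intro conjI allI impI)
    show "distinct (filter (\<lambda>v. v \<in> Y) xs)" using dx by simp
    show "set (filter (\<lambda>v. v \<in> Y) xs) = Y" using sx assms(2) by auto
    show "mcs R (filter (\<lambda>v. v \<in> Y) xs)" unfolding mcs_def
    proof (intro allI impI ballI)
      fix ys x zs y assume "filter (\<lambda>v. v \<in> Y) xs = ys @ x # zs" and y: "y \<in> set zs"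
      then obtain ys' zs' where 1: "xs = ys' @ x # zs'" "set ys = set ys' \<inter> Y"
        "set zs \<subseteq> set zs' \<inter> Y" "x \<in> Y" "set ys' \<subseteq> X" using dec by blast
      then have "num_nbrs R (set ys') y \<le> num_nbrs R (set ys') x" using mcsD[of R ys' x zs' y] m y by blast
      moreover have "y \<in> Y" using 1 y by blast
      ultimately show "num_nbrs R (set ys) y \<le> num_nbrs R (set ys) x"
        using num_nbrs[OF 1(5,4)] num_nbrs[OF 1(5), of y] unfolding 1(2) by linarith
    qed
    fix ys x zs assume "filter (\<lambda>v. v \<in> Y) xs = ys @ x # zs"
    then obtain ys' zs' where 1: "xs = ys' @ x # zs'" "set ys = set ys' \<inter> Y"
      "x \<in> Y" "set ys' \<subseteq> X" using dec by blast
    show "d' x = num_nbrs R (set ys) x"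
      unfolding 1(2) using d'[OF 1(1,3)] dd[OF 1(1)] num_nbrs[OF 1(4,3)] by linarith
  qed
qed

text \<open>The search chooses a vertex without visited neighbours only if no remaining vertex has
  one, so a zero count separates everything before it from everything from there on.\<close>

lemma search_order_cut:
  assumes "search_order R X (ys @ x # zs) d" "d x = 0" "u \<in> set ys" "v \<in> set (x # zs)"
  shows "\<not> R u v"
proof -
  have "d x = num_nbrs R (set ys) x" "\<forall>y\<in>set zs. num_nbrs R (set ys) y \<le> num_nbrs R (set ys) x"
    using search_order_d[OF assms(1)] mcsD[OF search_orderD(3)[OF assms(1)]] by blast+
  then have "num_nbrs R (set ys) v \<le> num_nbrs R (set ys) x" "num_nbrs R (set ys) x = 0"
    using assms(2,4) by auto
  then have "num_nbrs R (set ys) v = 0" by simp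
  then show ?thesis using assms(3) by (auto simp: num_nbrs_def)
qed

text \<open>A nonzero count gives an earlier neighbour, so every prefix stays connected when the
  next vertex is appended.\<close>

lemma search_order_conn:
  assumes "search_order R X (x # xs) d" "symp R" "\<And>y. y \<in> set xs \<Longrightarrow> d y \<noteq> 0"
  shows "conn R X"
proof -
  have "xs = ys @ zs \<Longrightarrow> conn R (set (x # ys))" for ys zs
  proof (induction ys arbitrary: zs rule: rev_induct)
    case Nil
    then show ?case by (simp add: conn_singleton)
  next
    case (snoc y ys)
    have "d y = num_nbrs R (set (x # ys)) y"
    proof -
      have "x # xs = (x # ys) @ y # zs" using snoc.prems by simp
      then show ?thesis using search_order_d[of R X "x # ys" y zs d] assms(1) by simp
    qed
    moreover have "d y \<noteq> 0" using assms(3) snoc.prems by simp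
    ultimately have "{z \<in> set (x # ys). R z y} \<noteq> {}" unfolding num_nbrs_def by (metis card.empty)
    then obtain z where z: "z \<in> set (x # ys)" "R z y" by blast
    have "conn R (insert y (set (x # ys)))"
      by (rule conn_insert[of R _ z]) (use snoc z assms(2) in \<open>auto dest: sympD\<close>)
    then show ?case by (simp add: insert_commute)
  qed
  moreover have "set (x # xs) = X" using search_orderD(2)[OF assms(1)] .
  ultimately show ?thesis by (metis append_Nil2)
qed

text \<open>Every edge is counted exactly once, at its later endpoint; \<open>arcs\<close> counts it
  twice.\<close>

lemma search_order_sum:
  assumes "search_order R X xs d" "symp R" "\<And>x. \<not> R x x"
  shows "2 * (\<Sum>v\<in>X. d v) = card (arcs R X)"
proof -
  have "xs = ys @ zs \<Longrightarrow> 2 * (\<Sum>v\<in>set ys. d v) = card (arcs R (set ys))" for ys zs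
  proof (induction ys arbitrary: zs rule: rev_induct)
    case Nil
    then show ?case by (simp add: arcs_def)
  next
    case (snoc y ys)
    then have "xs = ys @ y # zs" by simp
    then have "d y = num_nbrs R (set ys) y" "y \<notin> set ys"
      using search_order_d[of R X ys y zs d] search_orderD(1)[OF assms(1)] assms(1) by auto
    then show ?case using snoc card_arcs_insert[of "set ys" y R] assms by simp
  qed
  moreover have "set xs = X" using search_orderD(2)[OF assms(1)] .
  ultimately show ?thesis by (metis append_Nil2)
qed

section \<open>Adjacency, non-adjacency and induced cycles\<close>

text \<open>Adjacency for \<^term>\<open>c = False\<close>, adjacency in the complement for \<^term>\<open>c = True\<close>.\<close>

definition rel :: "'a ugraph \<Rightarrow> bool \<Rightarrow> 'a \<Rightarrow> 'a \<Rightarrow> bool" where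
  "rel G c u v \<longleftrightarrow> u \<in> verts G \<and> v \<in> verts G \<and> u \<noteq> v \<and> ({u, v} \<in> edges G) \<noteq> c"

lemma rel_commute: "rel G c u v \<longleftrightarrow> rel G c v u"
  by (auto simp: rel_def insert_commute)

lemma symp_rel: "symp (rel G c)"
  using rel_commute by (metis sympI)

lemma rel_irrefl [simp]: "\<not> rel G c u u"
  by (simp add: rel_def)

lemma rel_True_iff:
  "u \<in> verts G \<Longrightarrow> v \<in> verts G \<Longrightarrow> u \<noteq> v \<Longrightarrow> rel G True u v \<longleftrightarrow> \<not> rel G False u v"
  by (simp add: rel_def)

lemma rel_neg_iff:
  "u \<in> verts G \<Longrightarrow> v \<in> verts G \<Longrightarrow> u \<noteq> v \<Longrightarrow> rel G (\<not> c) u v \<longleftrightarrow> \<not> rel G c u v"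
  by (auto simp: rel_def)

lemma relD: "rel G c u v \<Longrightarrow> u \<in> verts G \<and> v \<in> verts G \<and> u \<noteq> v"
  by (simp add: rel_def)

lemma rel_disjoint: "rel G c u v \<Longrightarrow> \<not> rel G (\<not> c) u v"
  by (auto simp: rel_def)

context
  fixes G :: "'a ugraph"
  assumes simple: "simple_graph G"
begin

section \<open>Edges and connectivity of induced subgraphs\<close>

lemma edge_iff_rel: "{u, v} \<in> edges G \<longleftrightarrow> rel G False u v"
proof
  assume e: "{u, v} \<in> edges G"
  then have "{u, v} \<subseteq> verts G" "card {u, v} = 2" using simple by (auto simp: simple_graph_def)
  moreover from this(2) have "u \<noteq> v" by (metis card_1_singleton_iff insert_absorb2 numeral_One
      numeral_eq_iff semiring_norm(85) One_nat_def)
  ultimately show "rel G False u v" using e by (simp add: rel_def)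
qed (simp add: rel_def)

lemma edges_induced:
  "edges (induced G X) = {{u, v} | u v. u \<in> X \<and> v \<in> X \<and> rel G False u v}"
proof (intro set_eqI iffI)
  fix e assume e: "e \<in> edges (induced G X)"
  then have "e \<in> edges G" "e \<subseteq> X" by (auto simp: induced_def)
  moreover from this(1) obtain u v where "e = {u, v}"
    using simple by (metis simple_graph_def card_2_iff)
  ultimately show "e \<in> {{u, v} | u v. u \<in> X \<and> v \<in> X \<and> rel G False u v}"
    using edge_iff_rel by blast
next
  fix e assume "e \<in> {{u, v} | u v. u \<in> X \<and> v \<in> X \<and> rel G False u v}"
  then show "e \<in> edges (induced G X)" using edge_iff_rel by (auto simp: induced_def)
qed

lemma edges_complement_induced:
  assumes "X \<subseteq> verts G"
  shows "edges (complement (induced G X)) = {{u, v} | u v. u \<in> X \<and> v \<in> X \<and> rel G True u v}"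
proof (intro set_eqI iffI)
  fix e assume "e \<in> edges (complement (induced G X))"
  then have e: "e \<subseteq> X" "card e = 2" "e \<notin> edges (induced G X)"
    by (auto simp: complement_def induced_def)
  then obtain u v where uv: "e = {u, v}" "u \<noteq> v" by (metis card_2_iff)
  then have "u \<in> X" "v \<in> X" using e by auto
  moreover have "{u, v} \<notin> edges G" using e uv by (auto simp: induced_def)
  ultimately have "rel G True u v" using assms uv by (auto simp: rel_def)
  then show "e \<in> {{u, v} | u v. u \<in> X \<and> v \<in> X \<and> rel G True u v}"
    using uv \<open>u \<in> X\<close> \<open>v \<in> X\<close> by blast
next
  fix e assume "e \<in> {{u, v} | u v. u \<in> X \<and> v \<in> X \<and> rel G True u v}"
  then show "e \<in> edges (complement (induced G X))"
    by (auto simp: complement_def induced_def rel_def)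
qed

lemma finite_subset_verts: "X \<subseteq> verts G \<Longrightarrow> finite X"
  using simple by (metis simple_graph_def finite_subset)

lemma card_edges_induced:
  assumes "X \<subseteq> verts G"
  shows "2 * card (edges (induced G X)) = card (arcs (rel G False) X)"
    "2 * card (edges (complement (induced G X))) = card (arcs (rel G True) X)"
  unfolding edges_induced edges_complement_induced[OF assms]
  by (rule card_edges_arcs[OF finite_subset_verts[OF assms] symp_rel rel_irrefl])+

lemma connected_induced_iff:
  assumes "X \<subseteq> verts G"
  shows "connected (induced G X) \<longleftrightarrow> conn (rel G False) X"
proof -
  have "connected (induced G X) \<longleftrightarrow> conn (\<lambda>u v. {u, v} \<in> edges (induced G X)) (verts (induced G X))"
    by (rule connected_iff_conn) (auto simp: induced_def)
  also have "\<dots> \<longleftrightarrow> conn (\<lambda>u v. {u, v} \<in> edges (induced G X)) X" by (simp add: induced_def)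
  also have "\<dots> \<longleftrightarrow> conn (rel G False) X"
    by (rule conn_cong) (auto simp: induced_def edge_iff_rel)
  finally show ?thesis .
qed

lemma co_connected_induced_iff:
  assumes "X \<subseteq> verts G"
  shows "co_connected (induced G X) \<longleftrightarrow> conn (rel G True) X"
proof -
  let ?H = "complement (induced G X)"
  have vH: "verts ?H = X" by (simp add: complement_def induced_def)
  have "connected ?H \<longleftrightarrow> conn (\<lambda>u v. {u, v} \<in> edges ?H) (verts ?H)"
    by (rule connected_iff_conn) (auto simp: complement_def)
  also have "\<dots> \<longleftrightarrow> conn (rel G True) X"
    unfolding vH
  proof (rule conn_cong)
    fix u v assume uv: "u \<in> X" "v \<in> X" "u \<noteq> v"
    then show "({u, v} \<in> edges ?H) = rel G True u v"
      using assms by (auto simp: complement_def induced_def rel_def)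
  qed
  finally show ?thesis by (simp add: co_connected_def)
qed

section \<open>Induced paths and cycles in terms of adjacency\<close>

lemma induced_path3_iff:
  assumes "X \<subseteq> verts G"
  shows "induced_path (induced G X) [a, v, b] \<longleftrightarrow>
    a \<in> X \<and> v \<in> X \<and> b \<in> X \<and> rel G False a v \<and> rel G False v b \<and> rel G True a b"
proof -
  have p: "{{[a, v, b] ! i, [a, v, b] ! Suc i} | i. Suc i < length [a, v, b]} = {{a, v}, {v, b}}"
    (is "?P = _")
  proof -
    have "{i. Suc i < length [a, v, b]} = {0, 1}" by auto
    moreover have "?P = (\<lambda>i. {[a, v, b] ! i, [a, v, b] ! Suc i}) ` {i. Suc i < length [a, v, b]}"
      by auto
    ultimately show ?thesis by simp
  qed
  have e: "edges (induced (induced G X) {a, v, b}) = {{a, v}, {v, b}} \<longleftrightarrow>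
      rel G False a v \<and> rel G False v b \<and> rel G True a b"
    if abv: "{a, v, b} \<subseteq> X" "distinct [a, v, b]"
  proof -
    define E where "E = edges (induced (induced G X) {a, v, b})"
    have "induced (induced G X) {a, v, b} = induced G {a, v, b}"
      using abv by (auto simp: induced_def)
    then have E: "E = edges (induced G {a, v, b})" by (simp add: E_def)
    have mem: "{x, y} \<in> E \<longleftrightarrow> rel G False x y" if "x \<in> {a, v, b}" "y \<in> {a, v, b}" for x y
      unfolding E using that by (auto simp: induced_def edge_iff_rel)
    have ex: "\<exists>x y. f = {x, y} \<and> x \<in> {a, v, b} \<and> y \<in> {a, v, b} \<and> rel G False x y" if "f \<in> E" for f
      using that unfolding E edges_induced by blast
    have ne: "rel G True a b \<longleftrightarrow> \<not> rel G False a b"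
      using rel_True_iff[of a G b] abv assms by auto
    have "E = {{a, v}, {v, b}} \<longleftrightarrow> rel G False a v \<and> rel G False v b \<and> \<not> rel G False a b"
    proof
      assume EE: "E = {{a, v}, {v, b}}"
      have "{a, v} \<in> E" "{v, b} \<in> E" "{a, b} \<notin> E"
        unfolding EE using abv(2) by (auto simp: doubleton_eq_iff)
      then show "rel G False a v \<and> rel G False v b \<and> \<not> rel G False a b"
        using mem[of a v] mem[of v b] mem[of a b] by simp
    next
      assume r: "rel G False a v \<and> rel G False v b \<and> \<not> rel G False a b"
      then have r': "\<not> rel G False b a" using rel_commute[of G False a b] by simp
      show "E = {{a, v}, {v, b}}"
      proof (intro set_eqI iffI)
        fix f assume "f \<in> E"
        then obtain x y where "f = {x, y}" "x \<in> {a, v, b}" "y \<in> {a, v, b}" "rel G False x y"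
          using ex by blast
        then show "f \<in> {{a, v}, {v, b}}"
          using r r' by (elim insertE emptyE; simp add: insert_commute)
      next
        fix f assume "f \<in> {{a, v}, {v, b}}"
        then show "f \<in> E" using mem[of a v] mem[of v b] r by auto
      qed
    qed
    then show ?thesis unfolding E_def[symmetric] ne .
  qed
  have "induced_path (induced G X) [a, v, b] \<longleftrightarrow> distinct [a, v, b] \<and> {a, v, b} \<subseteq> X \<and>
      edges (induced (induced G X) {a, v, b}) = {{a, v}, {v, b}}"
    unfolding induced_path_def p by (simp add: induced_def)
  also have "\<dots> \<longleftrightarrow> distinct [a, v, b] \<and> {a, v, b} \<subseteq> X \<and>
      rel G False a v \<and> rel G False v b \<and> rel G True a b"
    by (intro conj_cong refl) (simp only: e)
  also have "\<dots> \<longleftrightarrow> a \<in> X \<and> v \<in> X \<and> b \<in> X \<and> rel G False a v \<and> rel G False v b \<and> rel G True a b"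
    using relD[of G _ a v] relD[of G _ v b] relD[of G _ a b] by auto
  finally show ?thesis .
qed

lemma induced_cycle_induced:
  assumes "X \<subseteq> verts G"
  shows "induced_cycle (induced G X) cs \<longleftrightarrow> induced_cycle G cs \<and> set cs \<subseteq> X"
proof -
  have "set cs \<subseteq> X \<Longrightarrow> induced (induced G X) (set cs) = induced G (set cs)"
    by (auto simp: induced_def)
  then show ?thesis using assms unfolding induced_cycle_def by (auto simp: induced_def[of G X])
qed

lemma induced_cycle_rel:
  assumes "induced_cycle G cs" "i < length cs" "j < length cs"
  shows "rel G False (cs ! i) (cs ! j) \<longleftrightarrow>
    j = Suc i mod length cs \<or> i = Suc j mod length cs"
proof -
  have E: "edges (induced G (set cs)) = {{cs ! i, cs ! (Suc i mod length cs)} | i. i < length cs}"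
    and d: "distinct cs" and L: "3 \<le> length cs"
    using assms(1) by (auto simp: induced_cycle_def)
  have m: "Suc k mod length cs < length cs" for k using L by (intro mod_less_divisor) linarith
  have "rel G False (cs ! i) (cs ! j) \<longleftrightarrow> {cs ! i, cs ! j} \<in> edges (induced G (set cs))"
    using assms by (auto simp: induced_def edge_iff_rel)
  also have "\<dots> \<longleftrightarrow> (\<exists>k<length cs. {cs ! i, cs ! j} = {cs ! k, cs ! (Suc k mod length cs)})"
    unfolding E by blast
  also have "\<dots> \<longleftrightarrow> j = Suc i mod length cs \<or> i = Suc j mod length cs"
    using assms(2,3) m d by (auto simp: doubleton_eq_iff nth_eq_iff_index_eq)
  finally show ?thesis .
qed

text \<open>The two neighbours are the cyclic successor and predecessor of the position of
  \<open>x\<close>; they differ because a cycle has length at least three.\<close>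

lemma induced_cycle_neighbours:
  assumes "induced_cycle G cs" "x \<in> set cs"
  obtains p q where "p \<noteq> q" "p \<in> set cs" "q \<in> set cs" "rel G False x p" "rel G False x q"
    "\<And>z. z \<in> set cs \<Longrightarrow> rel G False x z \<Longrightarrow> z = p \<or> z = q"
proof -
  let ?L = "length cs"
  have d: "distinct cs" and L: "3 \<le> ?L"
    using assms(1) by (auto simp: induced_cycle_def)
  obtain i where i: "i < ?L" "x = cs ! i" using assms(2) by (metis in_set_conv_nth)
  define j where "j = (if Suc i = ?L then 0 else Suc i)"
  define k where "k = (if i = 0 then ?L - 1 else i - 1)"
  have jk: "j < ?L" "k < ?L" "j \<noteq> k" using i L by (auto simp: j_def k_def)
  have sj: "Suc i mod ?L = j" using i L by (auto simp: j_def)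
  have sk: "i = Suc l mod ?L \<longleftrightarrow> l = k" if "l < ?L" for l
    using i L that by (cases "Suc l = ?L") (auto simp: k_def)
  have r: "rel G False x (cs ! l) \<longleftrightarrow> l = j \<or> l = k" if "l < ?L" for l
    using induced_cycle_rel[OF assms(1) i(1) that] i(2) sj sk[OF that] by simp
  show ?thesis
  proof (rule that[of "cs ! j" "cs ! k"])
    show "cs ! j \<noteq> cs ! k" using d jk by (simp add: nth_eq_iff_index_eq)
    show "z = cs ! j \<or> z = cs ! k" if "z \<in> set cs" "rel G False x z" for z
      using that r by (metis in_set_conv_nth)
  qed (use jk r in auto)
qed

lemma induced_cycle_two_neighbours:
  assumes "induced_cycle G cs" "x \<in> set cs"
  shows "\<exists>p\<in>set cs. \<exists>q\<in>set cs. p \<noteq> q \<and> rel G False x p \<and> rel G False x q"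
  by (rule induced_cycle_neighbours[OF assms]) blast

text \<open>Consecutive vertices are adjacent, so a property that passes along edges is constant
  around the cycle. This confines a cycle to one component.\<close>

lemma induced_cycle_closed:
  assumes c: "induced_cycle G cs" and x: "x \<in> set cs" "y \<in> set cs" "P x"
    and cl: "\<And>u w. u \<in> set cs \<Longrightarrow> w \<in> set cs \<Longrightarrow> rel G False u w \<Longrightarrow> P u \<Longrightarrow> P w"
  shows "P y"
proof -
  have L: "3 \<le> length cs" using c by (auto simp: induced_cycle_def)
  have st: "P (cs ! i) \<longleftrightarrow> P (cs ! Suc i)" if "Suc i < length cs" for i
  proof -
    have "rel G False (cs ! i) (cs ! Suc i)"
      using induced_cycle_rel[OF c, of i "Suc i"] that by simp
    then show ?thesis using cl that rel_commute by (metis Suc_lessD nth_mem)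
  qed
  have "i < length cs \<Longrightarrow> P (cs ! i) \<longleftrightarrow> P (cs ! 0)" for i
  proof (induction i)
    case (Suc i)
    then show ?case using st by simp
  qed simp
  then show ?thesis using x by (metis in_set_conv_nth)
qed

text \<open>The cycle used to witness avoidability: a non-neighbour \<open>w\<close> of
  \<open>v\<close> that sees both ends closes the path \<open>a - v - b\<close>.\<close>

lemma induced_cycle4:
  assumes "rel G False a v" "rel G False v b" "rel G False b w" "rel G False w a"
    "rel G True a b" "rel G True v w"
  shows "induced_cycle G [a, v, b, w]"
proof -
  have d: "distinct [a, v, b, w]" "{a, v, b, w} \<subseteq> verts G" using assms by (auto simp: rel_def)
  have "{{[a, v, b, w] ! i, [a, v, b, w] ! (Suc i mod length [a, v, b, w])} | i.
      i < length [a, v, b, w]} =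
      (\<lambda>i. {[a, v, b, w] ! i, [a, v, b, w] ! (Suc i mod 4)}) ` {0, 1, 2, 3}" (is "?P = _")
  proof -
    have "{i. i < length [a, v, b, w]} = {0, 1, 2, 3}" by auto
    moreover have "?P = (\<lambda>i. {[a, v, b, w] ! i, [a, v, b, w] ! (Suc i mod 4)}) `
      {i. i < length [a, v, b, w]}" by auto
    ultimately show ?thesis by simp
  qed
  also have "\<dots> = {{a, v}, {v, b}, {b, w}, {w, a}}" by simp
  finally have P: "?P = {{a, v}, {v, b}, {b, w}, {w, a}}" .
  have n: "\<not> rel G False a b" "\<not> rel G False v w" "\<not> rel G False b a" "\<not> rel G False w v"
    using assms(5,6) by (auto simp: rel_def insert_commute)
  have "edges (induced G (set [a, v, b, w])) = {{a, v}, {v, b}, {b, w}, {w, a}}"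
  proof (intro set_eqI iffI)
    fix e assume "e \<in> edges (induced G (set [a, v, b, w]))"
    then obtain x y where "e = {x, y}" "x \<in> {a, v, b, w}" "y \<in> {a, v, b, w}" "rel G False x y"
      unfolding edges_induced by auto
    then show "e \<in> {{a, v}, {v, b}, {b, w}, {w, a}}"
      using n by (elim insertE emptyE; simp add: insert_commute)
  next
    fix e assume "e \<in> {{a, v}, {v, b}, {b, w}, {w, a}}"
    then show "e \<in> edges (induced G (set [a, v, b, w]))"
      using assms(1-4) edge_iff_rel by (auto simp: induced_def)
  qed
  then show ?thesis unfolding induced_cycle_def P using d by simp
qed

section \<open>Avoidable vertices and splitting\<close>

text \<open>Avoidability inside the subgraph induced by \<open>X\<close>, but expressed with paths
  and cycles of the whole graph, so that nested vertex sets can be compared directly.\<close>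

definition avoids :: "'a set \<Rightarrow> 'a \<Rightarrow> bool" where
  "avoids X v \<longleftrightarrow> (\<forall>a\<in>X. \<forall>b\<in>X. rel G False a v \<longrightarrow> rel G False v b \<longrightarrow> rel G True a b \<longrightarrow>
     (\<exists>cs. induced_cycle G cs \<and> set cs \<subseteq> X \<and> {a, v, b} \<subseteq> set cs))"

lemma avoidable_induced_iff:
  assumes "X \<subseteq> verts G"
  shows "avoidable (induced G X) v \<longleftrightarrow> v \<in> X \<and> avoids X v"
proof -
  have vX: "verts (induced G X) = X" by (simp add: induced_def)
  show ?thesis
    unfolding avoidable_def avoids_def induced_path3_iff[OF assms] induced_cycle_induced[OF assms] vX
    by auto
qed

lemma induced_verts: "induced G (verts G) = G"
  using simple by (cases G) (auto simp: induced_def simple_graph_def)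

lemma avoidable_iff: "avoidable G v \<longleftrightarrow> v \<in> verts G \<and> avoids (verts G) v"
  using avoidable_induced_iff[of "verts G" v] induced_verts by simp

text \<open>On an induced cycle \<open>v\<close> has only two neighbours, and \<open>a\<close> and
  \<open>b\<close> already are these two.\<close>

lemma induced_cycle_nonadjacent:
  assumes "induced_cycle G cs" "{a, v, b} \<subseteq> set cs" "rel G False a v" "rel G False v b"
    "rel G True a b" "w \<in> set cs" "w \<notin> {a, v, b}"
  shows "rel G True v w"
proof -
  have v: "v \<in> set cs" using assms(2) by simp
  obtain p q where pq: "\<And>z. z \<in> set cs \<Longrightarrow> rel G False v z \<Longrightarrow> z = p \<or> z = q"
    using induced_cycle_neighbours[OF assms(1) v] by metis
  have ab: "a \<noteq> b" "rel G False v a" using assms(5,3) rel_commute by (auto simp: rel_def insert_commute)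
  have "a = p \<or> a = q" "b = p \<or> b = q" using pq assms(2,4) ab(2) by auto
  then have "\<not> rel G False v w" using pq[of w] assms(6,7) ab(1) by auto
  moreover have "w \<in> verts G" "v \<in> verts G" using assms(1,6) v by (auto simp: induced_cycle_def)
  ultimately show ?thesis using assms(7) rel_True_iff[of v G w] by auto
qed

text \<open>Every path with middle \<open>v\<close> and every cycle through \<open>v\<close> stays
  inside the component of \<open>v\<close>, so both conditions quantify over the same
  objects.\<close>

lemma avoids_component:
  assumes "C \<subseteq> X" "v \<in> C" "X \<subseteq> verts G"
    and cut: "\<And>x y. x \<in> C \<Longrightarrow> y \<in> X - C \<Longrightarrow> \<not> rel G False x y"
  shows "avoids X v \<longleftrightarrow> avoids C v"
proof -
  have nb: "a \<in> C" if "a \<in> X" "rel G False a v \<or> rel G False v a" for a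
    using cut[of v a] assms(2) that rel_commute[of G False a v] by blast
  have cyc: "set cs \<subseteq> C" if "induced_cycle G cs" "set cs \<subseteq> X" "v \<in> set cs" for cs
  proof
    fix y assume "y \<in> set cs"
    then show "y \<in> C"
      by (rule induced_cycle_closed[OF that(1,3), where P = "\<lambda>y. y \<in> C"])
        (use assms(2) cut that(2) in auto)
  qed
  show ?thesis
  proof
    assume A: "avoids X v"
    show "avoids C v" unfolding avoids_def
    proof (intro ballI impI)
      fix a b assume "a \<in> C" "b \<in> C" and r: "rel G False a v" "rel G False v b" "rel G True a b"
      then have "a \<in> X" "b \<in> X" using assms(1) by auto
      then obtain cs where "induced_cycle G cs" "set cs \<subseteq> X" "{a, v, b} \<subseteq> set cs"
        using A r unfolding avoids_def by blast
      then show "\<exists>cs. induced_cycle G cs \<and> set cs \<subseteq> C \<and> {a, v, b} \<subseteq> set cs" using cyc by auto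
    qed
  next
    assume A: "avoids C v"
    show "avoids X v" unfolding avoids_def
    proof (intro ballI impI)
      fix a b assume "a \<in> X" "b \<in> X" and r: "rel G False a v" "rel G False v b" "rel G True a b"
      then have "a \<in> C" "b \<in> C" using nb by auto
      then obtain cs where "induced_cycle G cs" "set cs \<subseteq> C" "{a, v, b} \<subseteq> set cs"
        using A r unfolding avoids_def by blast
      then show "\<exists>cs. induced_cycle G cs \<and> set cs \<subseteq> X \<and> {a, v, b} \<subseteq> set cs"
        using assms(1) by blast
    qed
  qed
qed

text \<open>An induced cycle through \<open>a - v - b\<close> consists of \<^term>\<open>a\<close>, \<^term>\<open>b\<close> and vertices of the
  co-component of \<^term>\<open>v\<close>.\<close>

lemma avoids_co_component:
  assumes "C \<subseteq> X" "v \<in> C" "X \<subseteq> verts G" "conn (rel G True) C"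
    and join: "\<And>x y. x \<in> C \<Longrightarrow> y \<in> X - C \<Longrightarrow> \<not> rel G True x y"
  shows "avoids X v \<longleftrightarrow> avoids C v \<and> (2 \<le> card C \<or> arcs (rel G True) X = {})"
proof -
  have finC: "finite C" using assms(1,3) by (intro finite_subset_verts) auto
  have sing: "C = {v}" if "\<not> 2 \<le> card C"
  proof -
    have "card C \<le> Suc 0" using that by simp
    then show ?thesis using assms(2) finC card_le_Suc0_iff_eq[of C] by blast
  qed
  have adj: "rel G False x y" if "x \<in> C" "y \<in> X - C" for x y
  proof -
    have "x \<in> verts G" "y \<in> verts G" "x \<noteq> y" using that assms by auto
    then show ?thesis using join[OF that] rel_True_iff by metis
  qed
  have nonadj: "w \<in> C" if "w \<in> X" "rel G True v w" for w
    using join[OF assms(2)] that by blast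
  show ?thesis
  proof
    assume A: "avoids X v"
    have "avoids C v" unfolding avoids_def
    proof (intro ballI impI)
      fix a b assume ab: "a \<in> C" "b \<in> C"
        and r: "rel G False a v" "rel G False v b" "rel G True a b"
      have "a \<in> X" "b \<in> X" using assms(1) ab by auto
      then obtain cs where cs: "induced_cycle G cs" "set cs \<subseteq> X" "{a, v, b} \<subseteq> set cs"
        using A r unfolding avoids_def by blast
      have "set cs \<subseteq> C"
      proof
        fix w assume w: "w \<in> set cs"
        show "w \<in> C"
        proof (cases "w \<in> {a, v, b}")
          case False
          have "rel G True v w" by (rule induced_cycle_nonadjacent[OF cs(1,3) r w False])
          then show ?thesis using nonadj cs(2) w by blast
        qed (use ab assms(2) in auto)
      qed
      then show "\<exists>cs. induced_cycle G cs \<and> set cs \<subseteq> C \<and> {a, v, b} \<subseteq> set cs" using cs by blast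
    qed
    \<comment> \<open>If \<open>C\<close> is just \<open>v\<close>, then \<open>v\<close> is
      universal in \<open>X\<close>. A cycle through \<open>a - v - b\<close> could contain no
      fourth vertex, and three vertices with \<open>a\<close> and \<open>b\<close> non-adjacent form
      no cycle.\<close>
    moreover have "arcs (rel G True) X = {}" if "\<not> 2 \<le> card C"
    proof (rule ccontr)
      assume "arcs (rel G True) X \<noteq> {}"
      then obtain a b where ab: "a \<in> X" "b \<in> X" "rel G True a b" by (auto simp: arcs_def)
      have "a \<noteq> v" using nonadj[of b] ab sing[OF that] by auto
      moreover have "b \<noteq> v" using nonadj[of a] ab sing[OF that] rel_commute[of G True a b] by auto
      ultimately have va: "rel G False v a" "rel G False v b"
        using adj[of v a] adj[of v b] ab sing[OF that] assms(2) by auto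
      then have r: "rel G False a v" "rel G False v b" "rel G True a b"
        using rel_commute[of G False a v] ab by auto
      then obtain cs where cs: "induced_cycle G cs" "set cs \<subseteq> X" "{a, v, b} \<subseteq> set cs"
        using A ab(1,2) unfolding avoids_def by blast
      have sub: "set cs \<subseteq> {a, v, b}"
      proof
        fix w assume w: "w \<in> set cs"
        show "w \<in> {a, v, b}"
        proof (rule ccontr)
          assume wn: "w \<notin> {a, v, b}"
          have "rel G True v w" by (rule induced_cycle_nonadjacent[OF cs(1,3) r w wn])
          then have "w \<in> C" using nonadj cs(2) w by blast
          then show False using sing[OF that] wn by auto
        qed
      qed
      obtain p q where pq: "p \<noteq> q" "p \<in> set cs" "q \<in> set cs" "rel G False a p" "rel G False a q"
        using induced_cycle_two_neighbours[OF cs(1), of a] cs(3) by blast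
      have "p \<in> {v, b}" "q \<in> {v, b}" using sub pq(2-5) by auto
      then have "rel G False a b" using pq by auto
      then show False using ab(3) by (auto simp: rel_def)
    qed
    ultimately show "avoids C v \<and> (2 \<le> card C \<or> arcs (rel G True) X = {})" by blast
  next
    assume A: "avoids C v \<and> (2 \<le> card C \<or> arcs (rel G True) X = {})"
    show "avoids X v" unfolding avoids_def
    proof (intro ballI impI)
      fix a b assume ab: "a \<in> X" "b \<in> X"
        and r: "rel G False a v" "rel G False v b" "rel G True a b"
      have ne: "arcs (rel G True) X \<noteq> {}" using ab r(3) by (auto simp: arcs_def)
      \<comment> \<open>Non-adjacent vertices lie in the same co-component, so the path has both
        ends in \<open>C\<close> or both outside.\<close>
      have iff: "a \<in> C \<longleftrightarrow> b \<in> C"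
        using join[of a b] join[of b a] ab r(3) rel_commute[of G True a b] by blast
      show "\<exists>cs. induced_cycle G cs \<and> set cs \<subseteq> X \<and> {a, v, b} \<subseteq> set cs"
      proof (cases "a \<in> C")
        case True
        then have "b \<in> C" using iff by simp
        then obtain cs where "induced_cycle G cs" "set cs \<subseteq> C" "{a, v, b} \<subseteq> set cs"
          using A r True unfolding avoids_def by blast
        then show ?thesis using assms(1) by blast
      next
        case False
        \<comment> \<open>With both ends outside \<open>C\<close>, every vertex of \<open>C\<close>
          sees both. Any non-neighbour of \<open>v\<close> in \<open>C\<close> therefore completes a
          cycle of length four.\<close>
        have "2 \<le> card C" using A ne by blast
        then obtain w where w: "w \<in> C" "rel G True v w"
          using conn_neighbour[OF assms(4,2)] by metis
        have "rel G False w a" "rel G False w b" using adj w(1) ab False iff by auto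
        then have "induced_cycle G [a, v, b, w]"
          using induced_cycle4[of a v b w] r w(2) rel_commute[of G False w b] by blast
        moreover have "set [a, v, b, w] \<subseteq> X" using ab w(1) assms(1,2) by auto
        ultimately show ?thesis by (intro exI[of _ "[a, v, b, w]"]) auto
      qed
    qed
  qed
qed

text \<open>Connected with fewer edges than vertices means acyclic: no path with middle
  \<open>v\<close> can be closed, and such a path exists as soon as \<open>v\<close> has two
  neighbours.\<close>

lemma avoids_tree:
  assumes "X \<subseteq> verts G" "v \<in> X" "conn (rel G False) X"
    "card (arcs (rel G False) X) < 2 * card X"
  shows "avoids X v \<longleftrightarrow> num_nbrs (rel G False) X v \<le> 1"
proof -
  have fin: "finite X" using assms finite_subset_verts by blast
  have acyclic: False
    if "Y \<subseteq> X" "Y \<noteq> {}"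
      "\<And>y. y \<in> Y \<Longrightarrow> \<exists>p\<in>Y. \<exists>q\<in>Y. p \<noteq> q \<and> rel G False p y \<and> rel G False q y" for Y
    using card_arcs_ge_cycle[OF fin symp_rel rel_irrefl assms(3) that] assms(4) by linarith
  show ?thesis
  proof
    assume A: "avoids X v"
    show "num_nbrs (rel G False) X v \<le> 1"
    proof (rule ccontr)
      assume "\<not> num_nbrs (rel G False) X v \<le> 1"
      then obtain a b where ab: "a \<in> X" "b \<in> X" "a \<noteq> b" "rel G False a v" "rel G False b v"
        unfolding num_nbrs_def by (auto simp: card_le_Suc0_iff_eq fin)
      have ba: "rel G False v a" "rel G False v b" using ab rel_commute[of G False] by blast+
      show False
      \<comment> \<open>Adjacent neighbours form a triangle with \<open>v\<close>; non-adjacent ones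
        form an induced path, which avoidability would place on a cycle. Both contradict
        acyclicity.\<close>
      proof (cases "rel G False a b")
        case True
        then have "rel G False b a" using rel_commute[of G False a b] by simp
        have d: "a \<noteq> v" "b \<noteq> v" using ab(4,5) by (auto simp: rel_def)
        show False
        proof (rule acyclic[of "{a, v, b}"])
          fix y assume "y \<in> {a, v, b}"
          then consider "y = a" | "y = v" | "y = b" by blast
          then show "\<exists>p\<in>{a, v, b}. \<exists>q\<in>{a, v, b}. p \<noteq> q \<and> rel G False p y \<and> rel G False q y"
            using ab ba True \<open>rel G False b a\<close> d by cases auto
        qed (use ab assms(2) in auto)
      next
        case False
        have "a \<in> verts G" "b \<in> verts G" using ab assms(1) by auto
        then have "rel G True a b" using rel_True_iff[of a G b] ab(3) False by simp
        then obtain cs where cs: "induced_cycle G cs" "set cs \<subseteq> X" "{a, v, b} \<subseteq> set cs"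
          using A ab ba unfolding avoids_def by blast
        show False
        proof (rule acyclic[of "set cs"])
          fix y assume "y \<in> set cs"
          then show "\<exists>p\<in>set cs. \<exists>q\<in>set cs. p \<noteq> q \<and> rel G False p y \<and> rel G False q y"
            using induced_cycle_two_neighbours[OF cs(1), of y] by (simp only: rel_commute[of G False _ y])
        qed (use cs in auto)
      qed
    qed
  next
    assume c: "num_nbrs (rel G False) X v \<le> 1"
    show "avoids X v" unfolding avoids_def
    proof (intro ballI impI)
      fix a b assume ab: "a \<in> X" "b \<in> X" "rel G False a v" "rel G False v b" "rel G True a b"
      then have "2 \<le> num_nbrs (rel G False) X v"
        using num_nbrs_ge_2[OF fin, of a b "rel G False" v] rel_commute[of G False v b]
        by (auto dest: relD)
      then show "\<exists>cs. induced_cycle G cs \<and> set cs \<subseteq> X \<and> {a, v, b} \<subseteq> set cs" using c by simp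
    qed
  qed
qed

text \<open>The complement is a tree. A leaf \<open>v\<close> with tree neighbour \<open>w\<close>
  fails on a path \<open>a - v - b\<close> for which \<open>w\<close> is the only candidate to close
  a cycle, while \<open>w\<close> is non-adjacent to \<open>a\<close>. If \<open>v\<close> has two
  tree neighbours, one of them closes any such path, because otherwise the tree would contain a
  cycle.\<close>

lemma avoids_co_tree:
  assumes "X \<subseteq> verts G" "v \<in> X" "2 \<le> card X" "conn (rel G False) X" "conn (rel G True) X"
    "card (arcs (rel G True) X) < 2 * card X"
  shows "avoids X v \<longleftrightarrow> 2 \<le> num_nbrs (rel G True) X v"
proof -
  have fin: "finite X" using assms finite_subset_verts by blast
  have acyclic: False
    if "Y \<subseteq> X" "Y \<noteq> {}"
      "\<And>y. y \<in> Y \<Longrightarrow> \<exists>p\<in>Y. \<exists>q\<in>Y. p \<noteq> q \<and> rel G True p y \<and> rel G True q y" for Y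
    using card_arcs_ge_cycle[OF fin symp_rel rel_irrefl assms(5) that] assms(6) by linarith
  have F: "rel G False x y" if "x \<in> X" "y \<in> X" "x \<noteq> y" "\<not> rel G True x y" for x y
    using that assms(1) rel_True_iff[of x G y] by auto
  note co = rel_commute[of G True]
  show ?thesis
  proof
    assume A: "avoids X v"
    show "2 \<le> num_nbrs (rel G True) X v"
    proof (rule ccontr)
      assume c: "\<not> 2 \<le> num_nbrs (rel G True) X v"
      obtain w where w: "w \<in> X" "w \<noteq> v" "rel G True v w"
        using conn_neighbour[OF assms(5,2,3)] by metis
      have uniq: "z = w" if "z \<in> X" "rel G True v z" for z
        using c w that num_nbrs_ge_2[OF fin, of z w "rel G True" v] co[of v] by auto
      obtain z where z: "z \<in> X" "z \<noteq> w" "rel G False w z"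
        using conn_neighbour[OF assms(4) w(1) assms(3)] by metis
      \<comment> \<open>The part is connected, so \<open>w\<close> has a neighbour in the graph and
        the tree is not a star around \<open>w\<close>. Hence a tree edge \<open>a b\<close> leaves
        the closed tree neighbourhood of \<open>w\<close>; since \<open>v\<close> is a leaf,
        \<open>a\<close> is another tree neighbour of \<open>w\<close>.\<close>
      define Y where "Y = {v, w} \<union> {x \<in> X. rel G True w x}"
      have "z \<noteq> v" using z(3) w(3) rel_disjoint[of G False w z] co[of v w] by auto
      then have "z \<notin> Y" using z rel_disjoint[of G False w z] by (auto simp: Y_def)
      then have "Y \<subset> X \<and> Y \<noteq> {}" using w assms(2) z by (auto simp: Y_def)
      then obtain a b where ab: "a \<in> Y" "b \<in> X - Y" "rel G True a b"
        using assms(5) unfolding conn_def by meson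
      have bY: "b \<noteq> v" "b \<noteq> w" "\<not> rel G True w b" using ab(2) by (auto simp: Y_def)
      have av: "a \<noteq> v" using uniq[of b] ab bY by auto
      have aw: "a \<noteq> w" using ab bY by auto
      have a: "a \<in> X" "rel G True w a" using ab(1) av aw by (auto simp: Y_def)
      have vb: "rel G False v b" using F[of v b] uniq[of b] ab assms(2) bY by auto
      have va: "rel G False v a" using F[of v a] uniq[of a] a assms(2) av aw by auto
      have r: "rel G False a v" using va rel_commute[of G False a v] by simp
      obtain cs where cs: "induced_cycle G cs" "set cs \<subseteq> X" "{a, v, b} \<subseteq> set cs"
        using A a(1) ab(2,3) r vb unfolding avoids_def by blast
      have sub: "set cs \<subseteq> {a, v, b, w}"
      proof
        fix x assume x: "x \<in> set cs"
        show "x \<in> {a, v, b, w}"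
        proof (rule ccontr)
          assume xn: "x \<notin> {a, v, b, w}"
          have "rel G True v x" by (rule induced_cycle_nonadjacent[OF cs(1,3) r vb ab(3) x]) (use xn in auto)
          then show False using uniq[of x] xn cs(2) x by auto
        qed
      qed
      obtain p q where pq: "p \<noteq> q" "p \<in> set cs" "q \<in> set cs" "rel G False a p" "rel G False a q"
        using induced_cycle_two_neighbours[OF cs(1), of a] cs(3) by blast
      \<comment> \<open>In the graph \<open>a\<close> sees neither \<open>b\<close> nor
        \<open>w\<close>, so on the cycle it has at most the neighbour \<open>v\<close> instead of
        two.\<close>
      have "\<not> rel G False a b" "\<not> rel G False a w"
        using rel_disjoint[of G False a] ab(3) a(2) co[of w a] by auto
      then have "p \<in> {v}" "q \<in> {v}" using sub pq(2-5) by auto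
      then show False using pq(1) by simp
    qed
  next
    assume c: "2 \<le> num_nbrs (rel G True) X v"
    then obtain w1 w2 where w: "w1 \<in> X" "w2 \<in> X" "w1 \<noteq> w2" "rel G True w1 v" "rel G True w2 v"
      unfolding num_nbrs_def using card_le_Suc0_iff_eq[of "{z \<in> X. rel G True z v}"] fin by auto
    have w': "rel G True v w1" "rel G True v w2" using w co[of v] by auto
    show "avoids X v" unfolding avoids_def
    proof (intro ballI impI)
      fix a b assume ab: "a \<in> X" "b \<in> X" and r: "rel G False a v" "rel G False v b" "rel G True a b"
      have r': "rel G True b a" "rel G False b v" using r co[of a b] rel_commute[of G False b v] by auto
      have nv: "\<not> rel G True a v" "\<not> rel G True b v"
        using r r' rel_disjoint[of G False] by auto
      \<comment> \<open>If \<open>w1\<close> and \<open>w2\<close> each had a tree neighbour among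
        \<open>a\<close> and \<open>b\<close>, then these together with \<open>v\<close> would form
        a cycle of length four or five in the tree, using the tree edge \<open>a b\<close> in the
        second case.\<close>
      have "\<exists>w. w \<in> {w1, w2} \<and> \<not> rel G True w a \<and> \<not> rel G True w b"
      proof (rule ccontr)
        assume "\<not> ?thesis"
        then have "rel G True w1 a \<or> rel G True w1 b" "rel G True w2 a \<or> rel G True w2 b" by auto
        then obtain x1 x2 where x: "x1 \<in> {a, b}" "x2 \<in> {a, b}" "rel G True w1 x1" "rel G True w2 x2"
          by (metis insertI1 insert_commute)
        then have x': "rel G True x1 w1" "rel G True x2 w2" using co[of w1] co[of w2] by auto
        have d: "x1 \<noteq> v" "x2 \<noteq> v" "x1 \<noteq> w1" "x1 \<noteq> w2" "x2 \<noteq> w1" "x2 \<noteq> w2" "w1 \<noteq> v" "w2 \<noteq> v"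
          using x nv w' w r r' by (auto simp: rel_def)
        show False
        proof (cases "x1 = x2")
          case True
          show False
          proof (rule acyclic[of "{v, w1, x1, w2}"])
            fix y assume "y \<in> {v, w1, x1, w2}"
            then consider "y = v" | "y = w1" | "y = x1" | "y = w2" by blast
            then show "\<exists>p\<in>{v, w1, x1, w2}. \<exists>q\<in>{v, w1, x1, w2}.
                p \<noteq> q \<and> rel G True p y \<and> rel G True q y"
              using w w' x x' d True by cases auto
          qed (use assms(2) w x ab in auto)
        next
          case False
          then have xx: "rel G True x1 x2" "rel G True x2 x1" using x r(3) r'(1) by auto
          show False
          proof (rule acyclic[of "{v, w1, x1, x2, w2}"])
            fix y assume "y \<in> {v, w1, x1, x2, w2}"
            then consider "y = v" | "y = w1" | "y = x1" | "y = x2" | "y = w2" by blast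
            then show "\<exists>p\<in>{v, w1, x1, x2, w2}. \<exists>q\<in>{v, w1, x1, x2, w2}.
                p \<noteq> q \<and> rel G True p y \<and> rel G True q y"
              using w w' x x' d xx by cases auto
          qed (use assms(2) w x ab in auto)
        qed
      qed
      then obtain w where ww: "w \<in> X" "rel G True v w" "\<not> rel G True w a" "\<not> rel G True w b"
        using w w' by auto
      have "w \<noteq> a" "w \<noteq> b" using ww nv co[of v] by auto
      then have "rel G False w a" "rel G False w b" using F ww ab by auto
      then have "induced_cycle G [a, v, b, w]"
        using induced_cycle4[of a v b w] r ww(2) rel_commute[of G False w b] by blast
      then show "\<exists>cs. induced_cycle G cs \<and> set cs \<subseteq> X \<and> {a, v, b} \<subseteq> set cs"
        using ab ww(1) assms(2) by (intro exI[of _ "[a, v, b, w]"]) auto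
    qed
  qed
qed

end

section \<open>Adjacency lists\<close>

text \<open>The linear bound covers addresses, offsets, entry numbers up to \<open>n + M\<close> and
  search keys with their intermediate sums. The square covers sums of earlier-neighbour counts over
  a part, which for the complement may be quadratic.\<close>

locale graph_input =
  fixes G :: "nat ugraph" and adj :: "nat list list" and W :: nat
  assumes simple: "simple_graph G" and adj: "adjacency_lists G adj"
    and W: "4 * length adj + 2 * length (concat adj) + 8 \<le> W"
    and W_square: "length adj * length adj < W"
begin

abbreviation n :: nat where "n \<equiv> length adj"

abbreviation M :: nat where "M \<equiv> length (concat adj)"

abbreviation E :: "nat \<Rightarrow> nat \<Rightarrow> bool" where "E \<equiv> rel G False"

definition off :: "nat \<Rightarrow> nat" where
  "off v = length (concat (take v adj))"

definition deg :: "nat \<Rightarrow> nat" where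
  "deg v = length (adj ! v)"

lemma verts_eq: "verts G = {..<n}"
  using adj by (simp add: adjacency_lists_def)

lemma set_adj: "v < n \<Longrightarrow> set (adj ! v) = {u. E u v}"
  using adj edge_iff_rel[OF simple] by (simp add: adjacency_lists_def)

lemma distinct_adj: "v < n \<Longrightarrow> distinct (adj ! v)"
  using adj by (simp add: adjacency_lists_def)

lemma off_Suc: "v < n \<Longrightarrow> off (Suc v) = off v + deg v"
  by (simp add: off_def deg_def take_Suc_conv_app_nth)

lemma off_le: "off v \<le> M"
proof -
  have "concat adj = concat (take v adj) @ concat (drop v adj)"
    by (metis append_take_drop_id concat_append)
  then show ?thesis unfolding off_def by (metis length_append le_add1)
qed

lemma nth_concat_adj:
  assumes "v < n" "i < deg v"
  shows "concat adj ! (off v + i) = adj ! v ! i" "off v + i < M"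
proof -
  have "adj = take v adj @ adj ! v # drop (Suc v) adj" using assms by (simp add: id_take_nth_drop)
  then have "concat adj = concat (take v adj @ adj ! v # drop (Suc v) adj)" by (rule arg_cong)
  then have c: "concat adj = concat (take v adj) @ adj ! v @ concat (drop (Suc v) adj)" by simp
  show "concat adj ! (off v + i) = adj ! v ! i"
    unfolding c off_def using assms(2) by (simp add: nth_append deg_def)
  have "off (Suc v) \<le> M" by (rule off_le)
  then show "off v + i < M" using off_Suc[OF assms(1)] assms(2) by linarith
qed

lemma deg_eq_num_nbrs: "v < n \<Longrightarrow> deg v = num_nbrs E (verts G) v"
proof -
  assume v: "v < n"
  have "deg v = card (set (adj ! v))" using distinct_adj[OF v] by (simp add: deg_def distinct_card)
  also have "set (adj ! v) = {z \<in> verts G. E z v}" using set_adj[OF v] by (auto dest: relD)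
  finally show ?thesis by (simp add: num_nbrs_def)
qed

lemma sum_deg: "(\<Sum>v<n. deg v) = M"
  by (simp add: deg_def length_concat sum_list_sum_nth atLeast0LessThan)

lemma M_eq: "M = card (arcs E (verts G))" "M = 2 * card (edges G)"
proof -
  have "M = (\<Sum>v\<in>verts G. num_nbrs E (verts G) v)"
    unfolding sum_deg[symmetric] verts_eq by (rule sum.cong) (auto simp: deg_eq_num_nbrs verts_eq)
  then show "M = card (arcs E (verts G))"
    using card_arcs[of "verts G" E] by (simp add: verts_eq)
  then show "M = 2 * card (edges G)"
    using card_edges_induced(1)[OF simple subset_refl] induced_verts[OF simple] by simp
qed

definition input :: "state \<Rightarrow> bool" where
  "input s \<longleftrightarrow> reg s ''n'' = n \<and>
     arr s ''off'' = (\<lambda>v. if v \<le> n then off v else 0) \<and>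
     arr s ''adj'' = (\<lambda>i. if i < M then concat adj ! i else 0)"

lemma input_state: "input (input_state adj)"
  by (auto simp: input_def input_state_def off_def)

lemma input_frame:
  assumes "input s" "frame p s s'" "''n'' \<notin> rmod p" "''off'' \<notin> amod p" "''adj'' \<notin> amod p"
  shows "input s'"
  using assms by (simp add: input_def frame_def)

lemma input_off: "input s \<Longrightarrow> v \<le> n \<Longrightarrow> arr s ''off'' v = off v"
  by (simp add: input_def)

lemma input_adj:
  "input s \<Longrightarrow> v < n \<Longrightarrow> i < deg v \<Longrightarrow> arr s ''adj'' (off v + i) = adj ! v ! i"
  using nth_concat_adj by (simp add: input_def)

lemma input_n: "input s \<Longrightarrow> reg s ''n'' = n"
  by (simp add: input_def)

end

section \<open>Maximum cardinality search on the machine\<close>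

text \<open>The register \<open>b\<close> is 0 for a search of the graph and \<open>n\<close> for a search of its complement. It is
  also the offset at which the order is stored in the array \<open>o\<close> and the numbers of earlier
  neighbours are stored in the array \<open>d\<close>. Buckets of vertices with equal key are linked lists with
  heads \<open>h\<close>; entries whose vertex has been visited or has changed its key stay in the list and
  are skipped when they are reached.\<close>

definition search_init :: com where
  "search_init = seqs [
     Assign ''i'' (N 0),
     For ''i'' ''n'' (seqs [
       Put ''ky'' (V ''i'') (V ''n''),
       Put ''vs'' (V ''i'') (N 0),
       Put ''h'' (V ''i'') (N 0),
       Put ''h'' (Plus (V ''n'') (V ''i'')) (N 0),
       Put ''u'' (Plus (V ''i'') (N 1)) (V ''i''),
       Put ''x'' (Plus (V ''i'') (N 1)) (V ''i'')]),
     Put ''h'' (Plus (V ''n'') (V ''n'')) (N 0),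
     Put ''h'' (V ''n'') (V ''n''),
     Assign ''e'' (V ''n''),
     Assign ''c'' (V ''n''),
     Assign ''i'' (N 0)]"

text \<open>A search of the complement also touches only edges: visiting \<open>v\<close> changes
  the keys of its neighbours alone, upwards for the graph and downwards for the complement. Each
  change files the vertex under its new key with a fresh entry.\<close>

definition search_scan :: com where
  "search_scan = For ''a'' ''z'' (seqs [
     Assign ''w'' (Get ''adj'' (V ''a'')),
     If (Eq (V ''b'') (N 0))
       (Put ''ky'' (V ''w'') (Plus (Get ''ky'' (V ''w'')) (N 1)))
       (Put ''ky'' (V ''w'') (Minus (Get ''ky'' (V ''w'')) (N 1))),
     Assign ''e'' (Plus (V ''e'') (N 1)),
     Put ''u'' (V ''e'') (V ''w''),
     Put ''x'' (V ''e'') (Get ''h'' (Get ''ky'' (V ''w''))),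
     Put ''h'' (Get ''ky'' (V ''w'')) (V ''e'')])"

text \<open>In the complement the key is \<open>n\<close> minus the number \<open>k\<close> of
  visited neighbours, so among the \<open>i\<close> visited vertices there are
  \<open>i - k = i + key - n\<close> non-neighbours; the sum is formed first because subtraction
  truncates. A visit raises a key by at most one, and \<open>c\<close> follows.\<close>

definition search_visit :: com where
  "search_visit = seqs [
     seqs [
       Put ''vs'' (V ''v'') (N 1),
       Put ''o'' (Plus (V ''b'') (V ''i'')) (V ''v''),
       If (Eq (V ''b'') (N 0))
         (Put ''d'' (Plus (V ''b'') (V ''v'')) (Minus (Get ''ky'' (V ''v'')) (V ''n'')))
         (Put ''d'' (Plus (V ''b'') (V ''v''))
           (Minus (Plus (V ''i'') (Get ''ky'' (V ''v''))) (V ''n''))),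
       Assign ''a'' (Get ''off'' (V ''v'')),
       Assign ''z'' (Get ''off'' (Plus (V ''v'') (N 1)))],
     search_scan,
     seqs [
       Assign ''i'' (Plus (V ''i'') (N 1)),
       Assign ''c'' (Plus (V ''c'') (N 1))]]"

text \<open>\<open>c\<close> bounds the keys of the unvisited vertices from above. A step removes an
  entry or lowers \<open>c\<close>; since \<open>c\<close> rises once per visit and at most
  \<open>n + M\<close> entries are ever made, there are linearly many steps.\<close>

definition search_step :: com where
  "search_step = seqs [
     Assign ''j'' (Get ''h'' (V ''c'')),
     If (Eq (V ''j'') (N 0))
       (Assign ''c'' (Minus (V ''c'') (N 1)))
       (seqs [
         Put ''h'' (V ''c'') (Get ''x'' (V ''j'')),
         Assign ''v'' (Get ''u'' (V ''j'')),
         If (And (Eq (Get ''vs'' (V ''v'')) (N 0)) (Eq (Get ''ky'' (V ''v'')) (V ''c'')))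
           search_visit
           SKIP])]"

definition search :: com where
  "search = Seq search_init (While (Less (V ''i'') (V ''n'')) search_step)"

text \<open>0 terminates a list, which is why entries are numbered from 1.\<close>

fun chain :: "(nat \<Rightarrow> nat) \<Rightarrow> nat \<Rightarrow> nat list \<Rightarrow> bool" where
  "chain x j [] \<longleftrightarrow> j = 0"
| "chain x j (i # is) \<longleftrightarrow> j = i \<and> i \<noteq> 0 \<and> chain x (x i) is"

lemma chain_upd: "e \<notin> set is \<Longrightarrow> chain (x(e := y)) j is \<longleftrightarrow> chain x j is"
  by (induction "is" arbitrary: j) auto

text \<open>Relates each element to the list before it. Stated by decompositions, such a property
  extends to one more element at the end by a single rewrite, which is how the order grows.\<close>

definition all_prefixes :: "('a list \<Rightarrow> 'a \<Rightarrow> bool) \<Rightarrow> 'a list \<Rightarrow> bool" where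
  "all_prefixes Q xs \<longleftrightarrow> (\<forall>ys x zs. xs = ys @ x # zs \<longrightarrow> Q ys x)"

lemma all_prefixes_Nil [simp]: "all_prefixes Q []"
  by (simp add: all_prefixes_def)

lemma all_prefixes_snoc [simp]:
  "all_prefixes Q (xs @ [x]) \<longleftrightarrow> all_prefixes Q xs \<and> Q xs x"
proof
  assume A: "all_prefixes Q (xs @ [x])"
  have "Q ys y" if "xs = ys @ y # zs" for ys y zs
    using A[unfolded all_prefixes_def, rule_format, of ys y "zs @ [x]"] that by simp
  moreover have "Q xs x"
    using A[unfolded all_prefixes_def, rule_format, of xs x "[]"] by simp
  ultimately show "all_prefixes Q xs \<and> Q xs x" unfolding all_prefixes_def by blast
next
  assume A: "all_prefixes Q xs \<and> Q xs x"
  show "all_prefixes Q (xs @ [x])" unfolding all_prefixes_def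
  proof (intro allI impI)
    fix ys y zs assume eq: "xs @ [x] = ys @ y # zs"
    show "Q ys y"
    proof (cases zs rule: rev_cases)
      case Nil
      then show ?thesis using A eq by simp
    next
      case (snoc zs' z)
      then have "xs = ys @ y # zs'" using eq by simp
      then show ?thesis using A unfolding all_prefixes_def by blast
    qed
  qed
qed

lemma all_prefixesD: "all_prefixes Q (ys @ x # zs) \<Longrightarrow> Q ys x"
  unfolding all_prefixes_def by blast

lemma all_prefixes_mono:
  assumes "all_prefixes Q xs" "\<And>ys x zs. xs = ys @ x # zs \<Longrightarrow> Q ys x \<Longrightarrow> Q' ys x"
  shows "all_prefixes Q' xs"
  using assms unfolding all_prefixes_def by blast

lemma sum_length_push:
  assumes "finite A" "a \<in> A"
  shows "(\<Sum>k\<in>A. length ((L(a := y # L a)) k)) = Suc (\<Sum>k\<in>A. length (L k))"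
proof -
  have "(\<Sum>k\<in>A - {a}. length ((L(a := y # L a)) k)) = (\<Sum>k\<in>A - {a}. length (L k))"
    by (rule sum.cong) auto
  then show ?thesis using sum.remove[OF assms, of "\<lambda>k. length (L k)"]
      sum.remove[OF assms, of "\<lambda>k. length ((L(a := y # L a)) k)"] by simp
qed

section \<open>Correctness and running time of the search\<close>

context graph_input
begin

definition base :: "bool \<Rightarrow> nat" where
  "base c = (if c then n else 0)"

text \<open>Searching the complement means preferring few visited neighbours; with this key both searches
  pick a vertex of maximum key.\<close>

definition search_key :: "bool \<Rightarrow> nat set \<Rightarrow> nat \<Rightarrow> nat" where
  "search_key c A v = (if c then n - num_nbrs E A v else n + num_nbrs E A v)"

text \<open>\<open>L k\<close> is the list stored in bucket \<open>k\<close>, stale entries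
  included. Keys start at \<open>n\<close> and move by at most \<open>n\<close> in one direction, so
  buckets up to \<open>2 * n\<close> serve both searches.\<close>

definition buckets :: "state \<Rightarrow> (nat \<Rightarrow> nat list) \<Rightarrow> bool" where
  "buckets s L \<longleftrightarrow> (\<forall>k\<le>2 * n. chain (arr s ''x'') (arr s ''h'' k) (L k) \<and>
     (\<forall>j\<in>set (L k). 1 \<le> j \<and> j \<le> reg s ''e'' \<and> arr s ''u'' j < n))"

text \<open>Guarantees that no unvisited vertex is lost. The exempt set \<open>A\<close> is separate
  from the visited set because it has one vertex more between the removal of an entry and the visit
  of its vertex.\<close>

definition covered :: "state \<Rightarrow> nat set \<Rightarrow> (nat \<Rightarrow> nat list) \<Rightarrow> bool" where
  "covered s A L \<longleftrightarrow> (\<forall>v<n. v \<notin> A \<longrightarrow> v \<in> arr s ''u'' ` set (L (arr s ''ky'' v)))"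

lemma num_nbrs_le_n: "A \<subseteq> {..<n} \<Longrightarrow> num_nbrs R A v \<le> n"
proof -
  assume "A \<subseteq> {..<n}"
  then have "{z \<in> A. R z v} \<subseteq> {..<n}" by auto
  then have "card {z \<in> A. R z v} \<le> card {..<n}" by (intro card_mono) auto
  then show ?thesis by (simp add: num_nbrs_def)
qed

lemma search_key_le: "A \<subseteq> {..<n} \<Longrightarrow> search_key c A v \<le> 2 * n"
  using num_nbrs_le_n[of A E v] unfolding search_key_def by (cases c) (simp_all add: le_trans)

lemma num_nbrs_insert:
  assumes "finite A" "v \<notin> A"
  shows "num_nbrs R (insert v A) w = (if R v w then Suc (num_nbrs R A w) else num_nbrs R A w)"
proof -
  have "{z \<in> insert v A. R z w} = (if R v w then insert v {z \<in> A. R z w} else {z \<in> A. R z w})"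
    by auto
  then show ?thesis using assms by (simp add: num_nbrs_def)
qed

lemma num_nbrs_True_add:
  assumes "A \<subseteq> {..<n}" "y < n" "y \<notin> A"
  shows "num_nbrs (rel G True) A y + num_nbrs E A y = card A"
proof -
  have fin: "finite A" using assms finite_subset by blast
  have "{z \<in> A. rel G True z y} = A - {z \<in> A. E z y}"
    using assms rel_True_iff[of _ G y] verts_eq by (auto simp: rel_def)
  then have "num_nbrs (rel G True) A y = card A - num_nbrs E A y"
    using fin by (simp add: num_nbrs_def card_Diff_subset)
  moreover have "num_nbrs E A y \<le> card A" unfolding num_nbrs_def using fin by (intro card_mono) auto
  ultimately show ?thesis by simp
qed

lemma search_scan_wp:
  assumes inp: "input s0" and v: "v < n" "v \<notin> A" "A \<subseteq> {..<n}"
    and r: "reg s0 ''a'' = off v" "reg s0 ''z'' = off (Suc v)" "reg s0 ''b'' = base c"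
    and ky: "\<And>w. w < n \<Longrightarrow> arr s0 ''ky'' w = search_key c A w"
    and bu: "buckets s0 L" and co: "covered s0 B L" and e: "reg s0 ''e'' + deg v \<le> n + M"
  shows "wp W search_scan (\<lambda>t s'. t \<le> 38 * deg v + 4 \<and>
      (\<forall>w<n. arr s' ''ky'' w = search_key c (insert v A) w) \<and>
      (\<exists>L'. buckets s' L' \<and> covered s' B L' \<and>
        (\<Sum>k\<le>2 * n. length (L' k)) = (\<Sum>k\<le>2 * n. length (L k)) + deg v) \<and>
      reg s' ''e'' = reg s0 ''e'' + deg v \<and> frame search_scan s0 s') s0"
proof -
  \<comment> \<open>The neighbours processed so far; during the scan only their keys already take
    \<open>v\<close> into account.\<close>
  define ws where "ws = (\<lambda>a. take (a - off v) (adj ! v))"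
  define I where "I = (\<lambda>a s.
    (\<forall>w<n. arr s ''ky'' w = search_key c (if w \<in> set (ws a) then insert v A else A) w) \<and>
    (\<exists>L'. buckets s L' \<and> covered s B L' \<and>
      (\<Sum>k\<le>2 * n. length (L' k)) = (\<Sum>k\<le>2 * n. length (L k)) + (a - off v)) \<and>
    reg s ''e'' = reg s0 ''e'' + (a - off v))"
  have finA: "finite A" using v(3) finite_subset by blast
  have insA: "insert v A \<subseteq> {..<n}" using v by auto
  have cnS: "num_nbrs E (insert v A) w = Suc (num_nbrs E A w)" if "E w v" for w
    using num_nbrs_insert[OF finA v(2), of E w] that rel_commute[of G False w v] by simp
  have kfS: "search_key c (insert v A) w = (if c then search_key c A w - 1 else search_key c A w + 1)"
    "c \<Longrightarrow> 1 \<le> search_key c A w" if "E w v" for w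
    using cnS[OF that] num_nbrs_le_n[OF insA, of E w] by (auto simp: search_key_def)
  have n0: "0 < n" using v(1) by linarith
  have step: "I (Suc a) s'"
    if I: "I a s" and a: "off v \<le> a" "a < off (Suc v)"
      and w: "w = adj ! v ! (a - off v)"
      and s': "arr s' ''ky'' = (arr s ''ky'')(w := search_key c (insert v A) w)"
        "arr s' ''u'' = (arr s ''u'')(Suc (reg s ''e'') := w)"
        "arr s' ''x'' = (arr s ''x'')(Suc (reg s ''e'') := arr s ''h'' (search_key c (insert v A) w))"
        "arr s' ''h'' = (arr s ''h'')(search_key c (insert v A) w := Suc (reg s ''e''))"
        "reg s' ''e'' = Suc (reg s ''e'')" for a s s' w
  proof -
    let ?k = "search_key c (insert v A) w" and ?e = "Suc (reg s ''e'')"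
    have ad: "a - off v < deg v" using a off_Suc[OF v(1)] by linarith
    have wv: "E w v" "w < n"
      using set_adj[OF v(1)] ad w verts_eq nth_mem[of "a - off v" "adj ! v"]
      by (auto simp: deg_def rel_def)
    have k: "?k \<le> 2 * n" by (rule search_key_le[OF insA])
    have wsS: "set (ws (Suc a)) = insert w (set (ws a))"
      using ad w a(1) by (simp add: ws_def Suc_diff_le deg_def take_Suc_conv_app_nth)
    from I obtain L1 where L1: "buckets s L1" "covered s B L1"
      "(\<Sum>k\<le>2 * n. length (L1 k)) = (\<Sum>k\<le>2 * n. length (L k)) + (a - off v)"
      unfolding I_def by blast
    define L2 where "L2 = L1(?k := ?e # L1 ?k)"
    \<comment> \<open>All listed entries are at most the old value of \<open>e\<close>, so the new
      entry occurs in no list and writing it breaks no chain.\<close>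
    have fresh: "?e \<notin> set (L1 k)" if "k \<le> 2 * n" for k
      using L1(1) that unfolding buckets_def by (metis not_less_eq_eq le_refl)
    have "buckets s' L2" unfolding buckets_def
    proof (intro allI impI conjI ballI)
      fix k' assume k': "k' \<le> 2 * n"
      have c1: "chain (arr s ''x'') (arr s ''h'' k') (L1 k')"
        "chain (arr s ''x'') (arr s ''h'' ?k) (L1 ?k)"
        using L1(1) k' k unfolding buckets_def by blast+
      show "chain (arr s' ''x'') (arr s' ''h'' k') (L2 k')"
        using c1 chain_upd[OF fresh[OF k']] chain_upd[OF fresh[OF k]] by (simp add: s' L2_def)
      fix j assume "j \<in> set (L2 k')"
      then have "j = ?e \<or> j \<in> set (L1 k')" by (auto simp: L2_def split: if_splits)
      then show "1 \<le> j" "j \<le> reg s' ''e''" "arr s' ''u'' j < n"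
        using L1(1) k' wv(2) unfolding buckets_def by (auto simp: s' le_SucI)
    qed
    moreover have "covered s' B L2" unfolding covered_def
    proof (intro allI impI)
      fix x assume x: "x < n" "x \<notin> B"
      show "x \<in> arr s' ''u'' ` set (L2 (arr s' ''ky'' x))"
      proof (cases "x = w")
        case True
        then show ?thesis by (simp add: s' L2_def)
      next
        case False
        have "arr s ''ky'' x = search_key c (if x \<in> set (ws a) then insert v A else A) x"
          using I x unfolding I_def by blast
        then have kx: "arr s ''ky'' x \<le> 2 * n" using search_key_le[OF insA] search_key_le[OF v(3)] by simp
        obtain j where j: "j \<in> set (L1 (arr s ''ky'' x))" "x = arr s ''u'' j"
          using L1(2) x unfolding covered_def by blast
        then have "j \<noteq> ?e" using fresh[OF kx] by blast
        then have "x = arr s' ''u'' j" using j by (simp add: s')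
        moreover have "j \<in> set (L2 (arr s' ''ky'' x))"
        proof -
          have "set (L1 k) \<subseteq> set (L2 k)" for k by (auto simp: L2_def)
          then show ?thesis using j(1) False by (auto simp: s'(1))
        qed
        ultimately show ?thesis by blast
      qed
    qed
    moreover have "(\<Sum>k\<le>2 * n. length (L2 k)) = (\<Sum>k\<le>2 * n. length (L k)) + (Suc a - off v)"
      unfolding L2_def using sum_length_push[of "{..2 * n}" ?k L1 ?e] k L1(3) a(1) by simp
    moreover have "\<forall>x<n. arr s' ''ky'' x = search_key c (if x \<in> set (ws (Suc a)) then insert v A else A) x"
      using I unfolding wsS I_def by (simp add: s')
    moreover have "reg s' ''e'' = reg s0 ''e'' + (Suc a - off v)"
      using I a(1) by (simp add: s' I_def)
    ultimately show ?thesis unfolding I_def by blast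
  qed
  have "wp W search_scan (\<lambda>t s'. t \<le> (30 + 8) * (reg s0 ''z'' - reg s0 ''a'') + 4 \<and>
    I (reg s0 ''z'') s' \<and> reg s' ''a'' = reg s0 ''z'' \<and> frame search_scan s0 s') s0"
    unfolding search_scan_def
  proof (rule wp_For)
    show "I (reg s0 ''a'') s0" using ky bu co by (auto simp: I_def r ws_def)
    show "reg s0 ''a'' \<le> reg s0 ''z''" using off_Suc[OF v(1)] by (simp add: r)
    show "reg s0 ''z'' < W" using off_le[of "Suc v"] W by (simp add: r)
    show "1 < W" using W by simp
  next
    fix s a assume I: "I a s" and fr: "frame (For ''a'' ''z'' (seqs [
     Assign ''w'' (Get ''adj'' (V ''a'')),
     If (Eq (V ''b'') (N 0))
       (Put ''ky'' (V ''w'') (Plus (Get ''ky'' (V ''w'')) (N 1)))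
       (Put ''ky'' (V ''w'') (Minus (Get ''ky'' (V ''w'')) (N 1))),
     Assign ''e'' (Plus (V ''e'') (N 1)),
     Put ''u'' (V ''e'') (V ''w''),
     Put ''x'' (V ''e'') (Get ''h'' (Get ''ky'' (V ''w''))),
     Put ''h'' (Get ''ky'' (V ''w'')) (V ''e'')])) s0 s"
      and a: "reg s ''a'' = a" "reg s0 ''a'' \<le> a" "a < reg s0 ''z''"
    have inps: "input s" by (rule input_frame[OF inp fr]) auto
    have b: "reg s ''b'' = base c" using frame_reg[OF fr, of "''b''"] r by simp
    have b0: "reg s ''b'' = 0 \<longleftrightarrow> \<not> c" using b n0 by (auto simp: base_def)
    define w where "w = adj ! v ! (a - off v)"
    have ad: "a - off v < deg v" "off v \<le> a" "a < off (Suc v)" using a r off_Suc[OF v(1)] by auto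
    have adja: "arr s ''adj'' a = w"
      using input_adj[OF inps v(1) ad(1)] ad(2) by (simp add: w_def)
    have aM: "a < M" using nth_concat_adj(2)[OF v(1) ad(1)] ad(2) by simp
    have wv: "E w v" "w < n"
      using set_adj[OF v(1)] ad w_def verts_eq nth_mem[of "a - off v" "adj ! v"]
      by (auto simp: deg_def rel_def)
    have "w \<notin> set (ws a)"
      using distinct_adj[OF v(1)] ad(1)
      by (auto simp: w_def ws_def deg_def in_set_conv_nth nth_eq_iff_index_eq)
    then have kw: "arr s ''ky'' w = search_key c A w" using I wv by (simp add: I_def)
    have eb: "reg s ''e'' < n + M" using I e ad by (auto simp: I_def)
    have hk: "arr s ''h'' (search_key c (insert v A) w) < W"
    proof -
      obtain L1 where L1: "buckets s L1" using I unfolding I_def by blast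
      have "chain (arr s ''x'') (arr s ''h'' (search_key c (insert v A) w)) (L1 (search_key c (insert v A) w))"
        "\<forall>j\<in>set (L1 (search_key c (insert v A) w)). j \<le> reg s ''e''"
        using L1 search_key_le[OF insA] unfolding buckets_def by blast+
      then have "arr s ''h'' (search_key c (insert v A) w) \<le> reg s ''e''"
        by (cases "L1 (search_key c (insert v A) w)") auto
      then show ?thesis using eb W by linarith
    qed
    have kb: "search_key c A w \<le> 2 * n" "search_key c (insert v A) w \<le> 2 * n"
      using search_key_le[OF insA] search_key_le[OF v(3)] by auto
    have bW: "reg s ''b'' < W" using b W by (simp add: base_def)
    have "wp W (seqs [
       Assign ''w'' (Get ''adj'' (V ''a'')),
       If (Eq (V ''b'') (N 0))
         (Put ''ky'' (V ''w'') (Plus (Get ''ky'' (V ''w'')) (N 1)))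
         (Put ''ky'' (V ''w'') (Minus (Get ''ky'' (V ''w'')) (N 1))),
       Assign ''e'' (Plus (V ''e'') (N 1)),
       Put ''u'' (V ''e'') (V ''w''),
       Put ''x'' (V ''e'') (Get ''h'' (Get ''ky'' (V ''w''))),
       Put ''h'' (Get ''ky'' (V ''w'')) (V ''e'')])
       (\<lambda>t s'. t \<le> 30 \<and> arr s' ''ky'' = (arr s ''ky'')(w := search_key c (insert v A) w) \<and>
        arr s' ''u'' = (arr s ''u'')(Suc (reg s ''e'') := w) \<and>
        arr s' ''x'' = (arr s ''x'')(Suc (reg s ''e'') := arr s ''h'' (search_key c (insert v A) w)) \<and>
        arr s' ''h'' = (arr s ''h'')(search_key c (insert v A) w := Suc (reg s ''e'')) \<and>
        reg s' ''e'' = Suc (reg s ''e'')) s"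
      using W a(1) adja aM wv kw eb hk kb bW b0 kfS[OF wv(1)] by auto
    then show "wp W (seqs [
       Assign ''w'' (Get ''adj'' (V ''a'')),
       If (Eq (V ''b'') (N 0))
         (Put ''ky'' (V ''w'') (Plus (Get ''ky'' (V ''w'')) (N 1)))
         (Put ''ky'' (V ''w'') (Minus (Get ''ky'' (V ''w'')) (N 1))),
       Assign ''e'' (Plus (V ''e'') (N 1)),
       Put ''u'' (V ''e'') (V ''w''),
       Put ''x'' (V ''e'') (Get ''h'' (Get ''ky'' (V ''w''))),
       Put ''h'' (Get ''ky'' (V ''w'')) (V ''e'')])
       (\<lambda>t s'. t \<le> 30 \<and> I (Suc a) (s'\<lparr>reg := (reg s')(''a'' := Suc a)\<rparr>)) s"
      by (rule wp_mono) (simp add: step[OF I ad(2,3) w_def])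
  qed auto
  then show ?thesis
  proof (rule wp_mono, elim conjE, intro conjI)
    fix t s' assume t: "t \<le> (30 + 8) * (reg s0 ''z'' - reg s0 ''a'') + 4"
      and I: "I (reg s0 ''z'') s'" and f: "frame search_scan s0 s'"
    have d: "reg s0 ''z'' - off v = deg v" using off_Suc[OF v(1)] by (simp add: r)
    show "t \<le> 38 * deg v + 4" using t d by (simp add: r)
    have "ws (reg s0 ''z'') = adj ! v" unfolding ws_def d by (simp add: deg_def)
    then have *: "\<forall>w<n. arr s' ''ky'' w = search_key c (if w \<in> set (adj ! v) then insert v A else A) w"
      using I by (simp add: I_def)
    show "\<forall>w<n. arr s' ''ky'' w = search_key c (insert v A) w"
    proof (intro allI impI)
      fix w assume w: "w < n"
      have "num_nbrs E (insert v A) w = num_nbrs E A w" if "w \<notin> set (adj ! v)"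
        using num_nbrs_insert[OF finA v(2), of E w] that set_adj[OF v(1)] rel_commute[of G False w v]
        by simp
      then show "arr s' ''ky'' w = search_key c (insert v A) w" using * w by (auto simp: search_key_def)
    qed
    show "\<exists>L'. buckets s' L' \<and> covered s' B L' \<and>
        (\<Sum>k\<le>2 * n. length (L' k)) = (\<Sum>k\<le>2 * n. length (L k)) + deg v"
      using I unfolding I_def d by blast
    show "reg s' ''e'' = reg s0 ''e'' + deg v" using I unfolding I_def d by blast
    show "frame search_scan s0 s'" by (rule f)
  qed
qed

definition search_inv ::
    "bool \<Rightarrow> state \<Rightarrow> nat list \<Rightarrow> nat set \<Rightarrow> (nat \<Rightarrow> nat list) \<Rightarrow> bool" where
  "search_inv c s xs B L \<longleftrightarrow>
     xs = map (\<lambda>k. arr s ''o'' (base c + k)) [0..<length xs] \<and> reg s ''i'' = length xs \<and>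
     distinct xs \<and> set xs \<subseteq> {..<n} \<and>
     (\<forall>v<n. arr s ''vs'' v = (if v \<in> set xs then 1 else 0)) \<and>
     (\<forall>v<n. arr s ''ky'' v = search_key c (set xs) v) \<and>
     buckets s L \<and> covered s B L \<and>
     (\<forall>v<n. v \<notin> set xs \<longrightarrow> search_key c (set xs) v \<le> reg s ''c'') \<and>
     all_prefixes (\<lambda>ys x. arr s ''d'' (base c + x) = num_nbrs (rel G c) (set ys) x \<and>
       (\<forall>y<n. y \<notin> set ys \<longrightarrow> num_nbrs (rel G c) (set ys) y \<le> num_nbrs (rel G c) (set ys) x)) xs \<and>
     reg s ''e'' \<le> n + (\<Sum>v\<in>set xs. deg v) \<and> reg s ''c'' \<le> n + length xs"

text \<open>The 30 for a unit of \<open>c\<close> or for an entry pays for a step that uses it up. A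
  visit of \<open>v\<close> spends \<open>38 * deg v\<close> on the scan and
  \<open>30 * deg v\<close> on new entries, within \<open>80 * deg v\<close>; its constant costs and
  the rise of \<open>c\<close> fit into 200.\<close>

definition search_pot :: "state \<Rightarrow> nat list \<Rightarrow> (nat \<Rightarrow> nat list) \<Rightarrow> nat" where
  "search_pot s xs L = 30 * reg s ''c'' + 30 * (\<Sum>k\<le>2 * n. length (L k)) +
     80 * (\<Sum>v\<in>{..<n} - set xs. deg v) + 200 * (n - length xs)"

text \<open>Both searches write to \<open>o\<close> and \<open>d\<close>. The frame condition speaks
  of whole arrays only, so it has to be said separately that the half of the other search
  survives.\<close>

definition same_outside :: "bool \<Rightarrow> state \<Rightarrow> state \<Rightarrow> bool" where
  "same_outside c s s' \<longleftrightarrow> (\<forall>i. i < base c \<or> base c + n \<le> i \<longrightarrow>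
     arr s' ''o'' i = arr s ''o'' i \<and> arr s' ''d'' i = arr s ''d'' i)"

lemma length_less_n:
  assumes "distinct xs" "set xs \<subseteq> {..<n}" "v < n" "v \<notin> set xs"
  shows "length xs < n"
proof -
  have "set xs \<subset> {..<n}" using assms by auto
  then have "card (set xs) < card {..<n}" by (intro psubset_card_mono) auto
  then show ?thesis using distinct_card[OF assms(1)] by simp
qed

lemma sum_deg_remove:
  assumes "A \<subseteq> {..<n}" "v < n" "v \<notin> A"
  shows "(\<Sum>x\<in>{..<n} - A. deg x) = deg v + (\<Sum>x\<in>{..<n} - insert v A. deg x)"
proof -
  have "{..<n} - insert v A = ({..<n} - A) - {v}" by auto
  then show ?thesis using sum.remove[of "{..<n} - A" v deg] assms by simp
qed

lemma search_visit_wp: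
  assumes inp: "input s" and S: "search_inv c s xs (insert v (set xs)) L" and b: "reg s ''b'' = base c"
    and v: "reg s ''v'' = v" "v < n" "v \<notin> set xs" "search_key c (set xs) v = reg s ''c''"
    and out: "same_outside c s0 s"
  shows "wp W search_visit (\<lambda>t s'. \<exists>xs' L'. search_inv c s' xs' (set xs') L' \<and>
    search_pot s' xs' L' + t + 30 \<le> search_pot s xs L \<and> same_outside c s0 s') s"
proof -
  note S' = S[unfolded search_inv_def]
  have xs: "distinct xs" "set xs \<subseteq> {..<n}" "reg s ''i'' = length xs"
    "xs = map (\<lambda>k. arr s ''o'' (base c + k)) [0..<length xs]"
    using S' by blast+
  have ky: "\<And>w. w < n \<Longrightarrow> arr s ''ky'' w = search_key c (set xs) w" using S' by blast
  have mx: "\<And>y. y < n \<Longrightarrow> y \<notin> set xs \<Longrightarrow> search_key c (set xs) y \<le> search_key c (set xs) v"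
    using S' v(4) by simp
  have cb: "reg s ''c'' \<le> n + length xs" using S' by blast
  have bu: "buckets s L" "covered s (insert v (set xs)) L" using S' by blast+
  have len: "length xs < n" using length_less_n[OF xs(1,2) v(2,3)] .
  have n0: "0 < n" using v(2) by linarith
  have b0: "reg s ''b'' = 0 \<longleftrightarrow> \<not> c" using b n0 by (auto simp: base_def)
  \<comment> \<open>The number of visited vertices is the same for all candidates, so few visited
    neighbours means many visited non-neighbours.\<close>
  have num_nbrs: "num_nbrs (rel G c) (set xs) y =
      (if c then length xs - num_nbrs E (set xs) y else num_nbrs E (set xs) y)" if "y < n" "y \<notin> set xs" for y
    using num_nbrs_True_add[OF xs(2) that] distinct_card[OF xs(1)] by (cases c) auto
  have cnb: "num_nbrs E (set xs) y \<le> n" for y by (rule num_nbrs_le_n[OF xs(2)])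
  have best: "num_nbrs (rel G c) (set xs) y \<le> num_nbrs (rel G c) (set xs) v" if "y < n" "y \<notin> set xs" for y
  proof (cases c)
    case True
    have "n - num_nbrs E (set xs) y \<le> n - num_nbrs E (set xs) v" using mx[OF that] True by (simp add: search_key_def)
    then have "num_nbrs E (set xs) v \<le> num_nbrs E (set xs) y" using cnb[of y] cnb[of v] by linarith
    then show ?thesis using num_nbrs[OF that] num_nbrs[OF v(2,3)] True by simp
  next
    case False
    then show ?thesis using mx[OF that] by (simp add: search_key_def)
  qed
  have dv: "num_nbrs (rel G c) (set xs) v =
      (if c then length xs + search_key c (set xs) v - n else search_key c (set xs) v - n)"
    using num_nbrs[OF v(2,3)] cnb[of v] by (cases c) (auto simp: search_key_def)
  \<comment> \<open>So far there are \<open>n\<close> initial entries and one per neighbour of each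
    visited vertex; adding those of \<open>v\<close> stays within the total degree
    \<open>M\<close>.\<close>
  have eb: "reg s ''e'' + deg v \<le> n + M"
  proof -
    have "(\<Sum>x<n. deg x) = (\<Sum>x\<in>{..<n} - set xs. deg x) + (\<Sum>x\<in>set xs. deg x)"
      using sum.subset_diff[OF xs(2), of deg] by simp
    then show ?thesis using sum_deg sum_deg_remove[OF xs(2) v(2,3)] S' by linarith
  qed
  define s1 where "s1 = s\<lparr>
     reg := (reg s)(''a'' := off v, ''z'' := off (Suc v)),
     arr := (arr s)(''vs'' := (arr s ''vs'')(v := 1),
       ''o'' := (arr s ''o'')(base c + length xs := v),
       ''d'' := (arr s ''d'')(base c + v := num_nbrs (rel G c) (set xs) v))\<rparr>"
  have inp1: "input s1" using inp by (simp add: s1_def input_def)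
  have bu1: "buckets s1 L" "covered s1 (set (xs @ [v])) L"
    using bu by (auto simp: s1_def buckets_def covered_def)
  have "wp W search_scan (\<lambda>t s'. t \<le> 38 * deg v + 4 \<and>
      (\<forall>w<n. arr s' ''ky'' w = search_key c (insert v (set xs)) w) \<and>
      (\<exists>L'. buckets s' L' \<and> covered s' (set (xs @ [v])) L' \<and>
        (\<Sum>k\<le>2 * n. length (L' k)) = (\<Sum>k\<le>2 * n. length (L k)) + deg v) \<and>
      reg s' ''e'' = reg s1 ''e'' + deg v \<and> frame search_scan s1 s') s1"
    by (rule search_scan_wp[OF inp1 v(2,3) xs(2)])
      (use ky eb b bu1 in \<open>auto simp: s1_def\<close>)
  then have scan: "wp W search_scan (\<lambda>t. wp W (seqs [Assign ''i'' (Plus (V ''i'') (N 1)),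
      Assign ''c'' (Plus (V ''c'') (N 1))]) (\<lambda>t' s'. \<exists>xs' L'. search_inv c s' xs' (set xs') L' \<and>
      search_pot s' xs' L' + (t + t' + 36) + 30 \<le> search_pot s xs L \<and> same_outside c s0 s')) s1"
  proof (rule wp_mono, elim conjE exE)
    fix t s' L' assume t: "t \<le> 38 * deg v + 4"
      and k: "\<forall>w<n. arr s' ''ky'' w = search_key c (insert v (set xs)) w"
      and L': "buckets s' L'" "covered s' (set (xs @ [v])) L'"
        "(\<Sum>k\<le>2 * n. length (L' k)) = (\<Sum>k\<le>2 * n. length (L k)) + deg v"
      and e: "reg s' ''e'' = reg s1 ''e'' + deg v" and f: "frame search_scan s1 s'"
    have rs: "reg s' ''i'' = length xs" "reg s' ''c'' = reg s ''c''"
      using f xs(3) by (auto simp: frame_def search_scan_def s1_def)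
    have as: "arr s' ''o'' = (arr s ''o'')(base c + length xs := v)"
      "arr s' ''d'' = (arr s ''d'')(base c + v := num_nbrs (rel G c) (set xs) v)"
      "arr s' ''vs'' = (arr s ''vs'')(v := 1)"
      using f by (auto simp: frame_def search_scan_def s1_def)
    define s2 where "s2 = s'\<lparr>reg := (reg s')(''i'' := Suc (length xs), ''c'' := Suc (reg s ''c''))\<rparr>"
    have "search_inv c s2 (xs @ [v]) (set (xs @ [v])) L'" unfolding search_inv_def
    proof (intro conjI)
      have "map (\<lambda>k. arr s2 ''o'' (base c + k)) [0..<length xs] =
          map (\<lambda>k. arr s ''o'' (base c + k)) [0..<length xs]"
        by (rule map_cong) (auto simp: s2_def as)
      then show "xs @ [v] = map (\<lambda>k. arr s2 ''o'' (base c + k)) [0..<length (xs @ [v])]"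
        using xs(4) by (simp add: s2_def as)
      show "reg s2 ''i'' = length (xs @ [v])" by (simp add: s2_def)
      show "distinct (xs @ [v])" "set (xs @ [v]) \<subseteq> {..<n}" using xs v by auto
      show "\<forall>x<n. arr s2 ''vs'' x = (if x \<in> set (xs @ [v]) then 1 else 0)"
        using S' by (auto simp: s2_def as)
      show "\<forall>x<n. arr s2 ''ky'' x = search_key c (set (xs @ [v])) x" using k by (simp add: s2_def)
      show "buckets s2 L'" "covered s2 (set (xs @ [v])) L'"
        using L' by (auto simp: s2_def buckets_def covered_def)
      show "\<forall>x<n. x \<notin> set (xs @ [v]) \<longrightarrow> search_key c (set (xs @ [v])) x \<le> reg s2 ''c''"
      proof (intro allI impI)
        fix x assume x: "x < n" "x \<notin> set (xs @ [v])"
        \<comment> \<open>Only the search of the graph raises keys, and by one per visit; the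
          increment of \<open>c\<close> covers this.\<close>
        have "search_key c (set (xs @ [v])) x \<le> Suc (search_key c (set xs) x)"
          using num_nbrs_insert[of "set xs" v E x] v(3) by (auto simp: search_key_def)
        also have "search_key c (set xs) x \<le> reg s ''c''" using mx[of x] x v(4) by simp
        finally show "search_key c (set (xs @ [v])) x \<le> reg s2 ''c''" by (simp add: s2_def)
      qed
      show "all_prefixes (\<lambda>ys x. arr s2 ''d'' (base c + x) = num_nbrs (rel G c) (set ys) x \<and>
        (\<forall>y<n. y \<notin> set ys \<longrightarrow> num_nbrs (rel G c) (set ys) y \<le> num_nbrs (rel G c) (set ys) x)) (xs @ [v])"
        unfolding all_prefixes_snoc
      proof (intro conjI)
        have old: "all_prefixes (\<lambda>ys x. arr s ''d'' (base c + x) = num_nbrs (rel G c) (set ys) x \<and>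
          (\<forall>y<n. y \<notin> set ys \<longrightarrow> num_nbrs (rel G c) (set ys) y \<le> num_nbrs (rel G c) (set ys) x)) xs"
          using S' by blast
        show "all_prefixes (\<lambda>ys x. arr s2 ''d'' (base c + x) = num_nbrs (rel G c) (set ys) x \<and>
          (\<forall>y<n. y \<notin> set ys \<longrightarrow> num_nbrs (rel G c) (set ys) y \<le> num_nbrs (rel G c) (set ys) x)) xs"
        proof (rule all_prefixes_mono[OF old])
          fix ys x zs assume "xs = ys @ x # zs" and
            Q: "arr s ''d'' (base c + x) = num_nbrs (rel G c) (set ys) x \<and>
              (\<forall>y<n. y \<notin> set ys \<longrightarrow> num_nbrs (rel G c) (set ys) y \<le> num_nbrs (rel G c) (set ys) x)"
          then have "x \<noteq> v" using v(3) by auto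
          then show "arr s2 ''d'' (base c + x) = num_nbrs (rel G c) (set ys) x \<and>
              (\<forall>y<n. y \<notin> set ys \<longrightarrow> num_nbrs (rel G c) (set ys) y \<le> num_nbrs (rel G c) (set ys) x)"
            using Q by (simp add: s2_def as)
        qed
        show "arr s2 ''d'' (base c + v) = num_nbrs (rel G c) (set xs) v" by (simp add: s2_def as)
        show "\<forall>y<n. y \<notin> set xs \<longrightarrow> num_nbrs (rel G c) (set xs) y \<le> num_nbrs (rel G c) (set xs) v"
          using best by blast
      qed
      show "reg s2 ''e'' \<le> n + (\<Sum>v\<in>set (xs @ [v]). deg v)"
        using S' e v(3) by (simp add: s2_def s1_def)
      show "reg s2 ''c'' \<le> n + length (xs @ [v])" using cb by (simp add: s2_def)
    qed
    moreover have "search_pot s2 (xs @ [v]) L' + (t + 8 + 36) + 30 \<le> search_pot s xs L"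
    proof -
      have "n - length xs = Suc (n - length (xs @ [v]))" using len by simp
      then show ?thesis
        using t L'(3) sum_deg_remove[OF xs(2) v(2,3)] by (simp add: search_pot_def s2_def)
    qed
    moreover have "same_outside c s0 s2"
      using out v(2) len by (auto simp: same_outside_def s2_def as)
    ultimately have "\<exists>xs' L'. search_inv c s2 xs' (set xs') L' \<and>
        search_pot s2 xs' L' + (t + 8 + 36) + 30 \<le> search_pot s xs L \<and> same_outside c s0 s2" by blast
    then show "wp W (seqs [Assign ''i'' (Plus (V ''i'') (N 1)),
      Assign ''c'' (Plus (V ''c'') (N 1))]) (\<lambda>t' s'. \<exists>xs' L'. search_inv c s' xs' (set xs') L' \<and>
      search_pot s' xs' L' + (t + t' + 36) + 30 \<le> search_pot s xs L \<and> same_outside c s0 s') s'"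
      using rs len cb W by (simp add: s2_def)
  qed
  have offb: "off v < W" "off (Suc v) < W"
    using off_le[of v] off_le[of "Suc v"] W by linarith+
  have offs: "arr s ''off'' v = off v" "arr s ''off'' (Suc v) = off (Suc v)"
    using input_off[OF inp] v(2) by simp_all
  have kb: "search_key c (set xs) v \<le> 2 * n" by (rule search_key_le[OF xs(2)])
  have pre: "wp W (seqs [
       Put ''vs'' (V ''v'') (N 1),
       Put ''o'' (Plus (V ''b'') (V ''i'')) (V ''v''),
       If (Eq (V ''b'') (N 0))
         (Put ''d'' (Plus (V ''b'') (V ''v'')) (Minus (Get ''ky'' (V ''v'')) (V ''n'')))
         (Put ''d'' (Plus (V ''b'') (V ''v''))
           (Minus (Plus (V ''i'') (Get ''ky'' (V ''v''))) (V ''n''))),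
       Assign ''a'' (Get ''off'' (V ''v'')),
       Assign ''z'' (Get ''off'' (Plus (V ''v'') (N 1)))]) (\<lambda>t s'. t \<le> 36 \<and> s' = s1) s"
  proof -
    have "reg s ''b'' \<le> n" using b by (simp add: base_def)
    moreover have "reg s ''i'' < n" using xs(3) len by simp
    moreover have "arr s ''ky'' v = search_key c (set xs) v" by (rule ky[OF v(2)])
    moreover have "reg s ''n'' = n" by (rule input_n[OF inp])
    ultimately show ?thesis
      using W v(1,2) b[symmetric] b0 xs(3)[symmetric] offb offs kb dv
      by (auto simp: s1_def)
  qed
  show ?thesis unfolding search_visit_def
  proof (rule wp_seqs[OF pre], elim conjE)
    fix t :: nat and s' assume t: "t \<le> 36" and s': "s' = s1"
    show "wp W (seqs [search_scan, seqs [
       Assign ''i'' (Plus (V ''i'') (N 1)),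
       Assign ''c'' (Plus (V ''c'') (N 1))]]) (\<lambda>t' s'. \<exists>xs' L'. search_inv c s' xs' (set xs') L' \<and>
    search_pot s' xs' L' + (t + t') + 30 \<le> search_pot s xs L \<and> same_outside c s0 s') s'"
      unfolding s'
    proof (rule wp_seqs[OF scan], rule wp_seqs_single, erule wp_mono, elim exE conjE)
      fix t' s' t'' s'' xs' L'
      assume "search_inv c s'' xs' (set xs') L'" "same_outside c s0 s''"
        "search_pot s'' xs' L' + (t' + t'' + 36) + 30 \<le> search_pot s xs L"
      then show "\<exists>xs' L'. search_inv c s'' xs' (set xs') L' \<and>
          search_pot s'' xs' L' + (t + (t' + t'')) + 30 \<le> search_pot s xs L \<and> same_outside c s0 s''"
        using t by (intro exI[of _ xs'] exI[of _ L']) simp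
    qed
  qed
qed

lemma search_step_wp:
  assumes inp: "input s" and S: "search_inv c s xs (set xs) L" and b: "reg s ''b'' = base c"
    and lt: "reg s ''i'' < n" and out: "same_outside c s0 s"
  shows "wp W search_step (\<lambda>t s'. \<exists>xs' L'. search_inv c s' xs' (set xs') L' \<and>
    search_pot s' xs' L' + t + 4 \<le> search_pot s xs L \<and> same_outside c s0 s') s"
proof -
  note S' = S[unfolded search_inv_def]
  have xs: "distinct xs" "set xs \<subseteq> {..<n}" "reg s ''i'' = length xs"
    using S' by blast+
  have ky: "\<And>w. w < n \<Longrightarrow> arr s ''ky'' w = search_key c (set xs) w" using S' by blast
  have vs: "\<And>w. w < n \<Longrightarrow> arr s ''vs'' w = (if w \<in> set xs then 1 else 0)" using S' by blast
  have mx: "\<And>y. y < n \<Longrightarrow> y \<notin> set xs \<Longrightarrow> search_key c (set xs) y \<le> reg s ''c''" using S' by blast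
  have bu: "buckets s L" "covered s (set xs) L" using S' by blast+
  have c2: "reg s ''c'' \<le> 2 * n" using S' lt xs(3) by linarith
  have e: "reg s ''e'' \<le> n + M"
  proof -
    have "(\<Sum>x\<in>set xs. deg x) \<le> (\<Sum>x<n. deg x)" by (rule sum_mono2) (use xs(2) in auto)
    then show ?thesis using sum_deg S' by linarith
  qed
  obtain v0 where v0: "v0 < n" "v0 \<notin> set xs"
  proof -
    have "card (set xs) < card {..<n}" using lt xs distinct_card[OF xs(1)] by simp
    then have "\<not> {..<n} \<subseteq> set xs" by (metis List.finite_set card_mono not_le)
    then show ?thesis using that by blast
  qed
  have ch: "chain (arr s ''x'') (arr s ''h'' (reg s ''c'')) (L (reg s ''c''))"
    and el: "\<And>j. j \<in> set (L (reg s ''c'')) \<Longrightarrow> 1 \<le> j \<and> j \<le> reg s ''e'' \<and> arr s ''u'' j < n"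
    using bu(1) c2 unfolding buckets_def by blast+
  show ?thesis
  proof (cases "L (reg s ''c'')")
    case Nil
    then have h: "arr s ''h'' (reg s ''c'') = 0" using ch by simp
    \<comment> \<open>An unvisited vertex has an entry in the bucket of its key, so an empty bucket
      \<open>c\<close> means that no key equals \<open>c\<close> and the bound may be
      lowered.\<close>
    have ne: "search_key c (set xs) y \<noteq> reg s ''c''" if "y < n" "y \<notin> set xs" for y
      using bu(2) that ky[OF that(1)] Nil unfolding covered_def by force
    have c0: "0 < reg s ''c''" using ne[OF v0] mx[OF v0] by linarith
    define s1 where "s1 = s\<lparr>reg := (reg s)(''j'' := 0, ''c'' := reg s ''c'' - 1)\<rparr>"
    have "search_inv c s1 xs (set xs) L" unfolding search_inv_def
    proof (intro conjI)
      show "\<forall>x<n. x \<notin> set xs \<longrightarrow> search_key c (set xs) x \<le> reg s1 ''c''"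
      proof (intro allI impI)
        fix x assume x: "x < n" "x \<notin> set xs"
        show "search_key c (set xs) x \<le> reg s1 ''c''" using ne[OF x] mx[OF x] by (simp add: s1_def)
      qed
      have "reg s1 ''c'' \<le> reg s ''c''" by (simp add: s1_def)
      then show "reg s1 ''c'' \<le> n + length xs" using S' by linarith
      show "buckets s1 L" using bu by (simp add: s1_def buckets_def)
      show "covered s1 (set xs) L" using bu by (simp add: s1_def covered_def)
    qed (use S' in \<open>simp_all add: s1_def\<close>)
    moreover have "search_pot s1 xs L + 30 \<le> search_pot s xs L"
      using c0 by (simp add: search_pot_def s1_def)
    moreover have "same_outside c s0 s1" using out by (simp add: same_outside_def s1_def)
    ultimately show ?thesis
      using W c2 h by (auto simp: search_step_def s1_def intro!: exI[of _ xs] exI[of _ L])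
  next
    case (Cons j js)
    have h: "arr s ''h'' (reg s ''c'') = j" "j \<noteq> 0" "chain (arr s ''x'') (arr s ''x'' j) js"
      using ch Cons by auto
    have j: "j \<le> n + M" "arr s ''u'' j < n" using el[of j] Cons e by auto
    have xj: "arr s ''x'' j \<le> n + M"
      using h(3) el Cons e by (cases js) fastforce+
    define v where "v = arr s ''u'' j"
    define L1 where "L1 = L(reg s ''c'' := js)"
    define s1 where "s1 = s\<lparr>
      arr := (arr s)(''h'' := (arr s ''h'')(reg s ''c'' := arr s ''x'' j)),
      reg := (reg s)(''j'' := j, ''v'' := v)\<rparr>"
    have bu1: "buckets s1 L1" unfolding buckets_def
    proof (intro allI impI conjI)
      fix k assume k: "k \<le> 2 * n"
      have "chain (arr s ''x'') (arr s ''h'' k) (L k)"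
        "\<forall>j\<in>set (L k). 1 \<le> j \<and> j \<le> reg s ''e'' \<and> arr s ''u'' j < n"
        using bu(1) k unfolding buckets_def by blast+
      then show "chain (arr s1 ''x'') (arr s1 ''h'' k) (L1 k)"
        "\<forall>j\<in>set (L1 k). 1 \<le> j \<and> j \<le> reg s1 ''e'' \<and> arr s1 ''u'' j < n"
        using h(3) Cons by (auto simp: s1_def L1_def)
    qed
    have "(\<Sum>k\<le>2 * n. length (L k)) = Suc (\<Sum>k\<le>2 * n. length (L1 k))"
      using sum_length_push[of "{..2 * n}" "reg s ''c''" L1 j] c2 Cons
      by (simp add: L1_def fun_upd_idem)
    then have pot: "search_pot s1 xs L1 + 30 = search_pot s xs L"
      by (simp add: search_pot_def s1_def)
    have inp1: "input s1" using inp by (simp add: input_def s1_def)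
    have out1: "same_outside c s0 s1" using out by (simp add: same_outside_def s1_def)
    have b1: "reg s1 ''b'' = base c" using b by (simp add: s1_def)
    have v1: "reg s1 ''v'' = v" "v < n" using j by (simp_all add: s1_def v_def)
    have kv: "arr s ''ky'' v = search_key c (set xs) v" by (rule ky[OF v1(2)])
    have kb: "search_key c (set xs) v \<le> 2 * n" by (rule search_key_le[OF xs(2)])
    \<comment> \<open>The removed entry can be missed only by \<open>v\<close>, and only if
      \<open>v\<close> is unvisited with key \<open>c\<close>. In exactly this case \<open>v\<close>
      is visited at once.\<close>
    have cov: "covered s1 (insert v (set xs)) L1 \<and>
        (v \<in> set xs \<or> search_key c (set xs) v \<noteq> reg s ''c'' \<longrightarrow> covered s1 (set xs) L1)"
    proof -
      have "y \<in> arr s1 ''u'' ` set (L1 (arr s1 ''ky'' y))"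
        if y: "y < n" "y \<notin> set xs" and "y \<noteq> v \<or> search_key c (set xs) v \<noteq> reg s ''c''" for y
      proof -
        obtain i where i: "i \<in> set (L (arr s ''ky'' y))" "y = arr s ''u'' i"
          using bu(2) y unfolding covered_def by blast
        have "i \<in> set (L1 (arr s ''ky'' y))"
        proof (cases "arr s ''ky'' y = reg s ''c'' \<and> i = j")
          case True
          then have "y = v" using i by (simp add: v_def)
          then show ?thesis using that(3) kv True by simp
        qed (use i Cons in \<open>auto simp: L1_def\<close>)
        then show ?thesis using i by (simp add: s1_def)
      qed
      then show ?thesis unfolding covered_def by blast
    qed
    have kc: "covered s1 B L1 \<Longrightarrow> search_inv c s1 xs B L1" for B
      using S' bu1 unfolding search_inv_def by (simp add: s1_def)
    have main: "wp W (If (And (Eq (Get ''vs'' (V ''v'')) (N 0)) (Eq (Get ''ky'' (V ''v'')) (V ''c'')))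
           search_visit SKIP) (\<lambda>t s'. \<exists>xs' L'. search_inv c s' xs' (set xs') L' \<and>
      search_pot s' xs' L' + (t + 14) + 4 \<le> search_pot s xs L \<and> same_outside c s0 s') s1"
    proof (cases "v \<in> set xs \<or> search_key c (set xs) v \<noteq> reg s ''c''")
      case True
      have "search_inv c s1 xs (set xs) L1" using kc cov True by blast
      then show ?thesis
        using True pot out1 W kv kb v1(2) vs[OF v1(2)] c2
        by (auto simp: s1_def intro!: exI[of _ xs] exI[of _ L1])
    next
      case False
      have "wp W search_visit (\<lambda>t s'. \<exists>xs' L'. search_inv c s' xs' (set xs') L' \<and>
        search_pot s' xs' L' + t + 30 \<le> search_pot s1 xs L1 \<and> same_outside c s0 s') s1"
        by (rule search_visit_wp[OF inp1 kc b1 v1 _ _ out1]) (use cov False in \<open>auto simp: s1_def\<close>)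
      then have "wp W search_visit (\<lambda>t s'. \<exists>xs' L'. search_inv c s' xs' (set xs') L' \<and>
        search_pot s' xs' L' + (10 + t + 14) + 4 \<le> search_pot s xs L \<and> same_outside c s0 s') s1"
        by (rule wp_mono) (use pot in force)
      then show ?thesis
        using False W kv kb v1 vs[OF v1(2)] c2 by (simp add: s1_def)
    qed
    have "wp W (seqs [
         Put ''h'' (V ''c'') (Get ''x'' (V ''j'')),
         Assign ''v'' (Get ''u'' (V ''j'')),
         If (And (Eq (Get ''vs'' (V ''v'')) (N 0)) (Eq (Get ''ky'' (V ''v'')) (V ''c'')))
           search_visit
           SKIP]) (\<lambda>t s'. \<exists>xs' L'. search_inv c s' xs' (set xs') L' \<and>
        search_pot s' xs' L' + (t + 7) + 4 \<le> search_pot s xs L \<and> same_outside c s0 s')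
        (s\<lparr>reg := (reg s)(''j'' := j)\<rparr>)"
      using main h j xj W c2 by (simp add: s1_def v_def)
    then show ?thesis
      using h(1,2) j(1) W c2 by (simp add: search_step_def) 
  qed
qed

text \<open>The initial bucket: entry \<open>i + 1\<close> holds vertex \<open>i\<close> and points
  to entry \<open>i\<close>, so the list with head \<open>n\<close> runs down through all entries to
  the terminator 0.\<close>

lemma chain_rev:
  assumes "\<And>i. i < m \<Longrightarrow> x (Suc i) = i"
  shows "chain x m (rev [1..<Suc m])"
  using assms by (induction m) auto

lemma search_init_wp:
  assumes inp: "input s" and b: "reg s ''b'' = base c" and n0: "0 < n"
  shows "wp W search_init (\<lambda>t s'. t \<le> 32 * n + 24 \<and> reg s' ''b'' = base c \<and> input s' \<and>
    same_outside c s s' \<and> (\<exists>L. search_inv c s' [] {} L \<and> search_pot s' [] L = 260 * n + 80 * M)) s"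
proof -
  let ?p = "seqs [
       Put ''ky'' (V ''i'') (V ''n''),
       Put ''vs'' (V ''i'') (N 0),
       Put ''h'' (V ''i'') (N 0),
       Put ''h'' (Plus (V ''n'') (V ''i'')) (N 0),
       Put ''u'' (Plus (V ''i'') (N 1)) (V ''i''),
       Put ''x'' (Plus (V ''i'') (N 1)) (V ''i'')]"
  define I where "I = (\<lambda>i (s :: state). \<forall>k<i. arr s ''ky'' k = n \<and> arr s ''vs'' k = 0 \<and> arr s ''h'' k = 0 \<and>
    arr s ''h'' (n + k) = 0 \<and> arr s ''u'' (Suc k) = k \<and> arr s ''x'' (Suc k) = k)"
  let ?s0 = "s\<lparr>reg := (reg s)(''i'' := 0)\<rparr>"
  have rn: "reg s ''n'' = n" by (rule input_n[OF inp])
  have "wp W (For ''i'' ''n'' ?p) (\<lambda>t s'. t \<le> (24 + 8) * (reg ?s0 ''n'' - reg ?s0 ''i'') + 4 \<and>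
    I (reg ?s0 ''n'') s' \<and> reg s' ''i'' = reg ?s0 ''n'' \<and> frame (For ''i'' ''n'' ?p) ?s0 s') ?s0"
  proof (rule wp_For)
    fix s1 i assume I: "I i s1" and fr: "frame (For ''i'' ''n'' ?p) ?s0 s1"
      and i: "reg s1 ''i'' = i" "i < reg ?s0 ''n''"
    have "reg s1 ''n'' = n" using frame_reg[OF fr, of "''n''"] rn by simp
    then show "wp W ?p (\<lambda>t s'. t \<le> 24 \<and> I (Suc i) (s'\<lparr>reg := (reg s')(''i'' := Suc i)\<rparr>)) s1"
      using i W I rn by (auto simp: I_def less_Suc_eq)
  qed (use rn W in \<open>auto simp: I_def\<close>)
  then have loop: "wp W (For ''i'' ''n'' ?p) (\<lambda>t s'. t \<le> 32 * n + 4 \<and> I n s' \<and>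
      frame (For ''i'' ''n'' ?p) ?s0 s') ?s0"
    by (rule wp_mono) (use rn in simp)
  have rest: "wp W (seqs [
     Put ''h'' (Plus (V ''n'') (V ''n'')) (N 0),
     Put ''h'' (V ''n'') (V ''n''),
     Assign ''e'' (V ''n''),
     Assign ''c'' (V ''n''),
     Assign ''i'' (N 0)]) (\<lambda>t' s'. 2 + (t + t') \<le> 32 * n + 24 \<and> reg s' ''b'' = base c \<and> input s' \<and>
      same_outside c s s' \<and> (\<exists>L. search_inv c s' [] {} L \<and> search_pot s' [] L = 260 * n + 80 * M)) s1"
    if t: "t \<le> 32 * n + 4" and I: "I n s1" and fr: "frame (For ''i'' ''n'' ?p) ?s0 s1" for t s1
  proof -
    define s2 where "s2 = s1\<lparr>
      arr := (arr s1)(''h'' := (arr s1 ''h'')(n + n := 0, n := n)),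
      reg := (reg s1)(''e'' := n, ''c'' := n, ''i'' := 0)\<rparr>"
    define L where "L = (\<lambda>k. if k = n then rev [1..<Suc n] else [])"
    have "input s1" by (rule input_frame[OF _ fr]) (use inp in \<open>auto simp: input_def\<close>)
    then have i2: "input s2" by (simp add: input_def s2_def)
    have b2: "reg s2 ''b'' = base c" using frame_reg[OF fr, of "''b''"] b by (simp add: s2_def)
    have o2: "same_outside c s s2"
      using frame_arr[OF fr, of "''o''"] frame_arr[OF fr, of "''d''"]
      by (simp add: s2_def same_outside_def)
    have h0: "arr s2 ''h'' k = 0" if "k \<le> 2 * n" "k \<noteq> n" for k
    proof -
      have "k < n \<or> k = n + n \<or> k = n + (k - n) \<and> k - n < n" using that by auto
      then consider "k < n" | "k = n + n" | "k = n + (k - n)" "k - n < n" by blast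
      then show ?thesis
      proof cases
        case 3
        then have "arr s1 ''h'' (n + (k - n)) = 0" using I unfolding I_def by blast
        then show ?thesis using 3 that by (simp add: s2_def)
      qed (use I that in \<open>auto simp: I_def s2_def\<close>)
    qed
    have ch: "chain (arr s2 ''x'') n (rev [1..<Suc n])"
      by (rule chain_rev) (use I in \<open>auto simp: I_def s2_def\<close>)
    have us: "arr s2 ''u'' j = j - 1" if "1 \<le> j" "j \<le> n" for j
    proof -
      have "j - 1 < n" using that by linarith
      then have "arr s1 ''u'' (Suc (j - 1)) = j - 1" using I unfolding I_def by blast
      then show ?thesis using that by (simp add: s2_def)
    qed
    have "buckets s2 L" unfolding buckets_def
    proof (intro allI impI conjI ballI)
      fix k assume k: "k \<le> 2 * n"
      show "chain (arr s2 ''x'') (arr s2 ''h'' k) (L k)"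
      proof (cases "k = n")
        case True
        then show ?thesis using ch by (simp add: L_def s2_def)
      qed (use h0 k in \<open>simp add: L_def\<close>)
      fix j assume "j \<in> set (L k)"
      then have "1 \<le> j" "j \<le> n" by (auto simp: L_def split: if_splits)
      then show "1 \<le> j" "j \<le> reg s2 ''e''" "arr s2 ''u'' j < n"
        using us n0 by (auto simp: s2_def)
    qed
    moreover have "covered s2 {} L" unfolding covered_def
    proof (intro allI impI)
      fix v assume v: "v < n"
      have "arr s2 ''ky'' v = n" using I v by (simp add: I_def s2_def)
      then have "Suc v \<in> set (L (arr s2 ''ky'' v))" using v by (auto simp: L_def)
      moreover have "arr s2 ''u'' (Suc v) = v" using us[of "Suc v"] v by simp
      ultimately show "v \<in> arr s2 ''u'' ` set (L (arr s2 ''ky'' v))" by (metis imageI)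
    qed
    moreover have search_key0: "search_key c {} v = n" for v by (simp add: search_key_def num_nbrs_def)
    ultimately have S: "search_inv c s2 [] {} L"
      using I by (simp add: search_inv_def search_key0) (simp add: I_def s2_def)
    have "(\<Sum>k\<le>2 * n. length (L k)) = (\<Sum>k\<le>2 * n. if k = n then n else 0)"
      by (rule sum.cong) (use n0 in \<open>simp_all add: L_def del: upt_Suc\<close>)
    \<comment> \<open>\<open>30 * n\<close> for \<open>c = n\<close>, \<open>30 * n\<close> for the
      \<open>n\<close> initial entries and \<open>200 * n\<close> for the visits.\<close>
    then have P: "search_pot s2 [] L = 260 * n + 80 * M"
      using sum_deg by (simp add: search_pot_def s2_def)
    have rn1: "reg s1 ''n'' = n" using frame_reg[OF fr, of "''n''"] rn by simp
    have "\<exists>L. search_inv c s2 [] {} L \<and> search_pot s2 [] L = 260 * n + 80 * M" using S P by blast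
    then show ?thesis using t W b2 i2 o2 rn1 by (simp add: s2_def)
  qed
  have i0: "wp W (Assign ''i'' (N 0)) (\<lambda>t s'. t = 2 \<and> s' = ?s0) s" using W by simp
  show ?thesis unfolding search_init_def
    apply (rule wp_seqs[OF i0], elim conjE, simp only:)
    apply (rule wp_seqs[OF loop], elim conjE)
    apply (rule rest, assumption+)
    done
qed

lemma search_wp:
  assumes inp: "input s0" and b: "reg s0 ''b'' = base c" and n0: "0 < n"
  shows "wp W search (\<lambda>t s. t \<le> 300 * n + 80 * M + 30 \<and> same_outside c s0 s \<and>
    search_order (rel G c) (verts G) (map (\<lambda>k. arr s ''o'' (base c + k)) [0..<n])
      (\<lambda>v. arr s ''d'' (base c + v))) s0"
proof -
  have loop: "wp W (While (Less (V ''i'') (V ''n'')) search_step)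
      (\<lambda>t' s. t + t' \<le> 300 * n + 80 * M + 30 \<and> same_outside c s0 s \<and>
      search_order (rel G c) (verts G) (map (\<lambda>k. arr s ''o'' (base c + k)) [0..<n])
      (\<lambda>v. arr s ''d'' (base c + v))) s"
    if t: "t \<le> 32 * n + 24" and b: "reg s ''b'' = base c" and inp: "input s"
      and out: "same_outside c s0 s" and S: "search_inv c s [] {} L"
      and P: "search_pot s [] L = 260 * n + 80 * M" for t s L
  proof -
    define J where "J = (\<lambda>k s. \<exists>xs L. search_inv c s xs (set xs) L \<and> search_pot s xs L = k \<and>
      same_outside c s0 s)"
    have "wp W (While (Less (V ''i'') (V ''n'')) search_step) (\<lambda>t s'. (\<exists>k'. J k' s' \<and>
      k' + t \<le> (260 * n + 80 * M) + bcost (Less (V ''i'') (V ''n'')) + 1) \<and>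
      \<not> bval (Less (V ''i'') (V ''n'')) s' \<and> frame search_step s s') s"
    proof (rule wp_While)
      show "J (260 * n + 80 * M) s" unfolding J_def using S P out by (metis list.set(1))
    next
      fix s1 k assume J: "J k s1" and fr: "frame search_step s s1"
      have rn: "reg s1 ''n'' = n" using input_n[OF inp] frame_reg[OF fr, of "''n''"]
        by (simp add: search_step_def search_visit_def search_scan_def)
      obtain xs L where S1: "search_inv c s1 xs (set xs) L" using J unfolding J_def by blast
      then have "reg s1 ''i'' = length xs" "distinct xs" "set xs \<subseteq> {..<n}"
        unfolding search_inv_def by blast+
      then have "reg s1 ''i'' \<le> n" using card_mono[of "{..<n}" "set xs"] distinct_card[of xs] by simp
      then show "bfits W (Less (V ''i'') (V ''n'')) s1" using rn W by simp
    next
      fix s1 k assume J: "J k s1" and fr: "frame search_step s s1"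
        and lt: "bval (Less (V ''i'') (V ''n'')) s1"
      have inp1: "input s1" by (rule input_frame[OF inp fr])
          (auto simp: search_step_def search_visit_def search_scan_def)
      have b1: "reg s1 ''b'' = base c" using b frame_reg[OF fr, of "''b''"]
        by (simp add: search_step_def search_visit_def search_scan_def)
      obtain xs L where S1: "search_inv c s1 xs (set xs) L" and k: "search_pot s1 xs L = k"
        and out1: "same_outside c s0 s1" using J unfolding J_def by blast
      have lt': "reg s1 ''i'' < n" using lt input_n[OF inp1] by simp
      show "wp W search_step (\<lambda>t s'. \<exists>k'. J k' s' \<and>
          k' + t + bcost (Less (V ''i'') (V ''n'')) + 1 \<le> k) s1"
      proof (rule wp_mono[OF search_step_wp[OF inp1 S1 b1 lt' out1]], elim exE conjE)
        fix t s' xs' L' assume "search_inv c s' xs' (set xs') L'"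
          "search_pot s' xs' L' + t + 4 \<le> search_pot s1 xs L" "same_outside c s0 s'"
        then have "J (search_pot s' xs' L') s' \<and>
            search_pot s' xs' L' + t + bcost (Less (V ''i'') (V ''n'')) + 1 \<le> k"
          using k unfolding J_def by auto
        then show "\<exists>k'. J k' s' \<and> k' + t + bcost (Less (V ''i'') (V ''n'')) + 1 \<le> k" by blast
      qed
    qed
    then show ?thesis
    proof (rule wp_mono, elim exE conjE)
      fix t' s' k' assume J: "J k' s'"
        and t': "k' + t' \<le> (260 * n + 80 * M) + bcost (Less (V ''i'') (V ''n'')) + 1"
        and nb: "\<not> bval (Less (V ''i'') (V ''n'')) s'" and fr: "frame search_step s s'"
      have rn: "reg s' ''n'' = n" using input_n[OF inp] frame_reg[OF fr, of "''n''"]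
        by (simp add: search_step_def search_visit_def search_scan_def)
      obtain xs L where S1: "search_inv c s' xs (set xs) L"
        and out1: "same_outside c s0 s'" using J unfolding J_def by blast
      note S' = S1[unfolded search_inv_def]
      have xs: "distinct xs" "set xs \<subseteq> {..<n}" "reg s' ''i'' = length xs"
        "xs = map (\<lambda>k. arr s' ''o'' (base c + k)) [0..<length xs]" using S' by blast+
      have "length xs \<le> n" using xs card_mono[of "{..<n}" "set xs"] distinct_card[of xs] by simp
      then have len: "length xs = n" using nb rn xs(3) by simp
      have set: "set xs = verts G"
        using card_subset_eq[of "{..<n}" "set xs"] xs distinct_card[of xs] len verts_eq by simp
      have A: "all_prefixes (\<lambda>ys x. arr s' ''d'' (base c + x) = num_nbrs (rel G c) (set ys) x \<and>
       (\<forall>y<n. y \<notin> set ys \<longrightarrow> num_nbrs (rel G c) (set ys) y \<le> num_nbrs (rel G c) (set ys) x)) xs"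
        using S' by blast
      have "search_order (rel G c) (verts G) xs (\<lambda>v. arr s' ''d'' (base c + v))"
        unfolding search_order_def mcs_def
      proof (intro conjI allI impI ballI)
        fix ys x zs y assume eq: "xs = ys @ x # zs" and y: "y \<in> set zs"
        have "y < n" "y \<notin> set ys" using eq y xs(1,2) by auto
        then show "num_nbrs (rel G c) (set ys) y \<le> num_nbrs (rel G c) (set ys) x"
          using all_prefixesD[OF A[unfolded eq]] by blast
      next
        fix ys x zs assume eq: "xs = ys @ x # zs"
        show "arr s' ''d'' (base c + x) = num_nbrs (rel G c) (set ys) x"
          using all_prefixesD[OF A[unfolded eq]] by blast
      qed (use xs set in auto)
      then show "t + t' \<le> 300 * n + 80 * M + 30 \<and> same_outside c s0 s' \<and>
        search_order (rel G c) (verts G) (map (\<lambda>k. arr s' ''o'' (base c + k)) [0..<n])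
        (\<lambda>v. arr s' ''d'' (base c + v))"
        using t t' out1 xs(4) len by simp
    qed
  qed
  show ?thesis unfolding search_def wp_Seq
    by (rule wp_mono[OF search_init_wp[OF inp b n0]]) (use loop in blast)
qed

end

section \<open>Splitting a node into its (co-)components\<close>

text \<open>A node is an interval from \<open>l\<close> to \<open>en[l] - 1\<close> that holds the same vertices in both halves of
  \<open>o\<close>. The offset \<open>ty[l]\<close> selects the half used for splitting; there the parts are already
  consecutive, and the other half is rearranged stably.\<close>

definition split_scan :: com where
  "split_scan = For ''i'' ''r'' (seqs [
     Assign ''v'' (Get ''o'' (Plus (V ''p'') (V ''i''))),
     If (Eq (Get ''d'' (Plus (V ''p'') (V ''v''))) (N 0))
       (seqs [Assign ''s'' (V ''i''), Assign ''c'' (Plus (V ''c'') (N 1))])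
       SKIP,
     Put ''pt'' (V ''v'') (V ''s''),
     Put ''en'' (V ''s'') (Plus (V ''i'') (N 1)),
     Put ''ty'' (V ''s'') (V ''q''),
     Put ''pr'' (V ''i'') (V ''i'')])"

text \<open>A stable bucket sort into \<open>tm\<close>, with \<open>pr[s]\<close> the next free
  position of the part that starts at \<open>s\<close>. For this relation a part is fully joined to
  the rest of the node, so its counts lose every earlier vertex outside the part: of the
  \<open>i - l\<close> earlier vertices of the node, \<open>j - s\<close> belong to the
  part.\<close>

definition split_move :: com where
  "split_move = For ''i'' ''r'' (seqs [
     Assign ''v'' (Get ''o'' (Plus (V ''q'') (V ''i''))),
     Assign ''s'' (Get ''pt'' (V ''v'')),
     Assign ''j'' (Get ''pr'' (V ''s'')),
     Put ''tm'' (V ''j'') (V ''v''),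
     Put ''pr'' (V ''s'') (Plus (V ''j'') (N 1)),
     Put ''d'' (Plus (V ''q'') (V ''v'')) (Minus (Get ''d'' (Plus (V ''q'') (V ''v'')))
       (Minus (Minus (V ''i'') (V ''l'')) (Minus (V ''j'') (V ''s'')))),
     Put ''fl'' (V ''i'') (V ''f'')])"

definition split_copy :: com where
  "split_copy = For ''i'' ''r'' (Put ''o'' (Plus (V ''q'') (V ''i'')) (Get ''tm'' (V ''i'')))"

text \<open>The flag is 0 exactly after a co-component split with fewer parts than vertices, that
  is, of a part that is not complete. One-vertex parts arising there were universal and are not
  avoidable.\<close>

definition split :: com where
  "split = seqs [
     seqs [
       Assign ''r'' (Get ''en'' (V ''l'')),
       Assign ''p'' (Get ''ty'' (V ''l'')),
       Assign ''q'' (Minus (V ''n'') (V ''p'')),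
       Assign ''c'' (N 0),
       Assign ''i'' (V ''l'')],
     split_scan,
     seqs [
       Assign ''f'' (N 1),
       If (And (Not (Eq (V ''p'') (N 0))) (Not (Eq (V ''c'') (Minus (V ''r'') (V ''l'')))))
         (Assign ''f'' (N 0))
         SKIP,
       Assign ''i'' (V ''l'')],
     split_move,
     Assign ''i'' (V ''l''),
     split_copy]"

text \<open>The start of the part that contains position \<open>i\<close>. The default 0 does no
  harm: the first position of a node is a start, so a true start is always found.\<close>

primrec last_start :: "(nat \<Rightarrow> bool) \<Rightarrow> nat \<Rightarrow> nat" where
  "last_start P 0 = 0"
| "last_start P (Suc i) = (if P (Suc i) then Suc i else last_start P i)"

lemma last_start_props:
  assumes "P a" "a \<le> i"
  shows "a \<le> last_start P i \<and> last_start P i \<le> i \<and> P (last_start P i) \<and>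
    (\<forall>k. last_start P i < k \<longrightarrow> k \<le> i \<longrightarrow> \<not> P k)"
  using assms(2)
proof (induction i)
  case 0
  then show ?case using assms(1) by simp
next
  case (Suc i)
  show ?case
  proof (cases "P (Suc i)")
    case True
    then show ?thesis using Suc.prems by auto
  next
    case False
    then have "a \<le> i" using Suc.prems assms(1) by (metis le_SucE)
    then show ?thesis using Suc.IH False by (auto simp: le_Suc_eq)
  qed
qed

lemma last_start_self: "P i \<Longrightarrow> last_start P i = i"
  by (cases i) auto

lemma last_start_pred: "\<not> P i \<Longrightarrow> 0 < i \<Longrightarrow> last_start P i = last_start P (i - 1)"
  by (cases i) auto

lemma filter_upt:
  assumes "a \<le> k" "k \<le> e" "e \<le> b" "\<And>j. a \<le> j \<Longrightarrow> j < b \<Longrightarrow> Q j \<longleftrightarrow> k \<le> j \<and> j < e"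
  shows "filter Q [a..<b] = [k..<e]"
proof -
  have "[a..<b] = [a..<k] @ [k..<e] @ [e..<b]"
    using assms(1-3) upt_add_eq_append[of a k "b - k"] upt_add_eq_append[of k e "b - e"] by simp
  moreover have "filter Q [a..<k] = []" "filter Q [k..<e] = [k..<e]" "filter Q [e..<b] = []"
    using assms by (auto simp: filter_empty_conv filter_id_conv)
  ultimately show ?thesis by simp
qed

section \<open>Nodes as intervals of both orders\<close>

context graph_input
begin

definition ord :: "state \<Rightarrow> bool \<Rightarrow> nat \<Rightarrow> nat" where
  "ord s c i = arr s ''o'' (base c + i)"

definition back_deg :: "state \<Rightarrow> bool \<Rightarrow> nat \<Rightarrow> nat" where
  "back_deg s c v = arr s ''d'' (base c + v)"

definition segment :: "state \<Rightarrow> bool \<Rightarrow> nat \<Rightarrow> nat \<Rightarrow> nat list" where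
  "segment s c a b = map (ord s c) [a..<b]"

definition node :: "state \<Rightarrow> nat \<Rightarrow> nat \<Rightarrow> nat set \<Rightarrow> bool" where
  "node s a b X \<longleftrightarrow> a < b \<and> b \<le> n \<and> X \<subseteq> {..<n} \<and>
     (\<forall>c. search_order (rel G c) X (segment s c a b) (back_deg s c))"

lemma base_le: "base c \<le> n"
  by (simp add: base_def)

lemma segment_split:
  assumes "a \<le> j" "j < b"
  shows "segment s c a b = segment s c a j @ ord s c j # segment s c (Suc j) b"
proof -
  have "[a..<b] = [a..<j] @ j # [Suc j..<b]"
    using assms upt_add_eq_append[of a j "b - j"] upt_conv_Cons[of j b] by simp
  then show ?thesis by (simp add: segment_def)
qed

lemma set_segment: "set (segment s c a b) = ord s c ` {a..<b}"
  by (simp add: segment_def)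

lemma length_segment [simp]: "length (segment s c a b) = b - a"
  by (simp add: segment_def)

context
  fixes s0 :: state and a b :: nat and X :: "nat set"
  assumes nd: "node s0 a b X"
begin

lemma node_order: "search_order (rel G c) X (segment s0 c a b) (back_deg s0 c)"
  using nd by (simp add: node_def)

lemma node_set: "ord s0 c ` {a..<b} = X"
  using search_orderD(2)[OF node_order] set_segment by blast

lemma node_inj: "inj_on (ord s0 c) {a..<b}"
  using search_orderD(1)[OF node_order[of c]] by (simp add: segment_def distinct_map)

lemma node_ord_less: "a \<le> i \<Longrightarrow> i < b \<Longrightarrow> ord s0 c i < n"
proof -
  assume "a \<le> i" "i < b"
  then have "ord s0 c i \<in> X" using node_set[of c] by auto
  then show ?thesis using nd by (auto simp: node_def)
qed

lemma node_back_deg: "a \<le> i \<Longrightarrow> i < b \<Longrightarrow>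
    back_deg s0 c (ord s0 c i) = num_nbrs (rel G c) (set (segment s0 c a i)) (ord s0 c i)"
  using search_order_d[of "rel G c" X "segment s0 c a i" "ord s0 c i" "segment s0 c (Suc i) b" "back_deg s0 c"]
    node_order[of c] segment_split[of a i b s0 c] by simp

lemma node_back_deg_le: "v \<in> X \<Longrightarrow> back_deg s0 c v \<le> n"
proof -
  assume "v \<in> X"
  then obtain i where i: "a \<le> i" "i < b" "v = ord s0 c i" using node_set[of c] by fastforce
  have "set (segment s0 c a i) \<subseteq> {..<n}" using node_ord_less i unfolding set_segment by auto
  then show ?thesis using node_back_deg[OF i(1,2)] i(3) num_nbrs_le_n by simp
qed

lemma node_first: "back_deg s0 c (ord s0 c a) = 0"
  using node_back_deg[of a c] nd by (simp add: node_def segment_def num_nbrs_def)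

lemma node_card: "card X = b - a"
  using card_image[OF node_inj[of True]] node_set[of True] by simp

text \<open>\<open>en[s]\<close> is pushed forward with every vertex of the current part, so it
  holds the end of the part once the next start has been met.\<close>

lemma split_scan_wp:
  fixes c :: bool
  defines "P \<equiv> \<lambda>i. back_deg s0 c (ord s0 c i) = 0"
  defines "St \<equiv> {k \<in> {a..<b}. P k}"
  assumes fr: "arr s ''o'' = arr s0 ''o''" "arr s ''d'' = arr s0 ''d''"
    and r: "reg s ''i'' = a" "reg s ''r'' = b" "reg s ''p'' = base c" "reg s ''q'' = base (\<not> c)"
      "reg s ''c'' = 0"
  shows "wp W split_scan (\<lambda>t s'. t \<le> 40 * (b - a) + 4 \<and>
    (\<forall>j. a \<le> j \<and> j < b \<longrightarrow> arr s' ''pt'' (ord s0 c j) = last_start P j \<and> arr s' ''pr'' j = j) \<and>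
    (\<forall>k\<in>St. k < arr s' ''en'' k \<and> arr s' ''en'' k \<le> b \<and> arr s' ''ty'' k = base (\<not> c) \<and>
       (\<forall>j. a \<le> j \<and> j < b \<longrightarrow> (last_start P j = k \<longleftrightarrow> k \<le> j \<and> j < arr s' ''en'' k))) \<and>
    reg s' ''c'' = card St \<and>
    (\<forall>j. j < a \<or> b \<le> j \<longrightarrow> arr s' ''en'' j = arr s ''en'' j \<and> arr s' ''ty'' j = arr s ''ty'' j) \<and>
    frame split_scan s s') s"
proof -
  have ab: "a < b" "b \<le> n" using nd by (auto simp: node_def)
  \<comment> \<open>Nothing precedes the first vertex, so its count is zero and every position of
    the node has a start at or before it.\<close>
  have Pa: "P a" using node_first by (simp add: P_def)
  note lsp = last_start_props[of P a, OF Pa]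
  define I where "I = (\<lambda>i (s' :: state).
    (\<forall>j. a \<le> j \<and> j < i \<longrightarrow> arr s' ''pt'' (ord s0 c j) = last_start P j \<and> arr s' ''pr'' j = j) \<and>
    (\<forall>k. k \<in> St \<and> k < i \<longrightarrow> k < arr s' ''en'' k \<and> arr s' ''en'' k \<le> i \<and> arr s' ''ty'' k = base (\<not> c) \<and>
       (\<forall>j. a \<le> j \<and> j < i \<longrightarrow> (last_start P j = k \<longleftrightarrow> k \<le> j \<and> j < arr s' ''en'' k))) \<and>
    (a < i \<longrightarrow> reg s' ''s'' = last_start P (i - 1)) \<and>
    reg s' ''c'' = card {k \<in> St. k < i} \<and>
    (\<forall>j. j < a \<or> b \<le> j \<longrightarrow> arr s' ''en'' j = arr s ''en'' j \<and> arr s' ''ty'' j = arr s ''ty'' j))"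
  have step: "I (Suc i) s2"
    if I: "I i s1" and i: "a \<le> i" "i < b"
      and s2: "reg s2 ''s'' = last_start P i"
        "reg s2 ''c'' = (if P i then Suc (reg s1 ''c'') else reg s1 ''c'')"
        "arr s2 ''pt'' = (arr s1 ''pt'')(ord s0 c i := last_start P i)"
        "arr s2 ''en'' = (arr s1 ''en'')(last_start P i := Suc i)"
        "arr s2 ''ty'' = (arr s1 ''ty'')(last_start P i := base (\<not> c))"
        "arr s2 ''pr'' = (arr s1 ''pr'')(i := i)" for i s1 s2
  proof -
    note I' = I[unfolded I_def]
    have ls: "a \<le> last_start P i" "last_start P i \<le> i" "P (last_start P i)"
      using lsp[OF i(1)] by auto
    have "\<forall>j. a \<le> j \<and> j < Suc i \<longrightarrow>
        arr s2 ''pt'' (ord s0 c j) = last_start P j \<and> arr s2 ''pr'' j = j"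
    proof (intro allI impI)
      fix j assume j: "a \<le> j \<and> j < Suc i"
      have "ord s0 c j \<noteq> ord s0 c i" if "j \<noteq> i"
        using inj_onD[OF node_inj[of c], of j i] that j i by auto
      then show "arr s2 ''pt'' (ord s0 c j) = last_start P j \<and> arr s2 ''pr'' j = j"
        using I' j by (cases "j = i") (auto simp: s2)
    qed
    moreover have "\<forall>k. k \<in> St \<and> k < Suc i \<longrightarrow> k < arr s2 ''en'' k \<and> arr s2 ''en'' k \<le> Suc i \<and>
      arr s2 ''ty'' k = base (\<not> c) \<and>
      (\<forall>j. a \<le> j \<and> j < Suc i \<longrightarrow> (last_start P j = k \<longleftrightarrow> k \<le> j \<and> j < arr s2 ''en'' k))"
    proof (intro allI impI)
      fix k assume k: "k \<in> St \<and> k < Suc i"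
      show "k < arr s2 ''en'' k \<and> arr s2 ''en'' k \<le> Suc i \<and> arr s2 ''ty'' k = base (\<not> c) \<and>
        (\<forall>j. a \<le> j \<and> j < Suc i \<longrightarrow> (last_start P j = k \<longleftrightarrow> k \<le> j \<and> j < arr s2 ''en'' k))"
      proof (cases "k = last_start P i")
        case True
        have "last_start P j = k \<longleftrightarrow> k \<le> j" if j: "a \<le> j" "j < Suc i" for j
        proof
          assume "last_start P j = k"
          then show "k \<le> j" using lsp[OF j(1)] by auto
        next
          assume kj: "k \<le> j"
          have "\<not> P l" if "k < l" "l \<le> i" for l using lsp[OF i(1)] True that by auto
          moreover have "k \<le> last_start P j"
            using lsp[OF j(1)] kj ls(3) True by (metis not_le_imp_less)
          moreover have "last_start P j \<le> j" "P (last_start P j)"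
            using lsp[OF j(1)] by auto
          ultimately show "last_start P j = k" using j(2) by (metis le_neq_implies_less le_trans less_Suc_eq_le)
        qed
        then show ?thesis using True ls(2) by (simp add: s2)
      next
        case False
        have "k \<noteq> i" using False k last_start_self[of P i] by (auto simp: St_def)
        then have ki: "k < i" using k by simp
        then have "k < arr s1 ''en'' k \<and> arr s1 ''en'' k \<le> i \<and> arr s1 ''ty'' k = base (\<not> c) \<and>
          (\<forall>j. a \<le> j \<and> j < i \<longrightarrow> (last_start P j = k \<longleftrightarrow> k \<le> j \<and> j < arr s1 ''en'' k))"
          using I' k by blast
        then show ?thesis using False by (auto simp: s2 less_Suc_eq)
      qed
    qed
    moreover have "reg s2 ''c'' = card {k \<in> St. k < Suc i}"
    proof -
      have "{k \<in> St. k < Suc i} = (if P i then insert i {k \<in> St. k < i} else {k \<in> St. k < i})"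
        using i by (auto simp: St_def less_Suc_eq)
      then show ?thesis using I' by (simp add: s2)
    qed
    moreover have "\<forall>j. j < a \<or> b \<le> j \<longrightarrow>
        arr s2 ''en'' j = arr s ''en'' j \<and> arr s2 ''ty'' j = arr s ''ty'' j"
      using I' ls i by (auto simp: s2)
    ultimately show ?thesis unfolding I_def using s2(1) by simp
  qed
  have "wp W split_scan (\<lambda>t s'. t \<le> (32 + 8) * (reg s ''r'' - reg s ''i'') + 4 \<and>
    I (reg s ''r'') s' \<and> reg s' ''i'' = reg s ''r'' \<and> frame split_scan s s') s"
    unfolding split_scan_def
  proof (rule wp_For)
    show "I (reg s ''i'') s" by (auto simp: I_def r St_def)
    show "reg s ''i'' \<le> reg s ''r''" "reg s ''r'' < W" "1 < W" using r ab W by auto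
  next
    let ?p = "seqs [
     Assign ''v'' (Get ''o'' (Plus (V ''p'') (V ''i''))),
     If (Eq (Get ''d'' (Plus (V ''p'') (V ''v''))) (N 0))
       (seqs [Assign ''s'' (V ''i''), Assign ''c'' (Plus (V ''c'') (N 1))])
       SKIP,
     Put ''pt'' (V ''v'') (V ''s''),
     Put ''en'' (V ''s'') (Plus (V ''i'') (N 1)),
     Put ''ty'' (V ''s'') (V ''q''),
     Put ''pr'' (V ''i'') (V ''i'')]"
    fix s1 i assume I: "I i s1" and f: "frame (For ''i'' ''r'' ?p) s s1"
      and i: "reg s1 ''i'' = i" "reg s ''i'' \<le> i" "i < reg s ''r''"
    have i': "a \<le> i" "i < b" using i r by auto
    have pq: "reg s1 ''p'' = base c" "reg s1 ''q'' = base (\<not> c)"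
      using frame_reg[OF f, of "''p''"] frame_reg[OF f, of "''q''"] r by auto
    have v: "arr s1 ''o'' (base c + i) = ord s0 c i"
      using frame_arr[OF f, of "''o''"] fr by (simp add: ord_def)
    have d: "arr s1 ''d'' (base c + ord s0 c i) = back_deg s0 c (ord s0 c i)"
      using frame_arr[OF f, of "''d''"] fr by (simp add: back_deg_def)
    have vX: "ord s0 c i \<in> X" using node_set[of c] i' by auto
    have bounds: "ord s0 c i < n" "back_deg s0 c (ord s0 c i) \<le> n" "base c \<le> n" "base (\<not> c) \<le> n"
      using node_ord_less[OF i'] node_back_deg_le[OF vX] base_le by auto
    have cb: "reg s1 ''c'' \<le> n"
    proof -
      have "card {k \<in> St. k < i} \<le> card {..<n}" by (rule card_mono) (use ab in \<open>auto simp: St_def\<close>)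
      then show ?thesis using I by (simp add: I_def)
    qed
    \<comment> \<open>The register \<open>s\<close> is used without being set only at a non-start;
      by then position \<open>a\<close> has set it.\<close>
    have sP: "\<not> P i \<Longrightarrow> reg s1 ''s'' = last_start P i"
    proof -
      assume "\<not> P i"
      then have "a < i" "last_start P i = last_start P (i - 1)"
        using Pa i'(1) last_start_pred[of P i] by (cases "a = i"; auto)+
      then show ?thesis using I by (simp add: I_def)
    qed
    have lsb: "last_start P i \<le> i" using lsp[OF i'(1)] by auto
    have "wp W ?p (\<lambda>t s2. t \<le> 32 \<and> reg s2 ''s'' = last_start P i \<and>
        reg s2 ''c'' = (if P i then Suc (reg s1 ''c'') else reg s1 ''c'') \<and>
        arr s2 ''pt'' = (arr s1 ''pt'')(ord s0 c i := last_start P i) \<and>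
        arr s2 ''en'' = (arr s1 ''en'')(last_start P i := Suc i) \<and>
        arr s2 ''ty'' = (arr s1 ''ty'')(last_start P i := base (\<not> c)) \<and>
        arr s2 ''pr'' = (arr s1 ''pr'')(i := i)) s1"
    proof (cases "P i")
      case True
      then show ?thesis
        using W i(1) i' ab pq v d bounds cb last_start_self[of P i, OF True] lsb by (simp add: P_def)
    next
      case False
      then show ?thesis
        using W i(1) i' ab pq v d bounds cb sP[OF False] lsb by (simp add: P_def)
    qed
    then show "wp W ?p (\<lambda>t s'. t \<le> 32 \<and> I (Suc i) (s'\<lparr>reg := (reg s')(''i'' := Suc i)\<rparr>)) s1"
      by (rule wp_mono) (simp add: step[OF I i'])
  qed auto
  then show ?thesis
  proof (rule wp_mono, elim conjE)
    fix t s' assume t: "t \<le> (32 + 8) * (reg s ''r'' - reg s ''i'') + 4"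
      and I: "I (reg s ''r'') s'" and f: "frame split_scan s s'"
    have "{k \<in> St. k < b} = St" by (auto simp: St_def)
    moreover have "\<forall>k\<in>St. k < b" by (auto simp: St_def)
    ultimately show "t \<le> 40 * (b - a) + 4 \<and>
    (\<forall>j. a \<le> j \<and> j < b \<longrightarrow> arr s' ''pt'' (ord s0 c j) = last_start P j \<and> arr s' ''pr'' j = j) \<and>
    (\<forall>k\<in>St. k < arr s' ''en'' k \<and> arr s' ''en'' k \<le> b \<and> arr s' ''ty'' k = base (\<not> c) \<and>
       (\<forall>j. a \<le> j \<and> j < b \<longrightarrow> (last_start P j = k \<longleftrightarrow> k \<le> j \<and> j < arr s' ''en'' k))) \<and>
    reg s' ''c'' = card St \<and>
    (\<forall>j. j < a \<or> b \<le> j \<longrightarrow> arr s' ''en'' j = arr s ''en'' j \<and> arr s' ''ty'' j = arr s ''ty'' j) \<and>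
    frame split_scan s s'"
      using t I f r unfolding I_def by simp
  qed
qed

lemma segment_Suc: "a \<le> i \<Longrightarrow> segment s c a (Suc i) = segment s c a i @ [ord s c i]"
  by (simp add: segment_def)

lemma distinct_segment: "i \<le> b \<Longrightarrow> distinct (segment s0 c a i)"
  using node_inj[of c] by (auto simp: segment_def distinct_map inj_on_def)

lemma set_segment_subset: "i \<le> b \<Longrightarrow> set (segment s0 c a i) \<subseteq> X"
  unfolding set_segment node_set[of c, symmetric] by auto

text \<open>The target intervals of the parts are disjoint and have exactly the sizes of the parts.
  Hence the write position of a part stays in its own interval, and each interval of
  \<open>tm\<close> receives the part in its old relative order.\<close>

lemma split_move_wp:
  fixes c :: bool
  assumes fr: "arr s ''o'' = arr s0 ''o''" "arr s ''d'' = arr s0 ''d''"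
    and r: "reg s ''i'' = a" "reg s ''r'' = b" "reg s ''l'' = a" "reg s ''q'' = base c"
      "reg s ''f'' \<le> 1"
    and pt: "f = arr s ''pt''" "\<And>v. v \<in> X \<Longrightarrow> f v \<in> St"
    and St: "\<And>k. k \<in> St \<Longrightarrow> k < e k \<and> e k \<le> b"
      "\<And>k. k \<in> St \<Longrightarrow> card {v \<in> X. f v = k} = e k - k"
      "\<And>k k'. k \<in> St \<Longrightarrow> k' \<in> St \<Longrightarrow> k < k' \<Longrightarrow> e k \<le> k'"
      "\<And>k. k \<in> St \<Longrightarrow> arr s ''pr'' k = k"
  shows "wp W split_move (\<lambda>t s'. t \<le> 46 * (b - a) + 4 \<and>
    (\<forall>k\<in>St. map (arr s' ''tm'') [k..<e k] = filter (\<lambda>v. f v = k) (segment s0 c a b)) \<and>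
    (\<forall>j. a \<le> j \<and> j < b \<longrightarrow> back_deg s' c (ord s0 c j) =
       back_deg s0 c (ord s0 c j) - card (set (segment s0 c a j) - {v. f v = f (ord s0 c j)})) \<and>
    (\<forall>x. x \<notin> (\<lambda>v. base c + v) ` X \<longrightarrow> arr s' ''d'' x = arr s0 ''d'' x) \<and>
    (\<forall>j. arr s' ''fl'' j = (if a \<le> j \<and> j < b then reg s ''f'' else arr s ''fl'' j)) \<and>
    frame split_move s s') s"
proof -
  have ab: "a < b" "b \<le> n" using nd by (auto simp: node_def)
  define F where "F = (\<lambda>k i. filter (\<lambda>v. f v = k) (segment s0 c a i))"
  define I where "I = (\<lambda>i (s' :: state).
    (\<forall>k\<in>St. arr s' ''pr'' k = k + length (F k i) \<and>
      map (arr s' ''tm'') [k..<k + length (F k i)] = F k i) \<and>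
    (\<forall>j. a \<le> j \<and> j < i \<longrightarrow> back_deg s' c (ord s0 c j) =
       back_deg s0 c (ord s0 c j) - card (set (segment s0 c a j) - {v. f v = f (ord s0 c j)})) \<and>
    (\<forall>x. x \<notin> (\<lambda>v. base c + v) ` set (segment s0 c a i) \<longrightarrow> arr s' ''d'' x = arr s0 ''d'' x) \<and>
    (\<forall>j. arr s' ''fl'' j = (if a \<le> j \<and> j < i then reg s ''f'' else arr s ''fl'' j)))"
  have Fset: "length (F k i) = card {v \<in> set (segment s0 c a i). f v = k}" if "i \<le> b" for k i
    using distinct_card[of "F k i"] distinct_segment[OF that, of c] by (simp add: F_def)
  have Fle: "length (F k i) \<le> e k - k" if "k \<in> St" "i \<le> b" for k i
  proof -
    have "finite X" using node_set[of c] by (metis finite_imageI finite_atLeastLessThan)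
    then have "card {v \<in> set (segment s0 c a i). f v = k} \<le> card {v \<in> X. f v = k}"
      using set_segment_subset[OF that(2), of c] by (intro card_mono) auto
    then show ?thesis using Fset[OF that(2)] St(2)[OF that(1)] by simp
  qed
  have FS: "F k (Suc i) = (if f (ord s0 c i) = k then F k i @ [ord s0 c i] else F k i)"
    if "a \<le> i" for k i by (simp add: F_def segment_Suc[OF that])
  have Flt: "k + length (F k i) < e k" if "k \<in> St" "a \<le> i" "i < b" "f (ord s0 c i) = k" for k i
    using Fle[OF that(1), of "Suc i"] FS[OF that(2), of k] that(3,4) St(1)[OF that(1)] by simp
  \<comment> \<open>What the machine subtracts is the number of earlier vertices of the node that
    lie outside part \<open>k\<close>.\<close>
  have diff: "(i - a) - length (F k i) = card (set (segment s0 c a i) - {v. f v = k})" if "i \<le> b" for i k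
  proof -
    have "set (segment s0 c a i) - {v. f v = k} =
        set (segment s0 c a i) - {v \<in> set (segment s0 c a i). f v = k}" by auto
    then have "card (set (segment s0 c a i) - {v. f v = k}) =
        card (set (segment s0 c a i)) - card {v \<in> set (segment s0 c a i). f v = k}"
      using card_Diff_subset[of "{v \<in> set (segment s0 c a i). f v = k}" "set (segment s0 c a i)"] by auto
    then show ?thesis using Fset[OF that] distinct_card[OF distinct_segment[OF that, of c]] by simp
  qed
  have step: "I (Suc i) s2"
    if I: "I i s1" and i: "a \<le> i" "i < b" and v: "v = ord s0 c i" and k: "k = f v"
      and s2: "arr s2 ''tm'' = (arr s1 ''tm'')(k + length (F k i) := v)"
        "arr s2 ''pr'' = (arr s1 ''pr'')(k := Suc (k + length (F k i)))"
        "arr s2 ''d'' = (arr s1 ''d'')(base c + v :=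
          arr s1 ''d'' (base c + v) - ((i - a) - length (F k i)))"
        "arr s2 ''fl'' = (arr s1 ''fl'')(i := reg s ''f'')" for i s1 s2 v k
  proof -
    note I' = I[unfolded I_def]
    have vX: "v \<in> X" using node_set[of c] i v by auto
    have kS: "k \<in> St" using pt(2)[OF vX] k by simp
    have vn: "v \<notin> set (segment s0 c a i)"
      using inj_onD[OF node_inj[of c]] i unfolding v set_segment by fastforce
    have "arr s2 ''pr'' k' = k' + length (F k' (Suc i)) \<and>
      map (arr s2 ''tm'') [k'..<k' + length (F k' (Suc i))] = F k' (Suc i)" if k': "k' \<in> St" for k'
    proof -
      have old: "arr s1 ''pr'' k' = k' + length (F k' i)"
        "map (arr s1 ''tm'') [k'..<k' + length (F k' i)] = F k' i" using I' k' by blast+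
      \<comment> \<open>The position written belongs to part \<open>k\<close> and lies just behind
        its filled section, so no filled section is overwritten.\<close>
      have "k + length (F k i) \<notin> {k'..<k' + length (F k' i)}"
      proof (cases "k' = k")
        case False
        then consider "k < k'" | "k' < k" by linarith
        then show ?thesis
        proof cases
          case 1
          then show ?thesis using St(3)[OF kS k'] Flt[OF kS i] k v by force
        next
          case 2
          then show ?thesis using St(3)[OF k' kS] Fle[OF k', of i] St(1)[OF k'] i by force
        qed
      qed simp
      then have "map (arr s2 ''tm'') [k'..<k' + length (F k' i)] =
          map (arr s1 ''tm'') [k'..<k' + length (F k' i)]"
        by (intro map_cong) (auto simp: s2)
      then have "map (arr s2 ''tm'') [k'..<k' + length (F k' i)] = F k' i" using old(2) by (rule trans)
      then show ?thesis using FS[OF i(1), of k'] k v old by (simp add: s2)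
    qed
    moreover have "back_deg s2 c (ord s0 c j) =
       back_deg s0 c (ord s0 c j) - card (set (segment s0 c a j) - {v. f v = f (ord s0 c j)})"
      if j: "a \<le> j" "j < Suc i" for j
    proof (cases "j = i")
      case True
      have "base c + v \<notin> (\<lambda>v. base c + v) ` set (segment s0 c a i)" using vn by auto
      then have "arr s1 ''d'' (base c + v) = arr s0 ''d'' (base c + v)" using I' by blast
      then show ?thesis using True diff[of i k] i k v by (simp add: back_deg_def s2)
    next
      case False
      then have "ord s0 c j \<noteq> v" using inj_onD[OF node_inj[of c], of j i] j i v by auto
      then show ?thesis using I' j False by (simp add: back_deg_def s2)
    qed
    moreover have "arr s2 ''d'' x = arr s0 ''d'' x"
      if "x \<notin> (\<lambda>v. base c + v) ` set (segment s0 c a (Suc i))" for x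
      using I' that segment_Suc[OF i(1), of s0 c] v by (auto simp: s2)
    moreover have "arr s2 ''fl'' j = (if a \<le> j \<and> j < Suc i then reg s ''f'' else arr s ''fl'' j)" for j
      using I' i by (auto simp: s2 less_Suc_eq)
    ultimately show ?thesis unfolding I_def by blast
  qed
  have "wp W split_move (\<lambda>t s'. t \<le> (38 + 8) * (reg s ''r'' - reg s ''i'') + 4 \<and>
    I (reg s ''r'') s' \<and> reg s' ''i'' = reg s ''r'' \<and> frame split_move s s') s"
    unfolding split_move_def
  proof (rule wp_For)
    show "I (reg s ''i'') s" using St(4) fr by (auto simp: I_def r F_def segment_def)
    show "reg s ''i'' \<le> reg s ''r''" "reg s ''r'' < W" "1 < W" using r ab W by auto
  next
    let ?p = "seqs [
     Assign ''v'' (Get ''o'' (Plus (V ''q'') (V ''i''))),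
     Assign ''s'' (Get ''pt'' (V ''v'')),
     Assign ''j'' (Get ''pr'' (V ''s'')),
     Put ''tm'' (V ''j'') (V ''v''),
     Put ''pr'' (V ''s'') (Plus (V ''j'') (N 1)),
     Put ''d'' (Plus (V ''q'') (V ''v'')) (Minus (Get ''d'' (Plus (V ''q'') (V ''v'')))
       (Minus (Minus (V ''i'') (V ''l'')) (Minus (V ''j'') (V ''s'')))),
     Put ''fl'' (V ''i'') (V ''f'')]"
    fix s1 i assume I: "I i s1" and f: "frame (For ''i'' ''r'' ?p) s s1"
      and i: "reg s1 ''i'' = i" "reg s ''i'' \<le> i" "i < reg s ''r''"
    have i': "a \<le> i" "i < b" using i r by auto
    define v where "v = ord s0 c i"
    define k where "k = f v"
    have rs: "reg s1 ''q'' = base c" "reg s1 ''l'' = a" "reg s1 ''f'' = reg s ''f''"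
      using frame_reg[OF f, of "''q''"] frame_reg[OF f, of "''l''"] frame_reg[OF f, of "''f''"] r by auto
    have vo: "arr s1 ''o'' (base c + i) = v"
      using frame_arr[OF f, of "''o''"] fr by (simp add: ord_def v_def)
    have kp: "arr s1 ''pt'' v = k"
      using frame_arr[OF f, of "''pt''"] pt(1) by (simp add: k_def)
    have vX: "v \<in> X" using node_set[of c] i' v_def by auto
    have kS: "k \<in> St" using pt(2)[OF vX] by (simp add: k_def)
    have vn: "v \<notin> set (segment s0 c a i)"
      using inj_onD[OF node_inj[of c]] i' unfolding v_def set_segment by fastforce
    have "base c + v \<notin> (\<lambda>v. base c + v) ` set (segment s0 c a i)" using vn by auto
    then have d: "arr s1 ''d'' (base c + v) = back_deg s0 c v"
      using I unfolding I_def back_deg_def by blast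
    have pr: "arr s1 ''pr'' k = k + length (F k i)" using I kS by (simp add: I_def)
    have bounds: "v < n" "back_deg s0 c v \<le> n" "base c \<le> n" "k + length (F k i) < n" "k < n"
      using node_ord_less[OF i'] node_back_deg_le[OF vX] base_le Flt[OF kS i'] St(1)[OF kS] ab
      by (auto simp: v_def k_def)
    have "wp W ?p (\<lambda>t s2. t \<le> 38 \<and>
        arr s2 ''tm'' = (arr s1 ''tm'')(k + length (F k i) := v) \<and>
        arr s2 ''pr'' = (arr s1 ''pr'')(k := Suc (k + length (F k i))) \<and>
        arr s2 ''d'' = (arr s1 ''d'')(base c + v :=
          arr s1 ''d'' (base c + v) - ((i - a) - length (F k i))) \<and>
        arr s2 ''fl'' = (arr s1 ''fl'')(i := reg s ''f'')) s1"
      using W i(1) i' ab rs vo kp d pr bounds r(5) by simp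
    then show "wp W ?p (\<lambda>t s'. t \<le> 38 \<and> I (Suc i) (s'\<lparr>reg := (reg s')(''i'' := Suc i)\<rparr>)) s1"
      by (rule wp_mono) (simp add: step[OF I i' v_def k_def])
  qed auto
  then show ?thesis
  proof (rule wp_mono, elim conjE)
    fix t s' assume t: "t \<le> (38 + 8) * (reg s ''r'' - reg s ''i'') + 4"
      and I: "I (reg s ''r'') s'" and f: "frame split_move s s'"
    have Fb: "k + length (F k b) = e k" if "k \<in> St" for k
    proof -
      have "{v \<in> set (segment s0 c a b). f v = k} = {v \<in> X. f v = k}"
        using node_set[of c] by (simp add: set_segment)
      then show ?thesis using Fset[of b k] St(2)[OF that] St(1)[OF that] by simp
    qed
    have "\<forall>k\<in>St. map (arr s' ''tm'') [k..<e k] = filter (\<lambda>v. f v = k) (segment s0 c a b)"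
    proof
      fix k assume k: "k \<in> St"
      then have "map (arr s' ''tm'') [k..<k + length (F k b)] = F k b" using I r by (simp add: I_def)
      then show "map (arr s' ''tm'') [k..<e k] = filter (\<lambda>v. f v = k) (segment s0 c a b)"
        unfolding Fb[OF k] by (simp add: F_def)
    qed
    moreover have "\<forall>x. x \<notin> (\<lambda>v. base c + v) ` X \<longrightarrow> arr s' ''d'' x = arr s0 ''d'' x"
      using I r node_set[of c] set_segment[of s0 c a b] by (simp add: I_def)
    ultimately show "t \<le> 46 * (b - a) + 4 \<and>
      (\<forall>k\<in>St. map (arr s' ''tm'') [k..<e k] = filter (\<lambda>v. f v = k) (segment s0 c a b)) \<and>
      (\<forall>j. a \<le> j \<and> j < b \<longrightarrow> back_deg s' c (ord s0 c j) =
       back_deg s0 c (ord s0 c j) - card (set (segment s0 c a j) - {v. f v = f (ord s0 c j)})) \<and>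
      (\<forall>x. x \<notin> (\<lambda>v. base c + v) ` X \<longrightarrow> arr s' ''d'' x = arr s0 ''d'' x) \<and>
      (\<forall>j. arr s' ''fl'' j = (if a \<le> j \<and> j < b then reg s ''f'' else arr s ''fl'' j)) \<and>
      frame split_move s s'"
      using t I f r unfolding I_def by simp
  qed
qed

lemma split_copy_wp:
  assumes r: "reg s ''i'' = a" "reg s ''r'' = b" "reg s ''q'' = base c"
    and tm: "\<And>i. a \<le> i \<Longrightarrow> i < b \<Longrightarrow> arr s ''tm'' i < n"
  shows "wp W split_copy (\<lambda>t s'. t \<le> 14 * (b - a) + 4 \<and>
    (\<forall>j. arr s' ''o'' j = (if base c + a \<le> j \<and> j < base c + b then arr s ''tm'' (j - base c)
      else arr s ''o'' j)) \<and> frame split_copy s s') s"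
proof -
  have ab: "a < b" "b \<le> n" using nd by (auto simp: node_def)
  define I where "I = (\<lambda>i (s' :: state). \<forall>j. arr s' ''o'' j =
    (if base c + a \<le> j \<and> j < base c + i then arr s ''tm'' (j - base c) else arr s ''o'' j))"
  have "wp W split_copy (\<lambda>t s'. t \<le> (6 + 8) * (reg s ''r'' - reg s ''i'') + 4 \<and>
    I (reg s ''r'') s' \<and> reg s' ''i'' = reg s ''r'' \<and> frame split_copy s s') s"
    unfolding split_copy_def
  proof (rule wp_For)
    show "I (reg s ''i'') s" by (auto simp: I_def r)
    show "reg s ''i'' \<le> reg s ''r''" "reg s ''r'' < W" "1 < W" using r ab W by auto
  next
    let ?p = "Put ''o'' (Plus (V ''q'') (V ''i'')) (Get ''tm'' (V ''i''))"
    fix s1 i assume I: "I i s1" and f: "frame (For ''i'' ''r'' ?p) s s1"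
      and i: "reg s1 ''i'' = i" "reg s ''i'' \<le> i" "i < reg s ''r''"
    have i': "a \<le> i" "i < b" using i r by auto
    have q: "reg s1 ''q'' = base c" using frame_reg[OF f, of "''q''"] r by simp
    have t: "arr s1 ''tm'' = arr s ''tm''" using frame_arr[OF f, of "''tm''"] by simp
    show "wp W ?p (\<lambda>t s'. t \<le> 6 \<and> I (Suc i) (s'\<lparr>reg := (reg s')(''i'' := Suc i)\<rparr>)) s1"
      using W i(1) i' ab q t base_le[of c] tm[OF i'] I by (auto simp: I_def)
  qed auto
  then show ?thesis by (rule wp_mono) (simp add: I_def r)
qed

text \<open>The parts carry the opposite type: each is connected for \<open>rel G c\<close>, so only
  the other relation can split it further.\<close>

definition split_result ::
    "state \<Rightarrow> bool \<Rightarrow> nat set \<Rightarrow> (nat \<Rightarrow> nat set) \<Rightarrow> bool" where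
  "split_result s c St P \<longleftrightarrow> St \<subseteq> {a..<b} \<and> a \<in> St \<and> (\<Union>k\<in>St. P k) = X \<and>
     (\<forall>k\<in>St. node s k (arr s ''en'' k) (P k) \<and> arr s ''en'' k \<le> b \<and>
       arr s ''ty'' k = base (\<not> c) \<and> conn (rel G c) (P k) \<and>
       (\<forall>x\<in>P k. \<forall>y\<in>X - P k. \<not> rel G c x y) \<and>
       (arr s ''en'' k = b \<or> arr s ''en'' k \<in> St) \<and>
       (\<forall>k'\<in>St. k < k' \<longrightarrow> arr s ''en'' k \<le> k') \<and>
       arr s ''fl'' k = (if \<not> c \<or> card St = b - a then 1 else 0)) \<and>
     (\<forall>k\<in>St. \<forall>k'\<in>St. k \<noteq> k' \<longrightarrow> P k \<inter> P k' = {}) \<and>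
     (\<forall>c i. (i < a \<or> b \<le> i) \<and> i < n \<longrightarrow> ord s c i = ord s0 c i) \<and>
     (\<forall>c v. v \<notin> X \<and> v < n \<longrightarrow> back_deg s c v = back_deg s0 c v) \<and>
     (\<forall>i. i < a \<or> b \<le> i \<longrightarrow> arr s ''en'' i = arr s0 ''en'' i \<and>
       arr s ''ty'' i = arr s0 ''ty'' i \<and> arr s ''fl'' i = arr s0 ''fl'' i)"

lemma split_resultI:
  fixes c :: bool
  assumes P_def: "P = (\<lambda>i. back_deg s0 c (ord s0 c i) = 0)" and St_def: "St = {k \<in> {a..<b}. P k}"
    and f: "\<And>j. a \<le> j \<Longrightarrow> j < b \<Longrightarrow> f (ord s0 c j) = last_start P j"
    and en: "\<And>k. k \<in> St \<Longrightarrow> k < arr s ''en'' k \<and> arr s ''en'' k \<le> b \<and> arr s ''ty'' k = base (\<not> c)"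
      "\<And>k j. k \<in> St \<Longrightarrow> a \<le> j \<Longrightarrow> j < b \<Longrightarrow> last_start P j = k \<longleftrightarrow> k \<le> j \<and> j < arr s ''en'' k"
    and l: "\<And>k. k \<in> St \<Longrightarrow>
      segment s (\<not> c) k (arr s ''en'' k) = filter (\<lambda>v. f v = k) (segment s0 (\<not> c) a b)"
    and d: "\<And>j. a \<le> j \<Longrightarrow> j < b \<Longrightarrow> back_deg s (\<not> c) (ord s0 (\<not> c) j) = back_deg s0 (\<not> c) (ord s0 (\<not> c) j) -
       card (set (segment s0 (\<not> c) a j) - {v. f v = f (ord s0 (\<not> c) j)})"
      "\<And>v. v < n \<Longrightarrow> back_deg s c v = back_deg s0 c v"
      "\<And>v. v < n \<Longrightarrow> v \<notin> X \<Longrightarrow> back_deg s (\<not> c) v = back_deg s0 (\<not> c) v"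
    and o: "\<And>i. i < n \<Longrightarrow> ord s c i = ord s0 c i"
      "\<And>i. i < n \<Longrightarrow> i < a \<or> b \<le> i \<Longrightarrow> ord s (\<not> c) i = ord s0 (\<not> c) i"
    and fl: "\<And>k. k \<in> St \<Longrightarrow> arr s ''fl'' k = (if \<not> c \<or> card St = b - a then 1 else 0)"
    and out: "\<And>i. i < a \<or> b \<le> i \<Longrightarrow> arr s ''en'' i = arr s0 ''en'' i \<and>
       arr s ''ty'' i = arr s0 ''ty'' i \<and> arr s ''fl'' i = arr s0 ''fl'' i"
  shows "split_result s c St (\<lambda>k. {v \<in> X. f v = k})"
proof -
  have ab: "a < b" "b \<le> n" "X \<subseteq> {..<n}" using nd by (auto simp: node_def)
  have Pa: "P a" using node_first by (simp add: P_def)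
  note lsp = last_start_props[of P a, OF Pa]
  have aS: "a \<in> St" using Pa ab by (simp add: St_def)
  have ex: "\<exists>j. a \<le> j \<and> j < b \<and> v = ord s0 c j" if "v \<in> X" for v
    using that node_set[of c] by fastforce
  have fS: "f v \<in> St" if v: "v \<in> X" for v
  proof -
    obtain j where j: "a \<le> j" "j < b" "v = ord s0 c j" using ex[OF v] by blast
    then show ?thesis using f[OF j(1,2)] lsp[OF j(1)] by (auto simp: St_def)
  qed
  \<comment> \<open>The start of the part of \<open>j\<close> lies after \<open>i\<close>, and the
    zero count there separates everything before from everything from there on.\<close>
  have cut1: "\<not> rel G c (ord s0 c i) (ord s0 c j)"
    if ij: "a \<le> i" "i < j" "j < b" "last_start P i \<noteq> last_start P j" for i j
  proof -
    let ?k = "last_start P j"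
    have lj: "a \<le> ?k" "?k \<le> j" "P ?k" "\<And>k. ?k < k \<Longrightarrow> k \<le> j \<Longrightarrow> \<not> P k"
      using lsp[of j] ij by auto
    have li: "last_start P i \<le> i" "P (last_start P i)" "\<And>k. last_start P i < k \<Longrightarrow> k \<le> i \<Longrightarrow> \<not> P k"
      using lsp[of i] ij by auto
    have ik: "i < ?k"
    proof (rule ccontr)
      assume "\<not> i < ?k"
      then have "?k \<le> i" by simp
      then have "?k \<le> last_start P i" using li(3)[of ?k] lj(3) by (metis not_le_imp_less)
      moreover have "last_start P i \<le> ?k" using lj(4)[of "last_start P i"] li(1,2) ij(2)
        by (metis le_trans less_imp_le_nat not_le_imp_less)
      ultimately show False using ij(4) by simp
    qed
    have sp: "segment s0 c a b = segment s0 c a ?k @ ord s0 c ?k # segment s0 c (Suc ?k) b"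
      by (rule segment_split) (use lj ij in auto)
    have "ord s0 c i \<in> set (segment s0 c a ?k)" unfolding set_segment using ij ik by auto
    moreover have "ord s0 c j \<in> set (ord s0 c ?k # segment s0 c (Suc ?k) b)"
      using lj ij by (cases "j = ?k") (auto simp: set_segment)
    moreover have "back_deg s0 c (ord s0 c ?k) = 0" using lj(3) by (simp add: P_def)
    ultimately show ?thesis using search_order_cut node_order[of c] sp by metis
  qed
  have cut: "\<not> rel G c x y" if xy: "x \<in> X" "y \<in> X" "f x \<noteq> f y" for x y
  proof -
    obtain i j where ij: "a \<le> i" "i < b" "x = ord s0 c i" "a \<le> j" "j < b" "y = ord s0 c j"
      using ex[OF xy(1)] ex[OF xy(2)] by blast
    then have ne: "last_start P i \<noteq> last_start P j" using xy(3) f by simp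
    then consider "i < j" | "j < i" by (metis nat_neq_iff)
    then show ?thesis
    proof cases
      case 1
      then show ?thesis using cut1[of i j] ij ne by simp
    next
      case 2
      then have "\<not> rel G c y x" using cut1[of j i] ij ne by simp
      then show ?thesis using rel_commute[of G c x y] by simp
    qed
  qed
  have part: "node s k (arr s ''en'' k) {v \<in> X. f v = k} \<and> conn (rel G c) {v \<in> X. f v = k}"
    if k: "k \<in> St" for k
  proof -
    let ?Y = "{v \<in> X. f v = k}" and ?e = "arr s ''en'' k"
    have ke: "a \<le> k" "k < ?e" "?e \<le> b" "P k" using k en(1)[OF k] by (auto simp: St_def)
    have flt: "filter (\<lambda>v. f v = k) (segment s0 c' a b) = filter (\<lambda>v. v \<in> ?Y) (segment s0 c' a b)" for c'
      using node_set[of c'] set_segment[of s0 c' a b] by (intro filter_cong) auto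
    have "filter (\<lambda>j. f (ord s0 c j) = k) [a..<b] = [k..<?e]"
      by (rule filter_upt) (use ke f en(2)[OF k] in auto)
    then have "filter (\<lambda>v. f v = k) (segment s0 c a b) = segment s0 c k ?e"
      by (simp add: segment_def filter_map o_def)
    also have "segment s0 c k ?e = segment s c k ?e" unfolding segment_def
      by (rule map_cong) (use o(1) ke ab in auto)
    finally have lc: "segment s c k ?e = filter (\<lambda>v. v \<in> ?Y) (segment s0 c a b)" using flt[of c] by simp
    have lc': "segment s (\<not> c) k ?e = filter (\<lambda>v. v \<in> ?Y) (segment s0 (\<not> c) a b)"
      using l[OF k] flt[of "\<not> c"] by simp
    have so: "search_order (rel G c) ?Y (segment s c k ?e) (back_deg s c)"
      unfolding lc
    proof (rule search_order_filter[OF node_order, where t = False])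
      fix u y assume "u \<in> X - ?Y" "y \<in> ?Y"
      then show "rel G c u y = False" using cut[of u y] by auto
    next
      fix ys x zs assume "x \<in> ?Y"
      then show "back_deg s c x = back_deg s0 c x - (if False then card (set ys - ?Y) else 0)"
        using d(2) ab(3) by auto
    qed auto
    \<comment> \<open>For relation \<open>c\<close> nothing outside is related to the part and the
      counts stay as they are. For the other relation everything outside is, so every earlier
      outsider has to leave the count.\<close>
    have so': "search_order (rel G (\<not> c)) ?Y (segment s (\<not> c) k ?e) (back_deg s (\<not> c))"
      unfolding lc'
    proof (rule search_order_filter[OF node_order, where t = True])
      fix u y assume uy: "u \<in> X - ?Y" "y \<in> ?Y"
      then have "\<not> rel G c u y" "u \<noteq> y" using cut[of u y] by auto
      moreover have "u \<in> verts G" "y \<in> verts G" using uy ab(3) verts_eq by auto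
      ultimately show "rel G (\<not> c) u y = True" using rel_neg_iff[of u G y c] by simp
    next
      fix ys x zs assume eq: "segment s0 (\<not> c) a b = ys @ x # zs" and x: "x \<in> ?Y"
      define j where "j = a + length ys"
      have lb: "length (segment s0 (\<not> c) a b) = b - a" by simp
      then have j: "a \<le> j" "j < b" using eq by (auto simp: j_def)
      have "segment s0 (\<not> c) a j @ ord s0 (\<not> c) j # segment s0 (\<not> c) (Suc j) b = ys @ x # zs"
        using segment_split[OF j, of s0 "\<not> c"] eq by simp
      moreover have "length (segment s0 (\<not> c) a j) = length ys" by (simp add: j_def)
      ultimately have eqs: "segment s0 (\<not> c) a j = ys" "ord s0 (\<not> c) j = x"
        using append_eq_append_conv by auto
      have "set ys \<subseteq> X" using eq node_set[of "\<not> c"] set_segment[of s0 "\<not> c" a b] by auto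
      then have "set ys - {v. f v = k} = set ys - ?Y" by auto
      then show "back_deg s (\<not> c) x = back_deg s0 (\<not> c) x - (if True then card (set ys - ?Y) else 0)"
        using d(1)[OF j] eqs x by simp
    qed auto
    have all: "search_order (rel G c') ?Y (segment s c' k ?e) (back_deg s c')" for c'
      using so so' by (cases "c' = c") auto
    have "segment s c k ?e = ord s c k # segment s c (Suc k) ?e"
      using segment_split[of k k ?e s c] ke by (simp add: segment_def)
    \<comment> \<open>Within the interval of a part only the first position is a start, so all later
      counts are nonzero.\<close>
    then have "conn (rel G c) ?Y"
    proof (intro search_order_conn[of "rel G c" ?Y "ord s c k" "segment s c (Suc k) ?e" "back_deg s c"] symp_rel)
      fix y assume "y \<in> set (segment s c (Suc k) ?e)"
      then obtain j where j: "Suc k \<le> j" "j < ?e" "y = ord s c j" by (auto simp: set_segment)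
      have y: "y = ord s0 c j" "y < n" using o(1)[of j] j ke ab node_ord_less[of j c] by auto
      have "last_start P j = k" using en(2)[OF k, of j] j ke by simp
      then have "\<not> P j" using last_start_self[of P j] j(1) by auto
      then show "back_deg s c y \<noteq> 0" using d(2)[OF y(2)] y(1) by (simp add: P_def)
    qed (use so in simp)
    then show ?thesis using all ke ab unfolding node_def by auto
  qed
  have nxt: "arr s ''en'' k = b \<or> arr s ''en'' k \<in> St" if k: "k \<in> St" for k
  proof (rule ccontr)
    let ?e = "arr s ''en'' k"
    assume A: "\<not> (?e = b \<or> ?e \<in> St)"
    have ke: "a \<le> k" "k < ?e" "?e < b" using k en(1)[OF k] A by (auto simp: St_def)
    then have "\<not> P ?e" using A by (auto simp: St_def)
    then have "last_start P ?e = last_start P (?e - 1)" using last_start_pred[of P ?e] ke by simp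
    moreover have "last_start P (?e - 1) = k" using en(2)[OF k, of "?e - 1"] ke by auto
    ultimately show False using en(2)[OF k, of ?e] ke by auto
  qed
  have sep: "arr s ''en'' k \<le> k'" if "k \<in> St" "k' \<in> St" "k < k'" for k k'
    using en(2)[OF that(1), of k'] last_start_self[of P k'] that by (auto simp: St_def)
  have on: "ord s c' i = ord s0 c' i" if "i < n" "i < a \<or> b \<le> i" for c' i
    using o that by (cases "c' = c") auto
  have dn: "back_deg s c' v = back_deg s0 c' v" if "v < n" "v \<notin> X" for c' v
    using d(2,3) that by (cases "c' = c") auto
  show ?thesis unfolding split_result_def
  proof (intro conjI ballI allI impI)
    show "St \<subseteq> {a..<b}" by (auto simp: St_def)
    show "(\<Union>k\<in>St. {v \<in> X. f v = k}) = X" using fS by auto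
  qed (use aS part en(1) nxt sep fl on dn out cut in auto)
qed

lemma split_wp:
  assumes inp: "input s0" and l: "reg s0 ''l'' = a" and en: "arr s0 ''en'' a = b"
    and ty: "arr s0 ''ty'' a = base c"
  shows "wp W split (\<lambda>t s. t \<le> 150 * (b - a) \<and> (\<exists>St P. split_result s c St P) \<and>
    reg s ''r'' = b \<and> frame split s0 s) s0"
proof -
  have ab: "a < b" "b \<le> n" "X \<subseteq> {..<n}" using nd by (auto simp: node_def)
  have rn: "reg s0 ''n'' = n" by (rule input_n[OF inp])
  define P where "P = (\<lambda>i. back_deg s0 c (ord s0 c i) = 0)"
  define St where "St = {k \<in> {a..<b}. P k}"
  have Pa: "P a" using node_first by (simp add: P_def)
  have finSt: "finite St" "St \<subseteq> {a..<b}" by (auto simp: St_def)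
  have cSt: "card St \<le> n"
    using card_mono[of "{a..<b}" St] finSt ab by auto
  define s1 where "s1 = s0\<lparr>reg := (reg s0)(''r'' := b, ''p'' := base c, ''q'' := base (\<not> c),
    ''c'' := 0, ''i'' := a)\<rparr>"
  let ?p1 = "seqs [
       Assign ''r'' (Get ''en'' (V ''l'')),
       Assign ''p'' (Get ''ty'' (V ''l'')),
       Assign ''q'' (Minus (V ''n'') (V ''p'')),
       Assign ''c'' (N 0),
       Assign ''i'' (V ''l'')]"
  let ?p3 = "seqs [
       Assign ''f'' (N 1),
       If (And (Not (Eq (V ''p'') (N 0))) (Not (Eq (V ''c'') (Minus (V ''r'') (V ''l'')))))
         (Assign ''f'' (N 0))
         SKIP,
       Assign ''i'' (V ''l'')]"
  have w1: "wp W ?p1 (\<lambda>t s. t \<le> 14 \<and> s = s1) s0"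
  proof -
    have "n - base c = base (\<not> c)" by (simp add: base_def)
    then show ?thesis using W l en ty ab base_le[of c] rn by (simp add: s1_def)
  qed
  have w2: "wp W split_scan (\<lambda>t s'. t \<le> 40 * (b - a) + 4 \<and>
    (\<forall>j. a \<le> j \<and> j < b \<longrightarrow> arr s' ''pt'' (ord s0 c j) = last_start P j \<and> arr s' ''pr'' j = j) \<and>
    (\<forall>k\<in>St. k < arr s' ''en'' k \<and> arr s' ''en'' k \<le> b \<and> arr s' ''ty'' k = base (\<not> c) \<and>
       (\<forall>j. a \<le> j \<and> j < b \<longrightarrow> (last_start P j = k \<longleftrightarrow> k \<le> j \<and> j < arr s' ''en'' k))) \<and>
    reg s' ''c'' = card St \<and>
    (\<forall>j. j < a \<or> b \<le> j \<longrightarrow> arr s' ''en'' j = arr s1 ''en'' j \<and> arr s' ''ty'' j = arr s1 ''ty'' j) \<and>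
    frame split_scan s1 s') s1"
    unfolding St_def P_def by (rule split_scan_wp) (auto simp: s1_def)
  have "wp W split (\<lambda>t s. t \<le> 150 * (b - a) \<and> (\<exists>St P. split_result s c St P) \<and>
    reg s ''r'' = b) s0"
    unfolding split_def
  proof (rule wp_seqs[OF w1], elim conjE, simp only:, rule wp_seqs[OF w2], elim conjE)
    fix t1 :: nat and s1' t2 s2
    assume t1: "t1 \<le> 14" and t2: "t2 \<le> 40 * (b - a) + 4"
      and ptr: "\<forall>j. a \<le> j \<and> j < b \<longrightarrow>
        arr s2 ''pt'' (ord s0 c j) = last_start P j \<and> arr s2 ''pr'' j = j"
      and en2: "\<forall>k\<in>St. k < arr s2 ''en'' k \<and> arr s2 ''en'' k \<le> b \<and> arr s2 ''ty'' k = base (\<not> c) \<and>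
       (\<forall>j. a \<le> j \<and> j < b \<longrightarrow> (last_start P j = k \<longleftrightarrow> k \<le> j \<and> j < arr s2 ''en'' k))"
      and c2: "reg s2 ''c'' = card St"
      and out2: "\<forall>j. j < a \<or> b \<le> j \<longrightarrow>
        arr s2 ''en'' j = arr s1 ''en'' j \<and> arr s2 ''ty'' j = arr s1 ''ty'' j"
      and f2: "frame split_scan s1 s2"
    define fv where "fv = (if \<not> c \<or> card St = b - a then 1 else 0 :: nat)"
    define s3 where "s3 = s2\<lparr>reg := (reg s2)(''f'' := fv, ''i'' := a)\<rparr>"
    have r2: "reg s2 ''p'' = base c" "reg s2 ''q'' = base (\<not> c)" "reg s2 ''r'' = b" "reg s2 ''l'' = a"
      using f2 l by (simp_all add: frame_def split_scan_def s1_def)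
    have a2: "arr s2 ''o'' = arr s0 ''o''" "arr s2 ''d'' = arr s0 ''d''" "arr s2 ''fl'' = arr s0 ''fl''"
      using f2 by (simp_all add: frame_def split_scan_def s1_def)
    have w3: "wp W ?p3 (\<lambda>t s. t \<le> 20 \<and> s = s3) s2"
      using W r2 c2 cSt ab base_le[of c] by (cases c) (auto simp: s3_def fv_def base_def)
    define f where "f = arr s3 ''pt''"
    define e where "e = arr s3 ''en''"
    have fo: "f (ord s0 c j) = last_start P j" if "a \<le> j" "j < b" for j
      using ptr that by (simp add: f_def s3_def)
    note lsp = last_start_props[of P a, OF Pa]
    have e1: "k < e k" "e k \<le> b" "arr s3 ''ty'' k = base (\<not> c)" if "k \<in> St" for k
      using en2 that by (auto simp: e_def s3_def)
    have e2: "last_start P j = k \<longleftrightarrow> k \<le> j \<and> j < e k" if "k \<in> St" "a \<le> j" "j < b" for k j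
      using en2 that by (simp add: e_def s3_def)
    have sep: "e k \<le> k'" if "k \<in> St" "k' \<in> St" "k < k'" for k k'
      using e2[OF that(1), of k'] last_start_self[of P k'] that by (auto simp: St_def)
    have cardP: "card {v \<in> X. f v = k} = e k - k" if k: "k \<in> St" for k
    proof -
      have "{v \<in> X. f v = k} = ord s0 c ` {k..<e k}"
      proof (intro set_eqI iffI)
        fix v assume "v \<in> {v \<in> X. f v = k}"
        then obtain j where "a \<le> j" "j < b" "v = ord s0 c j" "f v = k"
          using node_set[of c] by fastforce
        then show "v \<in> ord s0 c ` {k..<e k}" using fo[of j] e2[OF k, of j] by auto
      next
        fix v assume "v \<in> ord s0 c ` {k..<e k}"
        then obtain j where j: "k \<le> j" "j < e k" "v = ord s0 c j" by auto
        then have "a \<le> j" "j < b" using k e1[OF k] by (auto simp: St_def)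
        then show "v \<in> {v \<in> X. f v = k}" using node_set[of c] fo[of j] e2[OF k, of j] j by auto
      qed
      moreover have "inj_on (ord s0 c) {k..<e k}"
        by (rule inj_on_subset[OF node_inj]) (use k e1[OF k] in \<open>auto simp: St_def\<close>)
      ultimately show ?thesis by (simp add: card_image)
    qed
    have fS: "f v \<in> St" if v: "v \<in> X" for v
    proof -
      obtain j where j: "a \<le> j" "j < b" "v = ord s0 c j" using v node_set[of c] by fastforce
      then show ?thesis using fo[OF j(1,2)] lsp[OF j(1)] by (auto simp: St_def)
    qed
    have w4: "wp W split_move (\<lambda>t s'. t \<le> 46 * (b - a) + 4 \<and>
      (\<forall>k\<in>St. map (arr s' ''tm'') [k..<e k] = filter (\<lambda>v. f v = k) (segment s0 (\<not> c) a b)) \<and>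
      (\<forall>j. a \<le> j \<and> j < b \<longrightarrow> back_deg s' (\<not> c) (ord s0 (\<not> c) j) = back_deg s0 (\<not> c) (ord s0 (\<not> c) j) -
        card (set (segment s0 (\<not> c) a j) - {v. f v = f (ord s0 (\<not> c) j)})) \<and>
      (\<forall>x. x \<notin> (\<lambda>v. base (\<not> c) + v) ` X \<longrightarrow> arr s' ''d'' x = arr s0 ''d'' x) \<and>
      (\<forall>j. arr s' ''fl'' j = (if a \<le> j \<and> j < b then reg s3 ''f'' else arr s3 ''fl'' j)) \<and>
      frame split_move s3 s') s3"
    proof (rule split_move_wp)
      show "f = arr s3 ''pt''" by (simp add: f_def)
      show "arr s3 ''pr'' k = k" if "k \<in> St" for k using ptr that by (auto simp: s3_def St_def)
    qed (use a2 r2 fS e1 cardP sep in \<open>auto simp: s3_def fv_def\<close>)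
    show "wp W (seqs [?p3, split_move, Assign ''i'' (V ''l''), split_copy])
      (\<lambda>t' s. t1 + (t2 + t') \<le> 150 * (b - a) \<and> (\<exists>St P. split_result s c St P) \<and> reg s ''r'' = b) s2"
    proof (rule wp_seqs[OF w3], elim conjE, simp only:, rule wp_seqs[OF w4], elim conjE)
      fix t3 :: nat and s3' t4 s4
      assume t3: "t3 \<le> 20" and t4: "t4 \<le> 46 * (b - a) + 4"
        and tm: "\<forall>k\<in>St. map (arr s4 ''tm'') [k..<e k] = filter (\<lambda>v. f v = k) (segment s0 (\<not> c) a b)"
        and d4: "\<forall>j. a \<le> j \<and> j < b \<longrightarrow> back_deg s4 (\<not> c) (ord s0 (\<not> c) j) =
          back_deg s0 (\<not> c) (ord s0 (\<not> c) j) -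
          card (set (segment s0 (\<not> c) a j) - {v. f v = f (ord s0 (\<not> c) j)})"
        and dx: "\<forall>x. x \<notin> (\<lambda>v. base (\<not> c) + v) ` X \<longrightarrow> arr s4 ''d'' x = arr s0 ''d'' x"
        and fl4: "\<forall>j. arr s4 ''fl'' j = (if a \<le> j \<and> j < b then reg s3 ''f'' else arr s3 ''fl'' j)"
        and f4: "frame split_move s3 s4"
      define s5 where "s5 = s4\<lparr>reg := (reg s4)(''i'' := a)\<rparr>"
      have r4: "reg s4 ''r'' = b" "reg s4 ''q'' = base (\<not> c)" "reg s4 ''l'' = a"
        using f4 r2 by (simp_all add: frame_def split_move_def s3_def)
      have a4: "arr s4 ''o'' = arr s0 ''o''" "arr s4 ''en'' = e" "arr s4 ''ty'' = arr s3 ''ty''"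
        using f4 a2 by (simp_all add: frame_def split_move_def s3_def e_def)
      have w5: "wp W (Assign ''i'' (V ''l'')) (\<lambda>t s. t = 2 \<and> s = s5) s4"
        using W r4 ab by (simp add: s5_def)
      have tmn: "arr s4 ''tm'' i < n" if i: "a \<le> i" "i < b" for i
      proof -
        define k where "k = last_start P i"
        have k: "k \<in> St" using lsp[OF i(1)] i by (auto simp: k_def St_def)
        have ki: "k \<le> i" "i < e k" using e2[OF k i] by (auto simp: k_def)
        have "arr s4 ''tm'' i \<in> set (map (arr s4 ''tm'') [k..<e k])" using ki by simp
        then have "arr s4 ''tm'' i \<in> set (filter (\<lambda>v. f v = k) (segment s0 (\<not> c) a b))"
          using tm k by simp
        then show ?thesis using node_set[of "\<not> c"] ab(3) by (auto simp: set_segment)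
      qed
      have w6: "wp W split_copy (\<lambda>t s'. t \<le> 14 * (b - a) + 4 \<and>
        (\<forall>j. arr s' ''o'' j = (if base (\<not> c) + a \<le> j \<and> j < base (\<not> c) + b
          then arr s5 ''tm'' (j - base (\<not> c)) else arr s5 ''o'' j)) \<and> frame split_copy s5 s') s5"
        by (rule split_copy_wp) (use r4 tmn in \<open>auto simp: s5_def\<close>)
      show "wp W (seqs [Assign ''i'' (V ''l''), split_copy])
        (\<lambda>t' s. t1 + (t2 + (t3 + (t4 + t'))) \<le> 150 * (b - a) \<and>
          (\<exists>St P. split_result s c St P) \<and> reg s ''r'' = b) s4"
      proof (rule wp_seqs[OF w5], elim conjE, simp only:, rule wp_seqs_single,
          rule wp_mono[OF w6], elim conjE)
        fix t6 s6 assume t6: "t6 \<le> 14 * (b - a) + 4"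
          and o6: "\<forall>j. arr s6 ''o'' j = (if base (\<not> c) + a \<le> j \<and> j < base (\<not> c) + b
            then arr s5 ''tm'' (j - base (\<not> c)) else arr s5 ''o'' j)"
          and f6: "frame split_copy s5 s6"
        have a6: "arr s6 ''en'' = e" "arr s6 ''ty'' = arr s3 ''ty''" "arr s6 ''d'' = arr s4 ''d''"
          "arr s6 ''fl'' = arr s4 ''fl''" "reg s6 ''r'' = b"
          using f6 a4 r4 by (simp_all add: frame_def split_copy_def s5_def)
        have o6q: "ord s6 (\<not> c) i = arr s4 ''tm'' i" if "a \<le> i" "i < b" for i
          using o6 that by (simp add: ord_def s5_def)
        have o6c: "ord s6 c i = ord s0 c i" if "i < n" for i
          using o6 that ab a4(1) by (auto simp: ord_def s5_def base_def)
        have o6x: "ord s6 (\<not> c) i = ord s0 (\<not> c) i" if "i < n" "i < a \<or> b \<le> i" for i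
          using o6 that ab a4(1) by (auto simp: ord_def s5_def)
        have sr: "split_result s6 c St (\<lambda>k. {v \<in> X. f v = k})"
        proof (rule split_resultI[OF P_def St_def])
          fix k assume k: "k \<in> St"
          show "k < arr s6 ''en'' k \<and> arr s6 ''en'' k \<le> b \<and> arr s6 ''ty'' k = base (\<not> c)"
            using e1[OF k] a6 by simp
          have "segment s6 (\<not> c) k (e k) = map (arr s4 ''tm'') [k..<e k]" unfolding segment_def
            by (rule map_cong) (use o6q e1[OF k] finSt(2) k in auto)
          then show "segment s6 (\<not> c) k (arr s6 ''en'' k) = filter (\<lambda>v. f v = k) (segment s0 (\<not> c) a b)"
            using tm k a6(1) by simp
          show "arr s6 ''fl'' k = (if \<not> c \<or> card St = b - a then 1 else 0)"
            using fl4 a6(4) finSt(2) k by (auto simp: s3_def fv_def)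
        next
          fix i assume "i < a \<or> b \<le> i"
          then show "arr s6 ''en'' i = arr s0 ''en'' i \<and> arr s6 ''ty'' i = arr s0 ''ty'' i \<and>
              arr s6 ''fl'' i = arr s0 ''fl'' i"
            using out2 fl4 a6 a2(3) by (auto simp: s3_def e_def s1_def)
        next
          fix v assume "v < n"
          then have "base c + v \<notin> (\<lambda>v. base (\<not> c) + v) ` X" using ab(3) by (auto simp: base_def)
          then show "back_deg s6 c v = back_deg s0 c v" using dx a6(3) by (simp add: back_deg_def)
        next
          fix v assume "v < n" "v \<notin> X"
          then have "base (\<not> c) + v \<notin> (\<lambda>v. base (\<not> c) + v) ` X" by auto
          then show "back_deg s6 (\<not> c) v = back_deg s0 (\<not> c) v" using dx a6(3) by (simp add: back_deg_def)
        next
          fix j assume "a \<le> j" "j < b"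
          then show "back_deg s6 (\<not> c) (ord s0 (\<not> c) j) = back_deg s0 (\<not> c) (ord s0 (\<not> c) j) -
            card (set (segment s0 (\<not> c) a j) - {v. f v = f (ord s0 (\<not> c) j)})"
            using d4 a6(3) by (simp add: back_deg_def)
        qed (use fo e2 a6 o6c o6x in auto)
        have "t1 + (t2 + (t3 + (t4 + (2 + t6)))) \<le> 100 * (b - a) + 48"
          using t1 t2 t3 t4 t6 by linarith
        \<comment> \<open>A node is nonempty, so the constant 48 is absorbed by the factor.\<close>
        also have "\<dots> \<le> 150 * (b - a)" using ab by linarith
        finally show "t1 + (t2 + (t3 + (t4 + (2 + t6)))) \<le> 150 * (b - a) \<and>
          (\<exists>St P. split_result s6 c St P) \<and> reg s6 ''r'' = b"
          using sr a6(5) by blast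
      qed
    qed
  qed
  then show ?thesis by (rule wp_mono[OF wp_frame]) simp
qed

end

end

section \<open>Invariants of the decomposition\<close>

lemma search_order_cong:
  assumes "search_order R X xs d" "\<And>x. x \<in> X \<Longrightarrow> d' x = d x"
  shows "search_order R X xs d'"
proof -
  have "d' x = num_nbrs R (set ys) x" if eq: "xs = ys @ x # zs" for ys x zs
  proof -
    have "x \<in> X" using search_orderD(2)[OF assms(1)] eq by auto
    then show ?thesis using assms(2) search_order_d[of R X ys x zs d] assms(1) eq by simp
  qed
  then show ?thesis using search_orderD[OF assms(1)] unfolding search_order_def by blast
qed

lemma disjoint_arcs:
  assumes "\<And>k k'. k \<in> S \<Longrightarrow> k' \<in> S \<Longrightarrow> k \<noteq> k' \<Longrightarrow> P k \<inter> P k' = {}" "k \<in> S" "k' \<in> S" "k \<noteq> k'"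
  shows "arcs R (P k) \<inter> arcs R (P k') = {}"
  using assms(1)[OF assms(2-4)] by (auto simp: arcs_def)

section \<open>Counting vertices and arcs over a partition\<close>

context
  fixes S :: "'b set" and P :: "'b \<Rightarrow> 'a set" and X :: "'a set"
  assumes finS: "finite S" and finX: "finite X" and un: "(\<Union>k\<in>S. P k) = X"
    and dis: "\<And>k k'. k \<in> S \<Longrightarrow> k' \<in> S \<Longrightarrow> k \<noteq> k' \<Longrightarrow> P k \<inter> P k' = {}"
begin

lemma finite_part: "k \<in> S \<Longrightarrow> finite (P k)"
  using finX un by (metis UN_upper finite_subset)

lemma sum_card_parts: "(\<Sum>k\<in>S. card (P k)) = card X"
  using card_UN_disjoint[of S P] finS finite_part dis un by auto

lemma card_arcs_parts: "card (\<Union>k\<in>S. arcs R (P k)) = (\<Sum>k\<in>S. card (arcs R (P k)))"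
  using finS finite_part dis disjoint_arcs[of S P] by (intro card_UN_disjoint) auto

lemma sum_arcs_le: "(\<Sum>k\<in>S. card (arcs R (P k))) \<le> card (arcs R X)"
proof -
  have "(\<Union>k\<in>S. arcs R (P k)) \<subseteq> arcs R X" using un by (auto simp: arcs_def)
  from card_mono[OF finite_arcs[OF finX] this] show ?thesis unfolding card_arcs_parts .
qed

text \<open>If \<^term>\<open>x\<close> and \<^term>\<open>y\<close> lie in different parts, every vertex \<^term>\<open>u\<close> has an arc to the
  one of them that is not in its own part.\<close>

lemma sum_arcs_join:
  assumes "k1 \<in> S" "k2 \<in> S" "k1 \<noteq> k2" "P k1 \<noteq> {}" "P k2 \<noteq> {}"
    and join: "\<And>k u v. k \<in> S \<Longrightarrow> u \<in> P k \<Longrightarrow> v \<in> X - P k \<Longrightarrow> R u v"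
  shows "(\<Sum>k\<in>S. card (arcs R (P k))) + card X \<le> card (arcs R X)"
proof -
  obtain x y where xy: "x \<in> P k1" "y \<in> P k2" using assms by blast
  have sub: "P k \<subseteq> X" if "k \<in> S" for k using un that by blast
  define g where "g = (\<lambda>u. (u, if u \<in> P k1 then y else x))"
  have yk1: "y \<notin> P k1" using dis[OF assms(1-3)] xy by blast
  have "g ` X \<inter> (\<Union>k\<in>S. arcs R (P k)) = {}"
  proof (intro equals0I)
    fix z assume z: "z \<in> g ` X \<inter> (\<Union>k\<in>S. arcs R (P k))"
    then obtain u k where u: "u \<in> X" "z = g u" "k \<in> S" "z \<in> arcs R (P k)" by blast
    then have uk: "u \<in> P k" "(if u \<in> P k1 then y else x) \<in> P k" by (auto simp: g_def arcs_def)
    show False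
    proof (cases "u \<in> P k1")
      case True
      then have "k = k1" using dis[OF u(3) assms(1)] uk by blast
      then show False using uk True yk1 by simp
    next
      case False
      then have "k = k1" using dis[OF u(3) assms(1)] uk xy by auto
      then show False using uk False by simp
    qed
  qed
  moreover have "g ` X \<union> (\<Union>k\<in>S. arcs R (P k)) \<subseteq> arcs R X"
  proof -
    have "g u \<in> arcs R X" if u: "u \<in> X" for u
    proof -
      obtain k where k: "k \<in> S" "u \<in> P k" using u un by blast
      show ?thesis
      proof (cases "u \<in> P k1")
        case True
        then have "R u y" using join[OF assms(1) True, of y] yk1 xy sub[OF assms(2)] by blast
        then show ?thesis using True u xy sub[OF assms(2)] by (auto simp: g_def arcs_def)
      next
        case False
        then have "x \<notin> P k" using dis[OF k(1) assms(1)] k(2) xy by blast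
        then have "R u x" using join[OF k, of x] xy sub[OF assms(1)] by blast
        then show ?thesis using False u xy sub[OF assms(1)] by (auto simp: g_def arcs_def)
      qed
    qed
    then have "g ` X \<subseteq> arcs R X" by blast
    moreover have "(\<Union>k\<in>S. arcs R (P k)) \<subseteq> arcs R X" using un by (auto simp: arcs_def)
    ultimately show ?thesis by (rule Un_least)
  qed
  moreover have "card (g ` X) = card X" by (rule card_image) (auto simp: inj_on_def g_def)
  ultimately have "card X + card (\<Union>k\<in>S. arcs R (P k)) \<le> card (arcs R X)"
    using card_Un_disjoint[of "g ` X" "\<Union>k\<in>S. arcs R (P k)"] finX
      card_mono[of "arcs R X" "g ` X \<union> (\<Union>k\<in>S. arcs R (P k))"] finS finite_part by auto
  then show ?thesis using card_arcs_parts[of R] by simp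
qed

text \<open>This is what the machine's test is worth: comparing the number of parts with the size
  tells whether all parts are single vertices.\<close>

lemma card_parts_eq_iff:
  assumes "\<And>k. k \<in> S \<Longrightarrow> P k \<noteq> {}"
  shows "card S = card X \<longleftrightarrow> (\<forall>k\<in>S. card (P k) = 1)"
proof -
  have ge: "1 \<le> card (P k)" if "k \<in> S" for k
    using assms[OF that] finite_part[OF that] by (simp add: Suc_le_eq card_gt_0_iff)
  show ?thesis
  proof
    assume "card S = card X"
    then have eq: "(\<Sum>k\<in>S. 1) = (\<Sum>k\<in>S. card (P k))" using sum_card_parts by simp
    show "\<forall>k\<in>S. card (P k) = 1"
    proof (rule ccontr)
      assume "\<not> (\<forall>k\<in>S. card (P k) = 1)"
      then obtain k where k: "k \<in> S" "card (P k) \<noteq> 1" by blast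
      then have "1 < card (P k)" using ge[OF k(1)] by linarith
      then have "(\<Sum>k\<in>S. 1) < (\<Sum>k\<in>S. card (P k))"
        using ge finS k(1) by (intro sum_strict_mono_ex1) auto
      then show False using eq by simp
    qed
  next
    assume "\<forall>k\<in>S. card (P k) = 1"
    then show "card S = card X" using sum_card_parts by simp
  qed
qed

end

section \<open>Facts about a node that its parts inherit\<close>

context graph_input
begin

text \<open>What remains of the rest of the graph once attention is on \<open>X\<close>. The
  constant \<open>K\<close> reflects that \<open>X\<close> is a module; the second fact makes an
  unsplittable node maximal; by the third, avoidability can be decided inside \<open>X\<close>,
  except that a single vertex with flag 0 is never avoidable.\<close>

definition node_info :: "nat set \<Rightarrow> nat \<Rightarrow> bool" where
  "node_info X f \<longleftrightarrow> (\<exists>K. \<forall>v\<in>X. deg v = num_nbrs E X v + K) \<and>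
     (\<forall>Y. Y \<subseteq> verts G \<longrightarrow> conn (rel G False) Y \<longrightarrow> conn (rel G True) Y \<longrightarrow> Y \<inter> X \<noteq> {} \<longrightarrow> Y \<subseteq> X) \<and>
     (\<forall>v\<in>X. avoidable G v \<longleftrightarrow> avoids G X v \<and> (2 \<le> card X \<or> f = 1))"

lemma node_info_deg: "node_info X f \<Longrightarrow> \<exists>K. \<forall>v\<in>X. deg v = num_nbrs E X v + K"
  unfolding node_info_def by (elim conjE)

lemma node_info_verts: "node_info (verts G) 1"
proof -
  have "\<forall>v\<in>verts G. deg v = num_nbrs E (verts G) v + 0" using deg_eq_num_nbrs verts_eq by simp
  then show ?thesis unfolding node_info_def using avoidable_iff[OF simple] by blast
qed

text \<open>The three facts pass to parts for three reasons: a part is joined to the rest of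
  \<open>X\<close> completely or not at all, a set connected for both relations cannot cross the cut
  around a part, and avoidability transfers to components and co-components. The hypothesis on
  \<open>f0\<close> ensures that the old flag carries no information that would be lost.\<close>

lemma node_info_part:
  assumes inf: "node_info X f0" and f0: "2 \<le> card X \<or> f0 = 1" and X: "X \<subseteq> verts G"
    and finS: "finite S" and un: "(\<Union>k\<in>S. P k) = X"
    and dis: "\<And>k k'. k \<in> S \<Longrightarrow> k' \<in> S \<Longrightarrow> k \<noteq> k' \<Longrightarrow> P k \<inter> P k' = {}"
    and conn: "\<And>k. k \<in> S \<Longrightarrow> conn (rel G c) (P k)"
    and cut: "\<And>k x y. k \<in> S \<Longrightarrow> x \<in> P k \<Longrightarrow> y \<in> X - P k \<Longrightarrow> \<not> rel G c x y"
    and k: "k \<in> S" and f: "f = (if \<not> c \<or> card S = card X then 1 else 0)"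
  shows "node_info (P k) f"
proof -
  have finX: "finite X" by (rule finite_subset_verts[OF simple X])
  have sub: "P k \<subseteq> X" using un k by blast
  have ne: "P k' \<noteq> {}" if "k' \<in> S" for k' using conn[OF that] by (simp add: conn_def)
  have "\<exists>K. \<forall>v\<in>P k. deg v = num_nbrs E (P k) v + K"
  proof -
    obtain K where K: "\<And>v. v \<in> X \<Longrightarrow> deg v = num_nbrs E X v + K"
    using node_info_deg[OF inf] by blast
    have split: "num_nbrs E X v = num_nbrs E (P k) v + num_nbrs E (X - P k) v" for v
    proof -
      have "{z \<in> X. E z v} = {z \<in> P k. E z v} \<union> {z \<in> X - P k. E z v}" using sub by auto
      then have "card {z \<in> X. E z v} = card ({z \<in> P k. E z v} \<union> {z \<in> X - P k. E z v})"
        by (rule arg_cong)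
      also have "\<dots> = card {z \<in> P k. E z v} + card {z \<in> X - P k. E z v}"
        using finX finite_subset[OF sub finX] by (intro card_Un_disjoint) auto
      finally show ?thesis by (simp add: num_nbrs_def)
    qed
    \<comment> \<open>A vertex of a component sees nothing of the rest, a vertex of a co-component
      sees all of it: the same number for all \<open>v\<close> in the part.\<close>
    have out: "num_nbrs E (X - P k) v = (if c then card (X - P k) else 0)" if v: "v \<in> P k" for v
    proof (cases c)
      case True
      have "E z v" if z: "z \<in> X - P k" for z
      proof -
        have "\<not> rel G True v z" using cut[OF k v z] True by simp
        moreover have "v \<in> verts G" "z \<in> verts G" "v \<noteq> z" using v z X sub by auto
        ultimately show ?thesis using rel_True_iff[of v G z] rel_commute[of G False v z] by simp
      qed
      then have "{z \<in> X - P k. E z v} = X - P k" by blast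
      then show ?thesis using True unfolding num_nbrs_def by (simp only: if_True)
    next
      case False
      have "\<not> E z v" if z: "z \<in> X - P k" for z
        using cut[OF k v z] False rel_commute[of G False v z] by simp
      then have "{z \<in> X - P k. E z v} = {}" by blast
      then show ?thesis using False unfolding num_nbrs_def by (simp only: card.empty if_False)
    qed
    have "deg v = num_nbrs E (P k) v + ((if c then card (X - P k) else 0) + K)" if v: "v \<in> P k" for v
      using K[of v] split[of v] out[OF v] sub v by auto
    then show ?thesis by blast
  qed
  moreover have "Y \<subseteq> P k" if Y: "Y \<subseteq> verts G" "conn (rel G False) Y" "conn (rel G True) Y"
    "Y \<inter> P k \<noteq> {}" for Y
  \<comment> \<open>Otherwise the connectivity of \<open>Y\<close> for \<open>rel G c\<close> yields
    a related pair that crosses the border of \<open>P k\<close> inside \<open>X\<close>.\<close>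
  proof (rule ccontr)
    assume "\<not> Y \<subseteq> P k"
    then have "Y \<inter> P k \<subset> Y \<and> Y \<inter> P k \<noteq> {}" using Y(4) by auto
    moreover have "conn (rel G c) Y" using Y by (cases c) auto
    ultimately obtain u v where uv: "u \<in> Y \<inter> P k" "v \<in> Y - Y \<inter> P k" "rel G c u v"
      unfolding conn_def by meson
    have "Y \<inter> X \<noteq> {}" using Y(4) sub by blast
    then have "Y \<subseteq> X" using inf Y unfolding node_info_def by blast
    then show False using cut[OF k, of u v] uv by blast
  qed
  moreover have "avoidable G v \<longleftrightarrow> avoids G (P k) v \<and> (2 \<le> card (P k) \<or> f = 1)" if v: "v \<in> P k" for v
  proof -
    have 1: "avoidable G v \<longleftrightarrow> avoids G X v" using inf f0 v sub unfolding node_info_def by blast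
    show ?thesis
    proof (cases c)
      case False
      have "avoids G X v \<longleftrightarrow> avoids G (P k) v"
        by (rule avoids_component[OF simple sub v X]) (use cut[OF k] False in auto)
      then show ?thesis using 1 f False by simp
    next
      case True
      have 2: "avoids G X v \<longleftrightarrow> avoids G (P k) v \<and> (2 \<le> card (P k) \<or> arcs (rel G True) X = {})"
        by (rule avoids_co_component[OF simple sub v X]) (use cut[OF k] conn[OF k] True in auto)
      have iff: "card S = card X \<longleftrightarrow> (\<forall>k\<in>S. card (P k) = 1)"
        by (rule card_parts_eq_iff[OF finS finX un dis ne])
      \<comment> \<open>\<open>X\<close> is complete exactly if all its co-components are single
        vertices: a larger co-component contains a non-edge, and a non-edge lies within one
        co-component.\<close>
      have "arcs (rel G True) X = {} \<longleftrightarrow> card S = card X"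
      proof
        assume A: "arcs (rel G True) X = {}"
        have "card (P k') = 1" if k': "k' \<in> S" for k'
        proof (rule ccontr)
          assume c1: "card (P k') \<noteq> 1"
          have fp: "finite (P k')" by (rule finite_part[OF finS finX un dis k'])
          have "card (P k') \<noteq> 0" using ne[OF k'] fp by simp
          then have "2 \<le> card (P k')" using c1 by linarith
          moreover obtain x where x: "x \<in> P k'" using ne[OF k'] by blast
          moreover have "conn (rel G True) (P k')" using conn[OF k'] True by simp
          ultimately obtain w where "w \<in> P k'" "rel G True x w" using conn_neighbour by metis
          then have "(x, w) \<in> arcs (rel G True) X" using x un k' by (auto simp: arcs_def)
          then show False using A by blast
        qed
        then show "card S = card X" using iff by blast
      next
        assume "card S = card X"
        then have one: "\<forall>k\<in>S. card (P k) = 1" using iff by blast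
        show "arcs (rel G True) X = {}"
        proof (rule ccontr)
          assume "arcs (rel G True) X \<noteq> {}"
          then obtain x y where xy: "x \<in> X" "y \<in> X" "rel G True x y" by (auto simp: arcs_def)
          obtain k' where k': "k' \<in> S" "x \<in> P k'" using xy un by blast
          have "y \<in> P k'" using cut[OF k', of y] xy True by auto
          then have "x = y" using one k' by (metis card_1_singletonE singletonD)
          then show False using xy by simp
        qed
      qed
      then show ?thesis using 1 2 f True by auto
    qed
  qed
  ultimately show ?thesis unfolding node_info_def by blast
qed

text \<open>The conditions on a single member of a typical collection. Disjointness of the members
  comes from the labels.\<close>

definition good :: "nat set \<Rightarrow> bool" where
  "good X \<longleftrightarrow> maximal_conn_coconn G (induced G X) \<and>
     connected (induced G X) \<and> co_connected (induced G X) \<and>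
     card X \<le> card (edges (induced G X)) \<and> card X \<le> card (edges (complement (induced G X))) \<and>
     avoidable_set (induced G X) \<subseteq> avoidable_set G"

lemma card_arcs_singleton: "card (arcs (rel G c) {v}) = 0"
proof -
  have "arcs (rel G c) {v} = {}" by (auto simp: arcs_def)
  then show ?thesis by simp
qed

section \<open>Connected and co-connected parts\<close>

context
  fixes X :: "nat set" and f :: nat
  assumes inf: "node_info X f" and X: "X \<subseteq> verts G"
    and cF: "conn (rel G False) X" and cT: "conn (rel G True) X"
begin

lemma finite_leaf: "finite X"
  by (rule finite_subset_verts[OF simple X])

lemma leaf_card: "2 \<le> card X \<or> (\<exists>v. X = {v})"
proof -
  have "card X \<noteq> 0" using cF finite_leaf by (auto simp: conn_def)
  then consider "card X = 1" | "2 \<le> card X" by linarith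
  then show ?thesis by cases (auto simp: card_1_singleton_iff)
qed

lemma leaf_good:
  assumes "2 * card X \<le> card (arcs (rel G False) X)" "2 * card X \<le> card (arcs (rel G True) X)"
  shows "good X"
proof -
  have vX: "verts (induced G X) = X" by (simp add: induced_def)
  \<comment> \<open>A single vertex has no arcs and fails the size condition, so the flag plays no
    part in the avoidability of the vertices of \<open>X\<close>.\<close>
  have two: "2 \<le> card X" using leaf_card assms(1) card_arcs_singleton[of False] by auto
  have cc: "connected (induced G X)" "co_connected (induced G X)"
    using connected_induced_iff[OF simple X] co_connected_induced_iff[OF simple X] cF cT by auto
  have "maximal_conn_coconn G (induced G X)" unfolding maximal_conn_coconn_def
  proof (intro conjI allI impI)
    show "induced_subgraph (induced G X) G" using X by (simp add: induced_subgraph_def vX)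
  next
    fix H assume H: "induced_subgraph H G \<and> connected H \<and> co_connected H \<and>
      verts (induced G X) \<subseteq> verts H"
    let ?Y = "verts H"
    have Y: "?Y \<subseteq> verts G" and HY: "H = induced G ?Y" using H by (auto simp: induced_subgraph_def)
    have "conn (rel G False) ?Y" "conn (rel G True) ?Y"
      using connected_induced_iff[OF simple Y] co_connected_induced_iff[OF simple Y] H HY by auto
    moreover have "?Y \<inter> X \<noteq> {}"
    proof -
      have "X \<noteq> {}" using cF by (simp add: conn_def)
      moreover have "X \<subseteq> ?Y" using H vX by simp
      ultimately show ?thesis by blast
    qed
    \<comment> \<open>A larger connected and co-connected set meets \<open>X\<close> and is
      therefore confined to it by \<open>node_info\<close>.\<close>
    ultimately have "?Y \<subseteq> X" using inf Y unfolding node_info_def by blast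
    then have "?Y = X" using H vX by auto
    then show "H = induced G X" using HY by simp
  qed (use cc in auto)
  moreover have "avoidable_set (induced G X) \<subseteq> avoidable_set G"
    using inf avoidable_induced_iff[OF simple X] two
    unfolding node_info_def avoidable_set_def by auto
  ultimately show ?thesis
    unfolding good_def using cc card_edges_induced[OF simple X] assms by auto
qed

text \<open>Connectivity gives every vertex a neighbour, and an average degree below two leaves some
  vertex with only one. Such a vertex anchors the unknown constant between inner degrees and degrees
  in the graph.\<close>

lemma leaf_extremal_degree:
  assumes two: "2 \<le> card X" and lt: "card (arcs (rel G c) X) < 2 * card X"
  shows "(\<forall>v\<in>X. 1 \<le> num_nbrs (rel G c) X v) \<and> (\<exists>v\<in>X. num_nbrs (rel G c) X v = 1)"
proof -
  have ge: "1 \<le> num_nbrs (rel G c) X v" if v: "v \<in> X" for v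
  proof -
    have "conn (rel G c) X" using cF cT by (cases c) auto
    then obtain w where w: "w \<in> X" "rel G c v w" using conn_neighbour[OF _ v two] by metis
    then have "w \<in> {z \<in> X. rel G c z v}" using rel_commute[of G c v w] by simp
    then show ?thesis unfolding num_nbrs_def using finite_leaf by (auto simp: Suc_le_eq card_gt_0_iff)
  qed
  have "\<exists>v\<in>X. num_nbrs (rel G c) X v \<le> 1"
  proof (rule ccontr)
    assume "\<not> ?thesis"
    then have "(\<Sum>v\<in>X. 2) \<le> (\<Sum>v\<in>X. num_nbrs (rel G c) X v)" by (intro sum_mono) force
    then show False using card_arcs[OF finite_leaf, of "rel G c"] lt by simp
  qed
  then show ?thesis using ge by (metis le_antisym)
qed

text \<open>A single vertex is the middle of no path inside \<open>X\<close>, so the flag alone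
  decides.\<close>

lemma leaf_single:
  assumes "X = {v}"
  shows "avoidable G v \<longleftrightarrow> f = 1"
proof -
  have "avoids G X v" using assms rel_irrefl by (auto simp: avoids_def[OF simple])
  then show ?thesis using inf assms unfolding node_info_def by simp
qed

text \<open>The smallest inner degree is 1, so \<open>mn\<close> is \<open>1 + K\<close>, and an
  inner degree of at most 1 means a degree in the graph below \<open>mn + 1\<close>.\<close>

lemma leaf_tree:
  assumes two: "2 \<le> card X" and lt: "card (arcs (rel G False) X) < 2 * card X" and v: "v \<in> X"
    and mn: "\<And>u. u \<in> X \<Longrightarrow> mn \<le> deg u" "u \<in> X" "deg u = mn"
  shows "avoidable G v \<longleftrightarrow> deg v < mn + 1"
proof -
  obtain K where K: "\<And>v. v \<in> X \<Longrightarrow> deg v = num_nbrs E X v + K"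
    using node_info_deg[OF inf] by blast
  obtain w where w: "w \<in> X" "num_nbrs E X w = 1" and ge: "\<forall>v\<in>X. 1 \<le> num_nbrs E X v"
    using leaf_extremal_degree[OF two lt] by blast
  have "mn = 1 + K" using mn(1)[OF w(1)] K[OF w(1)] w(2) K[OF mn(2)] mn(3) ge mn(2) by fastforce
  moreover have "avoidable G v \<longleftrightarrow> num_nbrs E X v \<le> 1"
    using inf v two avoids_tree[OF simple X v cF lt] unfolding node_info_def by blast
  ultimately show ?thesis using K[OF v] by auto
qed

text \<open>The leaves of the complement tree miss only one other vertex of the part, so they are
  the vertices of largest degree; they are also the vertices that are not avoidable.\<close>

lemma leaf_co_tree:
  assumes two: "2 \<le> card X" and lt: "card (arcs (rel G True) X) < 2 * card X" and v: "v \<in> X"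
    and mx: "\<And>u. u \<in> X \<Longrightarrow> deg u \<le> mx" "u \<in> X" "deg u = mx"
  shows "avoidable G v \<longleftrightarrow> deg v < mx"
proof -
  obtain K where K: "\<And>v. v \<in> X \<Longrightarrow> deg v = num_nbrs E X v + K"
    using node_info_deg[OF inf] by blast
  have comp: "num_nbrs (rel G True) X w + num_nbrs E X w = card X - 1" if w: "w \<in> X" for w
  proof -
    have "num_nbrs (rel G c) X w = num_nbrs (rel G c) (X - {w}) w" for c
      unfolding num_nbrs_def by (rule arg_cong[of _ _ card]) auto
    moreover have "num_nbrs (rel G True) (X - {w}) w + num_nbrs E (X - {w}) w = card (X - {w})"
      by (rule num_nbrs_True_add) (use X verts_eq w in auto)
    ultimately show ?thesis using w finite_leaf by simp
  qed
  obtain w where w: "w \<in> X" "num_nbrs (rel G True) X w = 1" and ge: "\<forall>v\<in>X. 1 \<le> num_nbrs (rel G True) X v"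
    using leaf_extremal_degree[OF two lt] by blast
  have "mx = card X - 2 + K"
  proof -
    have "deg w = card X - 2 + K" using K[OF w(1)] comp[OF w(1)] w(2) by linarith
    moreover have "deg u \<le> card X - 2 + K" using K[OF mx(2)] comp[OF mx(2)] ge mx(2) by fastforce
    ultimately show ?thesis using mx(1)[OF w(1)] mx(3) by linarith
  qed
  moreover have "avoidable G v \<longleftrightarrow> 2 \<le> num_nbrs (rel G True) X v"
    using inf v two avoids_co_tree[OF simple X v two cF cT lt] unfolding node_info_def by blast
  ultimately show ?thesis using K[OF v] comp[OF v] two by linarith
qed

end

end

section \<open>Processing a leaf\<close>

text \<open>\<open>e\<close> and \<open>g\<close> become the numbers of edges and non-edges. The
  degrees are those in the whole graph, read off as differences of offsets.\<close>

definition leaf_sum :: com where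
  "leaf_sum = For ''i'' ''r'' (seqs [
     Assign ''v'' (Get ''o'' (V ''i'')),
     Assign ''e'' (Plus (V ''e'') (Get ''d'' (V ''v''))),
     Assign ''g'' (Plus (V ''g'') (Get ''d'' (Plus (V ''n'') (V ''v'')))),
     Assign ''w'' (Minus (Get ''off'' (Plus (V ''v'') (N 1))) (Get ''off'' (V ''v''))),
     If (Less (V ''w'') (V ''mn'')) (Assign ''mn'' (V ''w'')) SKIP,
     If (Less (V ''mx'') (V ''w'')) (Assign ''mx'' (V ''w'')) SKIP])"

text \<open>All cases become one threshold: a vertex is answered positively if its degree is below
  \<open>z\<close>. A tree gets \<open>mn + 1\<close>, a co-tree \<open>mx\<close>, and a single
  vertex with flag 0 gets 0. In a collected part no answer is asked for and only the label
  \<open>x\<close> matters.\<close>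

definition leaf_decide :: com where
  "leaf_decide = seqs [
     Assign ''z'' (N 0),
     Assign ''x'' (N 0),
     If (Less (V ''e'') (Minus (V ''r'') (V ''l'')))
       (If (And (Eq (V ''y'') (N 0)) (Eq (Minus (V ''r'') (V ''l'')) (N 1)))
         SKIP
         (Assign ''z'' (Plus (V ''mn'') (N 1))))
       (If (Less (V ''g'') (Minus (V ''r'') (V ''l'')))
         (Assign ''z'' (V ''mx''))
         (seqs [Assign ''k'' (Plus (V ''k'') (N 1)), Assign ''x'' (V ''k'')])),
     Assign ''i'' (V ''l'')]"

definition leaf_put :: com where
  "leaf_put = For ''i'' ''r'' (seqs [
     Assign ''v'' (Get ''o'' (V ''i'')),
     Put ''label'' (V ''v'') (V ''x''),
     If (Less (Minus (Get ''off'' (Plus (V ''v'') (N 1))) (Get ''off'' (V ''v''))) (V ''z''))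
       (Put ''answer'' (V ''v'') (N 1))
       (Put ''answer'' (V ''v'') (N 0))])"

definition leaf :: com where
  "leaf = seqs [
     seqs [
       Assign ''e'' (N 0),
       Assign ''g'' (N 0),
       Assign ''mn'' (V ''n''),
       Assign ''mx'' (N 0),
       Assign ''i'' (V ''l'')],
     leaf_sum,
     leaf_decide,
     leaf_put]"

section \<open>Correctness of the treatment of a leaf\<close>

context graph_input
begin

lemma deg_less: "v < n \<Longrightarrow> deg v < n"
proof -
  assume v: "v < n"
  have "{z \<in> verts G. E z v} \<subseteq> {..<n} - {v}" using verts_eq by (auto simp: rel_def)
  then have "card {z \<in> verts G. E z v} \<le> card ({..<n} - {v})" by (intro card_mono) auto
  then show ?thesis using v deg_eq_num_nbrs[OF v] by (simp add: num_nbrs_def)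
qed

lemma input_deg:
  assumes "input s" "v < n"
  shows "arr s ''off'' (Suc v) - arr s ''off'' v = deg v" "arr s ''off'' (Suc v) \<le> M"
    "arr s ''off'' v \<le> M"
proof -
  have "arr s ''off'' v = off v" "arr s ''off'' (Suc v) = off (Suc v)"
    using input_off[OF assms(1)] assms(2) by simp_all
  then show "arr s ''off'' (Suc v) - arr s ''off'' v = deg v" "arr s ''off'' (Suc v) \<le> M"
    "arr s ''off'' v \<le> M"
    using off_Suc[OF assms(2)] off_le[of v] off_le[of "Suc v"] by linarith+
qed

definition leaf_result :: "nat set \<Rightarrow> state \<Rightarrow> state \<Rightarrow> bool" where
  "leaf_result Y s s' \<longleftrightarrow> (\<forall>v. v \<notin> Y \<longrightarrow>
       arr s' ''label'' v = arr s ''label'' v \<and> arr s' ''answer'' v = arr s ''answer'' v) \<and>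
     (good Y \<and> reg s' ''k'' = Suc (reg s ''k'') \<and> (\<forall>v\<in>Y. arr s' ''label'' v = reg s' ''k'') \<or>
      reg s' ''k'' = reg s ''k'' \<and>
        (\<forall>v\<in>Y. arr s' ''label'' v = 0 \<and> decides_at s' v (v \<in> avoidable_set G)))"

context
  fixes s0 :: state and a b :: nat and X :: "nat set"
  assumes nd: "node s0 a b X"
begin

lemma leaf_sum_wp:
  assumes inp: "input s" and fr: "arr s ''o'' = arr s0 ''o''" "arr s ''d'' = arr s0 ''d''"
    and r: "reg s ''i'' = a" "reg s ''r'' = b" "reg s ''e'' = 0" "reg s ''g'' = 0"
      "reg s ''mn'' = n" "reg s ''mx'' = 0"
  shows "wp W leaf_sum (\<lambda>t s'. t \<le> 43 * (b - a) + 4 \<and>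
    reg s' ''e'' = (\<Sum>v\<in>X. back_deg s0 False v) \<and> reg s' ''g'' = (\<Sum>v\<in>X. back_deg s0 True v) \<and>
    reg s' ''e'' < W \<and> reg s' ''g'' < W \<and>
    (\<forall>v\<in>X. reg s' ''mn'' \<le> deg v) \<and> (\<exists>v\<in>X. deg v = reg s' ''mn'') \<and>
    (\<forall>v\<in>X. deg v \<le> reg s' ''mx'') \<and> (\<exists>v\<in>X. deg v = reg s' ''mx'') \<and>
    frame leaf_sum s s') s"
proof -
  have ab: "a < b" "b \<le> n" "X \<subseteq> {..<n}" using nd by (auto simp: node_def)
  let ?o = "ord s0 False"
  define I where "I = (\<lambda>i (s' :: state).
    reg s' ''e'' = (\<Sum>j=a..<i. back_deg s0 False (?o j)) \<and>
    reg s' ''g'' = (\<Sum>j=a..<i. back_deg s0 True (?o j)) \<and>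
    (\<forall>j. a \<le> j \<and> j < i \<longrightarrow> reg s' ''mn'' \<le> deg (?o j) \<and> deg (?o j) \<le> reg s' ''mx'') \<and>
    (reg s' ''mn'' = n \<or> (\<exists>j. a \<le> j \<and> j < i \<and> deg (?o j) = reg s' ''mn'')) \<and>
    (reg s' ''mx'' = 0 \<or> (\<exists>j. a \<le> j \<and> j < i \<and> deg (?o j) = reg s' ''mx'')))"
  have oX: "?o j \<in> X" if "a \<le> j" "j < b" for j using node_set[OF nd, of False] that by auto
  have on: "?o j < n" if "a \<le> j" "j < b" for j using oX[OF that] ab by auto
  \<comment> \<open>At most \<open>n\<close> summands of size at most \<open>n\<close>: this is
    where words of size \<open>n * n\<close> come in.\<close>
  have sq: "(\<Sum>j=a..<i. back_deg s0 c (?o j)) \<le> n * (i - a)" if "i \<le> b" for i c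
  proof -
    have "(\<Sum>j=a..<i. back_deg s0 c (?o j)) \<le> (\<Sum>j=a..<i. n)"
      using node_back_deg_le[OF nd] oX that by (intro sum_mono) auto
    then show ?thesis by (simp add: mult.commute)
  qed
  have sqW: "(\<Sum>j=a..<i. back_deg s0 c (?o j)) < W" if "i \<le> b" for i c
  proof -
    have "n * (i - a) \<le> n * n" using that ab by (intro mult_le_mono2) linarith
    then show ?thesis using sq[OF that, of c] W_square by linarith
  qed
  have "wp W leaf_sum (\<lambda>t s'. t \<le> (35 + 8) * (reg s ''r'' - reg s ''i'') + 4 \<and>
    I (reg s ''r'') s' \<and> reg s' ''i'' = reg s ''r'' \<and> frame leaf_sum s s') s"
    unfolding leaf_sum_def
  proof (rule wp_For)
    show "I (reg s ''i'') s" by (simp add: I_def r)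
    show "reg s ''i'' \<le> reg s ''r''" "reg s ''r'' < W" "1 < W" using r ab W by auto
  next
    let ?p = "seqs [
     Assign ''v'' (Get ''o'' (V ''i'')),
     Assign ''e'' (Plus (V ''e'') (Get ''d'' (V ''v''))),
     Assign ''g'' (Plus (V ''g'') (Get ''d'' (Plus (V ''n'') (V ''v'')))),
     Assign ''w'' (Minus (Get ''off'' (Plus (V ''v'') (N 1))) (Get ''off'' (V ''v''))),
     If (Less (V ''w'') (V ''mn'')) (Assign ''mn'' (V ''w'')) SKIP,
     If (Less (V ''mx'') (V ''w'')) (Assign ''mx'' (V ''w'')) SKIP]"
    fix s1 i assume I: "I i s1" and f: "frame (For ''i'' ''r'' ?p) s s1"
      and i: "reg s1 ''i'' = i" "reg s ''i'' \<le> i" "i < reg s ''r''"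
    note I' = I[unfolded I_def]
    have i': "a \<le> i" "i < b" using i r by auto
    define v where "v = ?o i"
    have v: "v < n" "v \<in> X" using on[OF i'] oX[OF i'] by (auto simp: v_def)
    have inp1: "input s1" by (rule input_frame[OF inp f]) auto
    note deg = input_deg[OF inp1 v(1)]
    have vo: "arr s1 ''o'' i = v"
      using frame_arr[OF f, of "''o''"] fr by (simp add: v_def ord_def base_def)
    have d: "arr s1 ''d'' v = back_deg s0 False v" "arr s1 ''d'' (n + v) = back_deg s0 True v"
      using frame_arr[OF f, of "''d''"] fr by (simp_all add: back_deg_def base_def)
    have dn: "back_deg s0 False v \<le> n" "back_deg s0 True v \<le> n" using node_back_deg_le[OF nd v(2)] by auto
    have e: "reg s1 ''e'' + back_deg s0 False v < W" "reg s1 ''g'' + back_deg s0 True v < W"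
      using I' sqW[of "Suc i" False] sqW[of "Suc i" True] i' by (simp_all add: v_def)
    have sS: "(\<Sum>j=a..<Suc i. back_deg s0 c (?o j)) = (\<Sum>j=a..<i. back_deg s0 c (?o j)) + back_deg s0 c v" for c
      using i' by (simp add: v_def)
    have mb: "reg s1 ''mn'' \<le> n" "reg s1 ''mx'' \<le> n"
    proof -
      have mnI: "reg s1 ''mn'' = n \<or> (\<exists>j. a \<le> j \<and> j < i \<and> deg (?o j) = reg s1 ''mn'')"
        and mxI: "reg s1 ''mx'' = 0 \<or> (\<exists>j. a \<le> j \<and> j < i \<and> deg (?o j) = reg s1 ''mx'')"
        using I' by simp_all
      have dj: "deg (?o j) \<le> n" if "a \<le> j" "j < i" for j
        using deg_less[OF on[of j]] that i' by simp
      show "reg s1 ''mn'' \<le> n"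
      proof (cases "reg s1 ''mn'' = n")
        case False
        then have "\<exists>j. a \<le> j \<and> j < i \<and> deg (?o j) = reg s1 ''mn''" using mnI by simp
        then obtain j where "a \<le> j" "j < i" "deg (?o j) = reg s1 ''mn''" by (elim exE conjE)
        then show ?thesis using dj[of j] by simp
      qed simp
      show "reg s1 ''mx'' \<le> n"
      proof (cases "reg s1 ''mx'' = 0")
        case False
        then have "\<exists>j. a \<le> j \<and> j < i \<and> deg (?o j) = reg s1 ''mx''" using mxI by simp
        then obtain j where "a \<le> j" "j < i" "deg (?o j) = reg s1 ''mx''" by (elim exE conjE)
        then show ?thesis using dj[of j] by simp
      qed simp
    qed
    have dv: "deg v < n" by (rule deg_less[OF v(1)])
    have rn: "reg s1 ''n'' = n" by (rule input_n[OF inp1])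
    have upd: "I (Suc i) s2"
      if "reg s2 ''e'' = reg s1 ''e'' + back_deg s0 False v" "reg s2 ''g'' = reg s1 ''g'' + back_deg s0 True v"
        "reg s2 ''mn'' = min (reg s1 ''mn'') (deg v)" "reg s2 ''mx'' = max (reg s1 ''mx'') (deg v)"
      for s2
      unfolding I_def sS
    proof (intro conjI)
      show "reg s2 ''e'' = (\<Sum>j=a..<i. back_deg s0 False (?o j)) + back_deg s0 False v"
        "reg s2 ''g'' = (\<Sum>j=a..<i. back_deg s0 True (?o j)) + back_deg s0 True v" using that I' by auto
      show "\<forall>j. a \<le> j \<and> j < Suc i \<longrightarrow> reg s2 ''mn'' \<le> deg (?o j) \<and> deg (?o j) \<le> reg s2 ''mx''"
      proof (intro allI impI)
        fix j assume j: "a \<le> j \<and> j < Suc i"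
        show "reg s2 ''mn'' \<le> deg (?o j) \<and> deg (?o j) \<le> reg s2 ''mx''"
        proof (cases "j = i")
          case True
          then show ?thesis using that by (simp add: v_def)
        next
          case False
          then have "reg s1 ''mn'' \<le> deg (?o j) \<and> deg (?o j) \<le> reg s1 ''mx''" using I' j by simp
          then show ?thesis using that by auto
        qed
      qed
      show "reg s2 ''mn'' = n \<or> (\<exists>j. a \<le> j \<and> j < Suc i \<and> deg (?o j) = reg s2 ''mn'')"
      proof (cases "reg s1 ''mn'' \<le> deg v")
        case True
        then have "reg s2 ''mn'' = reg s1 ''mn''" using that by simp
        then show ?thesis using I' by (metis less_SucI)
      next
        case False
        then have "deg (?o i) = reg s2 ''mn''" using that by (simp add: v_def)
        then show ?thesis using i' by blast
      qed
      show "reg s2 ''mx'' = 0 \<or> (\<exists>j. a \<le> j \<and> j < Suc i \<and> deg (?o j) = reg s2 ''mx'')"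
      proof (cases "deg v \<le> reg s1 ''mx''")
        case True
        then have "reg s2 ''mx'' = reg s1 ''mx''" using that by simp
        then show ?thesis using I' by (metis less_SucI)
      next
        case False
        then have "deg (?o i) = reg s2 ''mx''" using that by (simp add: v_def)
        then show ?thesis using i' by blast
      qed
    qed
    have "wp W ?p (\<lambda>t s2. t \<le> 35 \<and> reg s2 ''e'' = reg s1 ''e'' + back_deg s0 False v \<and>
      reg s2 ''g'' = reg s1 ''g'' + back_deg s0 True v \<and>
      reg s2 ''mn'' = min (reg s1 ''mn'') (deg v) \<and> reg s2 ''mx'' = max (reg s1 ''mx'') (deg v)) s1"
      using W i(1) i' ab v vo d dn e mb dv rn deg by auto
    then show "wp W ?p (\<lambda>t s'. t \<le> 35 \<and> I (Suc i) (s'\<lparr>reg := (reg s')(''i'' := Suc i)\<rparr>)) s1"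
      by (rule wp_mono) (simp add: upd)
  qed auto
  then show ?thesis
  proof (rule wp_mono, elim conjE)
    fix t s' assume t: "t \<le> (35 + 8) * (reg s ''r'' - reg s ''i'') + 4"
      and I0: "I (reg s ''r'') s'" and f: "frame leaf_sum s s'"
    have I: "I b s'" using I0 r by simp
    note I' = I[unfolded I_def]
    have sX: "(\<Sum>j=a..<b. back_deg s0 c (?o j)) = (\<Sum>v\<in>X. back_deg s0 c v)" for c
      using sum.reindex[OF node_inj[OF nd, of False], of "back_deg s0 c"] node_set[OF nd, of False] by simp
    have ex: "\<exists>j. a \<le> j \<and> j < b \<and> v = ?o j" if "v \<in> X" for v
      using that node_set[OF nd, of False] by fastforce
    have mn: "\<forall>v\<in>X. reg s' ''mn'' \<le> deg v \<and> deg v \<le> reg s' ''mx''" using I' ex by blast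
    have aX: "?o a \<in> X" using oX ab by simp
    \<comment> \<open>The start value \<open>n\<close> exceeds every degree and the part is
      nonempty, so it has been replaced by a real degree.\<close>
    have "reg s' ''mn'' \<noteq> n" using mn aX deg_less[OF on[of a]] ab by fastforce
    then have "\<exists>j. a \<le> j \<and> j < b \<and> deg (?o j) = reg s' ''mn''" using I' by simp
    then obtain j where "a \<le> j" "j < b" "deg (?o j) = reg s' ''mn''" by (elim exE conjE)
    then have mnx: "\<exists>v\<in>X. deg v = reg s' ''mn''" using oX[of j] by (intro bexI)
    have mxx: "\<exists>v\<in>X. deg v = reg s' ''mx''"
    \<comment> \<open>Unlike the start value of the minimum, 0 can be a real degree; in that case it
      is the degree of every vertex of the part.\<close>
    proof (cases "reg s' ''mx'' = 0")
      case True
      then have "deg (?o a) = reg s' ''mx''" using mn aX by fastforce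
      then show ?thesis using aX by blast
    next
      case False
      then have "\<exists>j. a \<le> j \<and> j < b \<and> deg (?o j) = reg s' ''mx''" using I' by simp
      then obtain j where "a \<le> j" "j < b" "deg (?o j) = reg s' ''mx''" by (elim exE conjE)
      then show ?thesis using oX[of j] by (intro bexI)
    qed
    show "t \<le> 43 * (b - a) + 4 \<and>
      reg s' ''e'' = (\<Sum>v\<in>X. back_deg s0 False v) \<and> reg s' ''g'' = (\<Sum>v\<in>X. back_deg s0 True v) \<and>
      reg s' ''e'' < W \<and> reg s' ''g'' < W \<and>
      (\<forall>v\<in>X. reg s' ''mn'' \<le> deg v) \<and> (\<exists>v\<in>X. deg v = reg s' ''mn'') \<and>
      (\<forall>v\<in>X. deg v \<le> reg s' ''mx'') \<and> (\<exists>v\<in>X. deg v = reg s' ''mx'') \<and> frame leaf_sum s s'"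
    proof (intro conjI)
      show "t \<le> 43 * (b - a) + 4" using t r by simp
      show es: "reg s' ''e'' = (\<Sum>v\<in>X. back_deg s0 False v)" "reg s' ''g'' = (\<Sum>v\<in>X. back_deg s0 True v)"
        using I' sX by simp_all
      show "reg s' ''e'' < W" "reg s' ''g'' < W" using es sqW[of b False] sqW[of b True] sX by simp_all
    qed (use mn mnx mxx f in simp_all)
  qed
qed

lemma leaf_put_wp:
  assumes inp: "input s" and fr: "arr s ''o'' = arr s0 ''o''"
    and r: "reg s ''i'' = a" "reg s ''r'' = b" "reg s ''x'' < W" "reg s ''z'' < W"
  shows "wp W leaf_put (\<lambda>t s'. t \<le> 30 * (b - a) + 4 \<and>
    (\<forall>v. arr s' ''label'' v = (if v \<in> X then reg s ''x'' else arr s ''label'' v)) \<and>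
    (\<forall>v\<in>X. arr s' ''answer'' v = (if deg v < reg s ''z'' then 1 else 0)) \<and>
    (\<forall>v. v \<notin> X \<longrightarrow> arr s' ''answer'' v = arr s ''answer'' v) \<and> frame leaf_put s s') s"
proof -
  have ab: "a < b" "b \<le> n" "X \<subseteq> {..<n}" using nd by (auto simp: node_def)
  let ?o = "ord s0 False"
  define I where "I = (\<lambda>i (s' :: state).
    (\<forall>v. arr s' ''label'' v = (if v \<in> ?o ` {a..<i} then reg s ''x'' else arr s ''label'' v)) \<and>
    (\<forall>v. arr s' ''answer'' v = (if v \<in> ?o ` {a..<i} then (if deg v < reg s ''z'' then 1 else 0)
      else arr s ''answer'' v)))"
  have oX: "?o j \<in> X" if "a \<le> j" "j < b" for j using node_set[OF nd, of False] that by auto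
  have "wp W leaf_put (\<lambda>t s'. t \<le> (22 + 8) * (reg s ''r'' - reg s ''i'') + 4 \<and>
    I (reg s ''r'') s' \<and> reg s' ''i'' = reg s ''r'' \<and> frame leaf_put s s') s"
    unfolding leaf_put_def
  proof (rule wp_For)
    show "I (reg s ''i'') s" by (simp add: I_def r)
    show "reg s ''i'' \<le> reg s ''r''" "reg s ''r'' < W" "1 < W" using r ab W by auto
  next
    let ?p = "seqs [
     Assign ''v'' (Get ''o'' (V ''i'')),
     Put ''label'' (V ''v'') (V ''x''),
     If (Less (Minus (Get ''off'' (Plus (V ''v'') (N 1))) (Get ''off'' (V ''v''))) (V ''z''))
       (Put ''answer'' (V ''v'') (N 1))
       (Put ''answer'' (V ''v'') (N 0))]"
    fix s1 i assume I: "I i s1" and f: "frame (For ''i'' ''r'' ?p) s s1"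
      and i: "reg s1 ''i'' = i" "reg s ''i'' \<le> i" "i < reg s ''r''"
    note I' = I[unfolded I_def]
    have i': "a \<le> i" "i < b" using i r by auto
    define v where "v = ?o i"
    have v: "v < n" using oX[OF i'] ab by (auto simp: v_def)
    have inp1: "input s1" by (rule input_frame[OF inp f]) auto
    note deg = input_deg[OF inp1 v]
    have vo: "arr s1 ''o'' i = v"
      using frame_arr[OF f, of "''o''"] fr by (simp add: v_def ord_def base_def)
    have rs: "reg s1 ''x'' = reg s ''x''" "reg s1 ''z'' = reg s ''z''"
      using frame_reg[OF f, of "''x''"] frame_reg[OF f, of "''z''"] by auto
    have img: "?o ` {a..<Suc i} = insert v (?o ` {a..<i})"
      using i' by (simp add: atLeastLessThanSuc v_def)
    have upd: "I (Suc i) s2"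
      if "arr s2 ''label'' = (arr s1 ''label'')(v := reg s ''x'')"
        "arr s2 ''answer'' = (arr s1 ''answer'')(v := if deg v < reg s ''z'' then 1 else 0)" for s2
      unfolding I_def img using I' that by auto
    have "wp W ?p (\<lambda>t s2. t \<le> 22 \<and> arr s2 ''label'' = (arr s1 ''label'')(v := reg s ''x'') \<and>
      arr s2 ''answer'' = (arr s1 ''answer'')(v := if deg v < reg s ''z'' then 1 else 0)) s1"
      using W i(1) i' ab v vo rs deg r(3,4) by auto
    then show "wp W ?p (\<lambda>t s'. t \<le> 22 \<and> I (Suc i) (s'\<lparr>reg := (reg s')(''i'' := Suc i)\<rparr>)) s1"
      by (rule wp_mono) (simp add: upd)
  qed auto
  then show ?thesis
    by (rule wp_mono) (use node_set[OF nd, of False] in \<open>simp add: I_def r\<close>)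
qed

lemma leaf_wp:
  assumes inp: "input s0" and r: "reg s0 ''l'' = a" "reg s0 ''r'' = b"
    and k: "reg s0 ''k'' \<le> n" and y: "reg s0 ''y'' = f" "f \<le> 1"
    and inf: "node_info X f" and cF: "conn (rel G False) X" and cT: "conn (rel G True) X"
  shows "wp W leaf (\<lambda>t s. t \<le> 150 * (b - a) \<and>
    leaf_result X s0 s \<and>
    frame leaf s0 s) s0"
proof -
  have ab: "a < b" "b \<le> n" "X \<subseteq> {..<n}" using nd by (auto simp: node_def)
  have X: "X \<subseteq> verts G" using ab verts_eq by simp
  have cX: "card X = b - a" by (rule node_card[OF nd])
  have rn: "reg s0 ''n'' = n" by (rule input_n[OF inp])
  define s1 where "s1 = s0\<lparr>reg := (reg s0)(''e'' := 0, ''g'' := 0, ''mn'' := n, ''mx'' := 0,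
    ''i'' := a)\<rparr>"
  let ?p1 = "seqs [
       Assign ''e'' (N 0),
       Assign ''g'' (N 0),
       Assign ''mn'' (V ''n''),
       Assign ''mx'' (N 0),
       Assign ''i'' (V ''l'')]"
  have inp1: "input s1" using inp by (simp add: input_def s1_def)
  have w1: "wp W ?p1 (\<lambda>t s. t = 10 \<and> s = s1) s0"
    using W r ab rn by (simp add: s1_def)
  have w2: "wp W leaf_sum (\<lambda>t s'. t \<le> 43 * (b - a) + 4 \<and>
    reg s' ''e'' = (\<Sum>v\<in>X. back_deg s0 False v) \<and> reg s' ''g'' = (\<Sum>v\<in>X. back_deg s0 True v) \<and>
    reg s' ''e'' < W \<and> reg s' ''g'' < W \<and>
    (\<forall>v\<in>X. reg s' ''mn'' \<le> deg v) \<and> (\<exists>v\<in>X. deg v = reg s' ''mn'') \<and>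
    (\<forall>v\<in>X. deg v \<le> reg s' ''mx'') \<and> (\<exists>v\<in>X. deg v = reg s' ''mx'') \<and>
    frame leaf_sum s1 s') s1"
    by (rule leaf_sum_wp[OF inp1]) (use r in \<open>auto simp: s1_def\<close>)
  have arcs: "2 * (\<Sum>v\<in>X. back_deg s0 c v) = card (arcs (rel G c) X)" for c
    by (rule search_order_sum[OF node_order[OF nd] symp_rel rel_irrefl])
  have "wp W leaf (\<lambda>t s. t \<le> 150 * (b - a) \<and>
    leaf_result X s0 s) s0"
    unfolding leaf_def
  proof (rule wp_seqs[OF w1], elim conjE, simp only:, rule wp_seqs[OF w2], elim conjE)
    fix t2 s2
    assume t2: "t2 \<le> 43 * (b - a) + 4"
      and e: "reg s2 ''e'' = (\<Sum>v\<in>X. back_deg s0 False v)" "reg s2 ''e'' < W"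
      and g: "reg s2 ''g'' = (\<Sum>v\<in>X. back_deg s0 True v)" "reg s2 ''g'' < W"
      and mn: "\<forall>v\<in>X. reg s2 ''mn'' \<le> deg v" "\<exists>v\<in>X. deg v = reg s2 ''mn''"
      and mx: "\<forall>v\<in>X. deg v \<le> reg s2 ''mx''" "\<exists>v\<in>X. deg v = reg s2 ''mx''"
      and f2: "frame leaf_sum s1 s2"
    have inp2: "input s2" by (rule input_frame[OF inp1 f2]) (auto simp: leaf_sum_def)
    have r2: "reg s2 ''l'' = a" "reg s2 ''r'' = b" "reg s2 ''k'' = reg s0 ''k''" "reg s2 ''y'' = f"
      using f2 r y by (simp_all add: frame_def leaf_sum_def s1_def)
    have a2: "arr s2 = arr s0" using f2 by (simp add: frame_def leaf_sum_def s1_def fun_eq_iff)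
    have mb: "reg s2 ''mn'' < n" "reg s2 ''mx'' < n"
      using mn(2) mx(2) deg_less ab(3) by (metis lessThan_iff subsetD)+
    define coll where "coll \<longleftrightarrow> b - a \<le> reg s2 ''e'' \<and> b - a \<le> reg s2 ''g''"
    define k' where "k' = (if coll then Suc (reg s0 ''k'') else reg s0 ''k'')"
    define x where "x = (if coll then k' else 0)"
    define z where "z = (if reg s2 ''e'' < b - a then (if f = 0 \<and> b - a = 1 then 0 else reg s2 ''mn'' + 1)
      else if coll then 0 else reg s2 ''mx'')"
    have w3: "wp W leaf_decide (\<lambda>t s. t \<le> 40 \<and> input s \<and> arr s = arr s0 \<and>
        reg s ''i'' = a \<and> reg s ''r'' = b \<and>
        reg s ''x'' = x \<and> reg s ''z'' = z \<and> reg s ''k'' = k') s2"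
      unfolding leaf_decide_def
      using W r2 a2 e(2) g(2) mb k y ab inp2
      by (auto simp: input_def x_def z_def k'_def coll_def)
    have xz: "x < W" "z < W" using W k mb by (auto simp: x_def z_def k'_def)
    have res: "(if coll then good X else
        (\<forall>v\<in>X. (if deg v < z then 1 else 0 :: nat) = (if v \<in> avoidable_set G then 1 else 0)))"
    proof -
      \<comment> \<open>The machine compares edges with vertices, the lemmas compare arcs with twice
        the vertices.\<close>
      have eX: "reg s2 ''e'' < b - a \<longleftrightarrow> card (arcs (rel G False) X) < 2 * card X"
        "reg s2 ''g'' < b - a \<longleftrightarrow> card (arcs (rel G True) X) < 2 * card X"
        using arcs[of False] arcs[of True] e(1) g(1) cX by linarith+
      show ?thesis
      proof (cases coll)
        case True
        then show ?thesis using leaf_good[OF inf X cF cT] eX by (auto simp: coll_def)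
      next
        case False
        have "deg v < z \<longleftrightarrow> avoidable G v" if v: "v \<in> X" for v
        proof (cases "2 \<le> card X")
          case True
          then have b1: "b - a \<noteq> 1" using cX by simp
          show ?thesis
          proof (cases "reg s2 ''e'' < b - a")
            case e: True
            then show ?thesis
              using leaf_tree[OF inf X cF cT True _ v, of "reg s2 ''mn''"] mn eX b1 by (auto simp: z_def)
          next
            case e: False
            then have "reg s2 ''g'' < b - a" using \<open>\<not> coll\<close> by (simp add: coll_def)
            then show ?thesis
              using leaf_co_tree[OF inf X cF cT True _ v, of "reg s2 ''mx''"] mx eX e \<open>\<not> coll\<close>
              by (auto simp: z_def)
          qed
        next
          case c1: False
          then obtain u where "X = {u}" using leaf_card[OF inf X cF cT] by blast
          then have Xv: "X = {v}" using v by simp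
          \<comment> \<open>A single vertex has no edge, so it always takes the branch for trees,
            where the flag is inspected.\<close>
          have "reg s2 ''e'' < b - a" using eX(1) Xv card_arcs_singleton[of False v] by simp
          moreover have "b - a = 1" using cX Xv by simp
          moreover have "deg v = reg s2 ''mn''" using mn(2) Xv by simp
          ultimately show ?thesis using leaf_single[OF inf X cF cT Xv] y(2) by (auto simp: z_def)
        qed
        then show ?thesis using False by (simp add: avoidable_set_def)
      qed
    qed
    show "wp W (seqs [leaf_decide, leaf_put]) (\<lambda>t' s. 10 + (t2 + t') \<le> 150 * (b - a) \<and>
      leaf_result X s0 s) s2"
    proof (rule wp_seqs[OF w3], elim conjE, rule wp_seqs_single)
      fix t3 :: nat and s3 assume t3: "t3 \<le> 40" and inp3: "input s3" and a3: "arr s3 = arr s0"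
        and r3: "reg s3 ''i'' = a" "reg s3 ''r'' = b" "reg s3 ''x'' = x" "reg s3 ''z'' = z"
          "reg s3 ''k'' = k'"
      have w4: "wp W leaf_put (\<lambda>t s'. t \<le> 30 * (b - a) + 4 \<and>
        (\<forall>v. arr s' ''label'' v = (if v \<in> X then reg s3 ''x'' else arr s3 ''label'' v)) \<and>
        (\<forall>v\<in>X. arr s' ''answer'' v = (if deg v < reg s3 ''z'' then 1 else 0)) \<and>
        (\<forall>v. v \<notin> X \<longrightarrow> arr s' ''answer'' v = arr s3 ''answer'' v) \<and> frame leaf_put s3 s') s3"
        by (rule leaf_put_wp[OF inp3]) (use a3 r3 xz in auto)
      then show "wp W leaf_put (\<lambda>t' s. 10 + (t2 + (t3 + t')) \<le> 150 * (b - a) \<and>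
        leaf_result X s0 s) s3"
      proof (rule wp_mono, elim conjE)
        fix t4 s4 assume t4: "t4 \<le> 30 * (b - a) + 4"
          and l4: "\<forall>v. arr s4 ''label'' v = (if v \<in> X then reg s3 ''x'' else arr s3 ''label'' v)"
          and w4: "\<forall>v\<in>X. arr s4 ''answer'' v = (if deg v < reg s3 ''z'' then 1 else 0)"
            "\<forall>v. v \<notin> X \<longrightarrow> arr s4 ''answer'' v = arr s3 ''answer'' v"
          and f4: "frame leaf_put s3 s4"
        have "reg s4 ''k'' = k'" using f4 r3 by (simp add: frame_def leaf_put_def)
        moreover have "10 + (t2 + (t3 + t4)) \<le> 150 * (b - a)" using t2 t3 t4 ab by linarith
        ultimately show "10 + (t2 + (t3 + t4)) \<le> 150 * (b - a) \<and>
          leaf_result X s0 s4"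
          using l4 w4 a3 r3 res by (cases coll) (simp_all add: leaf_result_def x_def k'_def decides_at_def)
      qed
    qed
  qed
  then show ?thesis by (rule wp_mono[OF wp_frame]) simp
qed

end

end

section \<open>The main loop\<close>

text \<open>\<open>y\<close> saves the flag before \<open>split\<close> overwrites it: an
  unsplittable node passes through \<open>split\<close> as well, and for a single vertex the old
  flag is the answer. The node was not split exactly if its first part still ends at
  \<open>r\<close>.\<close>

definition main_step :: com where
  "main_step = seqs [
     Assign ''y'' (Get ''fl'' (V ''l'')),
     split,
     If (Eq (Get ''en'' (V ''l'')) (V ''r''))
       (seqs [leaf, Assign ''l'' (V ''r'')])
       SKIP]"

definition main_init :: com where
  "main_init = seqs [
     Put ''en'' (N 0) (V ''n''),
     Put ''ty'' (N 0) (N 0),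
     Put ''fl'' (N 0) (N 1),
     Assign ''l'' (N 0)]"

text \<open>The split before the loop produces the components. From then on every node is connected
  for the relation opposite to its type, so a node that its own relation does not split is connected
  and co-connected. For \<open>n = 0\<close> the offsets of the two halves would coincide, and
  nothing is run.\<close>

definition algorithm :: com where
  "algorithm = If (Less (N 0) (V ''n''))
     (seqs [
       Assign ''b'' (N 0),
       search,
       Assign ''b'' (V ''n''),
       search,
       main_init,
       split,
       While (Less (V ''l'') (V ''n'')) main_step])
     SKIP"

section \<open>Invariants of the main loop\<close>

context graph_input
begin

text \<open>\<open>B\<close> contains the starts of the pending nodes. Their intervals follow each
  other without gaps from \<open>l\<close> to \<open>n\<close>, so the position \<open>l\<close>
  replaces a stack.\<close>

definition tree_inv :: "state \<Rightarrow> nat \<Rightarrow> nat set \<Rightarrow> (nat \<Rightarrow> nat set) \<Rightarrow> bool" where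
  "tree_inv s l B P \<longleftrightarrow> B \<subseteq> {l..<n} \<and> l \<le> n \<and> (l < n \<longrightarrow> l \<in> B) \<and>
     (\<forall>a\<in>B. node s a (arr s ''en'' a) (P a) \<and> node_info (P a) (arr s ''fl'' a) \<and>
       arr s ''fl'' a \<le> 1 \<and> (\<exists>c. arr s ''ty'' a = base c) \<and>
       (arr s ''en'' a = n \<or> arr s ''en'' a \<in> B)) \<and>
     (\<forall>a\<in>B. \<forall>a'\<in>B. a < a' \<longrightarrow> arr s ''en'' a \<le> a') \<and>
     (\<forall>a\<in>B. \<forall>a'\<in>B. a \<noteq> a' \<longrightarrow> P a \<inter> P a' = {})"

text \<open>Kept apart from \<open>tree_inv\<close> because it can fail for the root: before the
  first split the whole graph has type \<open>False\<close>, and it may have a disconnected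
  complement.\<close>

definition conn_inv :: "state \<Rightarrow> nat set \<Rightarrow> (nat \<Rightarrow> nat set) \<Rightarrow> bool" where
  "conn_inv s B P \<longleftrightarrow> (\<forall>a\<in>B. \<forall>c. arr s ''ty'' a = base c \<longrightarrow> conn (rel G (\<not> c)) (P a))"

text \<open>Splitting \<^term>\<open>X\<close> into co-components loses at least \<^term>\<open>card X\<close> arcs, which pays for the
  larger factor of the parts.\<close>

definition weight :: "bool \<Rightarrow> nat set \<Rightarrow> nat" where
  "weight c X = 400 * (2 * card (arcs E X) + (if c then 1 else 2) * card X)"

definition pot :: "state \<Rightarrow> nat set \<Rightarrow> (nat \<Rightarrow> nat set) \<Rightarrow> nat" where
  "pot s B P = (\<Sum>a\<in>B. weight (arr s ''ty'' a \<noteq> 0) (P a))"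

text \<open>\<open>U\<close> contains the vertices of pending nodes. The bound \<open>k\<close> on
  all labels keeps the next label fresh, and label 0 outside \<open>U\<close> means that the vertex
  has been decided.\<close>

definition result_inv :: "state \<Rightarrow> nat set \<Rightarrow> bool" where
  "result_inv s U \<longleftrightarrow> (\<forall>v\<in>U. arr s ''label'' v = 0) \<and>
     (\<forall>v\<in>verts G - U. arr s ''label'' v \<le> reg s ''k'' \<and>
       (arr s ''label'' v = 0 \<longrightarrow> decides_at s v (v \<in> avoidable_set G))) \<and>
     (\<forall>i\<in>{1..reg s ''k''}. good {v \<in> verts G. arr s ''label'' v = i})"

lemma node_cong:
  assumes "node s a b X" "\<And>c i. a \<le> i \<Longrightarrow> i < b \<Longrightarrow> ord s' c i = ord s c i"
    "\<And>c v. v \<in> X \<Longrightarrow> back_deg s' c v = back_deg s c v"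
  shows "node s' a b X"
proof -
  have "segment s' c a b = segment s c a b" for c unfolding segment_def using assms(2) by auto
  moreover have "search_order (rel G c) X (segment s c a b) (back_deg s' c)" for c
    by (rule search_order_cong[of _ _ _ "back_deg s c"]) (use assms(1,3) in \<open>auto simp: node_def\<close>)
  ultimately show ?thesis using assms(1) by (simp add: node_def)
qed

lemma node_arr_cong:
  assumes "arr s' = arr s"
  shows "node s' = node s"
proof -
  have "ord s' = ord s" "back_deg s' = back_deg s" using assms by (simp_all add: ord_def back_deg_def fun_eq_iff)
  then show ?thesis by (intro ext) (simp add: node_def segment_def)
qed

lemma tree_inv_arr_cong: "arr s' = arr s \<Longrightarrow> tree_inv s' = tree_inv s"
  using node_arr_cong[of s' s] by (simp add: tree_inv_def fun_eq_iff)

lemma conn_inv_arr_cong: "arr s' = arr s \<Longrightarrow> conn_inv s' = conn_inv s"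
  by (simp add: conn_inv_def fun_eq_iff)

section \<open>Effect of one split on the invariants\<close>

context
  fixes s s' :: state and l :: nat and B St :: "nat set" and P Q :: "nat \<Rightarrow> nat set" and c :: bool
  assumes n0: "0 < n" and tr: "tree_inv s l B P" and lB: "l \<in> B"
    and ty: "arr s ''ty'' l = base c"
    and sp: "split_result s l (arr s ''en'' l) (P l) s' c St Q"
begin

lemma base_inject: "base c1 = base c2 \<longleftrightarrow> c1 = c2"
  using n0 by (auto simp: base_def)

lemma node_l: "node s l (arr s ''en'' l) (P l)"
  using tr lB by (simp add: tree_inv_def)

lemmas sp' = sp[unfolded split_result_def[OF node_l]]

lemma l_bounds: "l < arr s ''en'' l" "arr s ''en'' l \<le> n" "P l \<subseteq> {..<n}"
  using node_l by (auto simp: node_def)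

lemma finite_St: "finite St"
proof -
  have "St \<subseteq> {l..<arr s ''en'' l}" using sp' by simp
  then show ?thesis by (rule finite_subset) simp
qed

lemma other_bounds:
  assumes "a \<in> B" "a \<noteq> l"
  shows "arr s ''en'' l \<le> a" "a < arr s ''en'' a" "arr s ''en'' a \<le> n" "P a \<inter> P l = {}" "P a \<subseteq> {..<n}"
proof -
  have "l < a" using assms tr by (auto simp: tree_inv_def)
  then show "arr s ''en'' l \<le> a" using tr lB assms(1) unfolding tree_inv_def by blast
  have "node s a (arr s ''en'' a) (P a)" using tr assms(1) by (simp add: tree_inv_def)
  then show "a < arr s ''en'' a" "arr s ''en'' a \<le> n" "P a \<subseteq> {..<n}" by (auto simp: node_def)
  show "P a \<inter> P l = {}" using tr lB assms unfolding tree_inv_def by blast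
qed

text \<open>The other pending nodes occupy other positions and other vertices, and
  \<open>split\<close> leaves both alone.\<close>

lemma other_same:
  assumes "a \<in> B" "a \<noteq> l"
  shows "arr s' ''en'' a = arr s ''en'' a" "arr s' ''ty'' a = arr s ''ty'' a"
    "arr s' ''fl'' a = arr s ''fl'' a" "node s' a (arr s' ''en'' a) (P a)"
proof -
  note ob = other_bounds[OF assms]
  show en: "arr s' ''en'' a = arr s ''en'' a" and "arr s' ''ty'' a = arr s ''ty'' a"
    "arr s' ''fl'' a = arr s ''fl'' a" using sp' ob(1) by simp_all
  show "node s' a (arr s' ''en'' a) (P a)" unfolding en
  proof (rule node_cong[of s])
    show "node s a (arr s ''en'' a) (P a)" using tr assms(1) by (simp add: tree_inv_def)
    have o: "\<forall>c i. (i < l \<or> arr s ''en'' l \<le> i) \<and> i < n \<longrightarrow> ord s' c i = ord s c i"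
      and d: "\<forall>c v. v \<notin> P l \<and> v < n \<longrightarrow> back_deg s' c v = back_deg s c v" using sp' by simp_all
    show "ord s' c i = ord s c i" if "a \<le> i" "i < arr s ''en'' a" for c i
      using o ob that by simp
    show "back_deg s' c v = back_deg s c v" if "v \<in> P a" for c v
    proof -
      have "v \<notin> P l" "v < n" using ob(4,5) that by auto
      then show ?thesis using d by simp
    qed
  qed
qed

lemma other_notin_St:
  assumes "a \<in> B" "a \<noteq> l"
  shows "a \<notin> St"
proof -
  have "St \<subseteq> {l..<arr s ''en'' l}" using sp' by simp
  then show ?thesis using other_bounds(1)[OF assms] by auto
qed

lemma parts:
  assumes "k \<in> St"
  shows "node s' k (arr s' ''en'' k) (Q k)" "arr s' ''en'' k \<le> arr s ''en'' l"
    "arr s' ''ty'' k = base (\<not> c)" "conn (rel G c) (Q k)"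
    "\<And>x y. x \<in> Q k \<Longrightarrow> y \<in> P l - Q k \<Longrightarrow> \<not> rel G c x y"
    "arr s' ''en'' k = arr s ''en'' l \<or> arr s' ''en'' k \<in> St"
    "\<And>k'. k' \<in> St \<Longrightarrow> k < k' \<Longrightarrow> arr s' ''en'' k \<le> k'"
    "arr s' ''fl'' k = (if \<not> c \<or> card St = arr s ''en'' l - l then 1 else 0)"
    "\<And>k'. k' \<in> St \<Longrightarrow> k \<noteq> k' \<Longrightarrow> Q k \<inter> Q k' = {}"
    "l \<le> k" "k < arr s ''en'' l" "Q k \<subseteq> P l"
proof -
  have 1: "node s' k (arr s' ''en'' k) (Q k) \<and> arr s' ''en'' k \<le> arr s ''en'' l \<and>
    arr s' ''ty'' k = base (\<not> c) \<and> conn (rel G c) (Q k) \<and>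
       (\<forall>x\<in>Q k. \<forall>y\<in>P l - Q k. \<not> rel G c x y) \<and>
       (arr s' ''en'' k = arr s ''en'' l \<or> arr s' ''en'' k \<in> St) \<and>
       (\<forall>k'\<in>St. k < k' \<longrightarrow> arr s' ''en'' k \<le> k') \<and>
       arr s' ''fl'' k = (if \<not> c \<or> card St = arr s ''en'' l - l then 1 else 0)"
    using sp' assms by simp
  have 2: "\<forall>k\<in>St. \<forall>k'\<in>St. k \<noteq> k' \<longrightarrow> Q k \<inter> Q k' = {}" "St \<subseteq> {l..<arr s ''en'' l}"
    "(\<Union>k\<in>St. Q k) = P l" using sp' by simp_all
  show "node s' k (arr s' ''en'' k) (Q k)" "arr s' ''en'' k \<le> arr s ''en'' l"
    "arr s' ''ty'' k = base (\<not> c)" "conn (rel G c) (Q k)"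
    "\<And>x y. x \<in> Q k \<Longrightarrow> y \<in> P l - Q k \<Longrightarrow> \<not> rel G c x y"
    "arr s' ''en'' k = arr s ''en'' l \<or> arr s' ''en'' k \<in> St"
    "\<And>k'. k' \<in> St \<Longrightarrow> k < k' \<Longrightarrow> arr s' ''en'' k \<le> k'"
    "arr s' ''fl'' k = (if \<not> c \<or> card St = arr s ''en'' l - l then 1 else 0)"
    using 1 by simp_all
  show "\<And>k'. k' \<in> St \<Longrightarrow> k \<noteq> k' \<Longrightarrow> Q k \<inter> Q k' = {}" using 2 assms by blast
  show "l \<le> k" "k < arr s ''en'' l" using 2 assms by auto
  show "Q k \<subseteq> P l" using 2 assms by blast
qed

lemma union_Q: "(\<Union>k\<in>St. Q k) = P l" and l_in_St: "l \<in> St"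
  using sp' by simp_all

lemma dis_Q: "k \<in> St \<Longrightarrow> k' \<in> St \<Longrightarrow> k \<noteq> k' \<Longrightarrow> Q k \<inter> Q k' = {}"
  using parts(9) by blast

lemma finite_Pl: "finite (P l)"
  using l_bounds(3) finite_subset by blast

lemma card_Pl: "card (P l) = arr s ''en'' l - l"
  by (rule node_card[OF node_l])

text \<open>The hypothesis excludes the one case in which the old flag is indispensable, a single
  vertex with flag 0.\<close>

lemma tree_inv_split:
  assumes "2 \<le> card (P l) \<or> arr s ''fl'' l = 1"
  shows "tree_inv s' l ((B - {l}) \<union> St) (\<lambda>k. if k \<in> St then Q k else P k)"
proof -
  let ?P = "\<lambda>k. if k \<in> St then Q k else P k"
  have Bsub: "B \<subseteq> {l..<n}" using tr by (simp add: tree_inv_def)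
  have info: "node_info (P l) (arr s ''fl'' l)" using tr lB by (simp add: tree_inv_def)
  have Pl: "P l \<subseteq> verts G" using l_bounds(3) verts_eq by simp
  have infk: "node_info (Q k) (arr s' ''fl'' k)" if k: "k \<in> St" for k
    by (rule node_info_part[OF info assms Pl finite_St union_Q dis_Q parts(4) parts(5) k])
      (use parts(8)[OF k] card_Pl in auto)
  have enB: "arr s ''en'' a = n \<or> arr s ''en'' a \<in> B" if "a \<in> B" for a
    using tr that by (simp add: tree_inv_def)
  have enl: "arr s ''en'' l = n \<or> arr s ''en'' l \<in> B - {l}" using enB[OF lB] l_bounds by auto
  show ?thesis unfolding tree_inv_def
  proof (intro conjI ballI impI)
    show "B - {l} \<union> St \<subseteq> {l..<n}" using Bsub parts(10,11) l_bounds(2) by fastforce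
    show "l \<le> n" using l_bounds by simp
    show "l \<in> B - {l} \<union> St" using l_in_St by simp
  next
    fix a assume a: "a \<in> B - {l} \<union> St"
    have "node s' a (arr s' ''en'' a) (?P a) \<and> node_info (?P a) (arr s' ''fl'' a) \<and>
       arr s' ''fl'' a \<le> 1 \<and> (\<exists>c. arr s' ''ty'' a = base c) \<and>
       (arr s' ''en'' a = n \<or> arr s' ''en'' a \<in> B - {l} \<union> St)"
    proof (cases "a \<in> St")
      case True
      have "arr s' ''en'' a = n \<or> arr s' ''en'' a \<in> B - {l} \<union> St"
        using parts(6)[OF True] enl by auto
      then show ?thesis using True parts(1,3,8)[OF True] infk[OF True] by auto
    next
      case False
      then have aB: "a \<in> B" "a \<noteq> l" using a by auto
      have "arr s ''en'' a \<noteq> l" using other_bounds[OF aB] l_bounds by linarith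
      moreover have "node_info (P a) (arr s ''fl'' a)" "arr s ''fl'' a \<le> 1"
        "\<exists>c. arr s ''ty'' a = base c" using tr aB by (simp_all add: tree_inv_def)
      ultimately show ?thesis using other_same[OF aB] enB[OF aB(1)] False by auto
    qed
    then show "node s' a (arr s' ''en'' a) (?P a)" "node_info (?P a) (arr s' ''fl'' a)"
       "arr s' ''fl'' a \<le> 1" "\<exists>c. arr s' ''ty'' a = base c"
       "arr s' ''en'' a = n \<or> arr s' ''en'' a \<in> B - {l} \<union> St" by blast+
  next
    fix a a' assume a: "a \<in> B - {l} \<union> St" and a': "a' \<in> B - {l} \<union> St" and lt: "a < a'"
    show "arr s' ''en'' a \<le> a'"
    proof (cases "a \<in> St")
      case True
      show ?thesis
      proof (cases "a' \<in> St")
        case True2: True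
        then show ?thesis using parts(7)[OF True True2 lt] by simp
      next
        case False
        then have "arr s ''en'' l \<le> a'" using a' other_bounds(1) by blast
        then show ?thesis using parts(2)[OF True] by linarith
      qed
    next
      case False
      then have aB: "a \<in> B" "a \<noteq> l" using a by auto
      have "a' \<notin> St" using parts(11)[of a'] other_bounds(1)[OF aB] lt by fastforce
      then have "a' \<in> B" using a' by simp
      then have "arr s ''en'' a \<le> a'" using tr aB lt unfolding tree_inv_def by blast
      then show ?thesis using other_same(1)[OF aB] by simp
    qed
  next
    fix a a' assume a: "a \<in> B - {l} \<union> St" and a': "a' \<in> B - {l} \<union> St" and ne: "a \<noteq> a'"
    have *: "Q a1 \<inter> P a2 = {}" if "a1 \<in> St" "a2 \<in> B - {l} \<union> St" "a2 \<notin> St" for a1 a2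
      using parts(12)[OF that(1)] other_bounds(4)[of a2] that by blast
    show "?P a \<inter> ?P a' = {}"
    proof (cases "a \<in> St"; cases "a' \<in> St")
      assume "a \<in> St" "a' \<in> St"
      then show ?thesis using dis_Q ne by simp
    next
      assume "a \<in> St" "a' \<notin> St"
      then show ?thesis using *[of a a'] a' by simp
    next
      assume "a \<notin> St" "a' \<in> St"
      then show ?thesis using *[of a' a] a by auto
    next
      assume "a \<notin> St" "a' \<notin> St"
      moreover have "\<forall>a\<in>B. \<forall>a'\<in>B. a \<noteq> a' \<longrightarrow> P a \<inter> P a' = {}" using tr by (simp add: tree_inv_def)
      ultimately show ?thesis using a a' ne by simp
    qed
  qed
qed

lemma conn_inv_split:
  assumes "conn_inv s (B - {l}) P"
  shows "conn_inv s' ((B - {l}) \<union> St) (\<lambda>k. if k \<in> St then Q k else P k)"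
  unfolding conn_inv_def
proof (intro ballI allI impI)
  fix a c' assume a: "a \<in> B - {l} \<union> St" and t: "arr s' ''ty'' a = base c'"
  show "conn (rel G (\<not> c')) (if a \<in> St then Q a else P a)"
  proof (cases "a \<in> St")
    case True
    then have "c' = (\<not> c)" using parts(3)[OF True] t base_inject by simp
    then show ?thesis using parts(4)[OF True] True by simp
  next
    case False
    then have aB: "a \<in> B" "a \<noteq> l" using a by auto
    then show ?thesis using assms other_same(2)[OF aB] t False by (simp add: conn_inv_def)
  qed
qed

lemma union_split: "(\<Union>k\<in>(B - {l}) \<union> St. if k \<in> St then Q k else P k) = (\<Union>a\<in>B. P a)"
proof -
  have "(\<Union>k\<in>(B - {l}) \<union> St. if k \<in> St then Q k else P k) =
      (\<Union>k\<in>B - {l}. if k \<in> St then Q k else P k) \<union> (\<Union>k\<in>St. Q k)" by auto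
  also have "(\<Union>k\<in>B - {l}. if k \<in> St then Q k else P k) = (\<Union>k\<in>B - {l}. P k)"
    using other_notin_St by auto
  finally show ?thesis using union_Q lB by auto
qed

text \<open>A component split lowers the size factor from 2 to 1. A proper co-component split raises
  it from 1 to 2 but loses at least \<open>card X\<close> arcs, each counted twice. Either way 400
  per vertex is set free.\<close>

lemma pot_split:
  assumes "\<not> c \<or> St \<noteq> {l}"
  shows "pot s' ((B - {l}) \<union> St) (\<lambda>k. if k \<in> St then Q k else P k) + 400 * (arr s ''en'' l - l)
    \<le> pot s B P"
proof -
  let ?X = "P l"
  have fB: "finite B" using tr finite_subset unfolding tree_inv_def by blast
  have t0: "base c' \<noteq> 0 \<longleftrightarrow> c'" for c' using n0 by (auto simp: base_def)
  have "pot s' ((B - {l}) \<union> St) (\<lambda>k. if k \<in> St then Q k else P k) =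
      (\<Sum>a\<in>B - {l}. weight (arr s' ''ty'' a \<noteq> 0) (if a \<in> St then Q a else P a)) +
      (\<Sum>a\<in>St. weight (arr s' ''ty'' a \<noteq> 0) (if a \<in> St then Q a else P a))"
    unfolding pot_def by (rule sum.union_disjoint) (use fB finite_St other_notin_St in auto)
  also have "(\<Sum>a\<in>B - {l}. weight (arr s' ''ty'' a \<noteq> 0) (if a \<in> St then Q a else P a)) =
      (\<Sum>a\<in>B - {l}. weight (arr s ''ty'' a \<noteq> 0) (P a))"
    by (rule sum.cong) (use other_same(2) other_notin_St in auto)
  also have "(\<Sum>a\<in>St. weight (arr s' ''ty'' a \<noteq> 0) (if a \<in> St then Q a else P a)) =
      (\<Sum>a\<in>St. weight (\<not> c) (Q a))"
    by (rule sum.cong) (use parts(3) t0 in auto)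
  finally have p1: "pot s' ((B - {l}) \<union> St) (\<lambda>k. if k \<in> St then Q k else P k) =
      (\<Sum>a\<in>B - {l}. weight (arr s ''ty'' a \<noteq> 0) (P a)) + (\<Sum>a\<in>St. weight (\<not> c) (Q a))" .
  have p2: "pot s B P = weight c ?X + (\<Sum>a\<in>B - {l}. weight (arr s ''ty'' a \<noteq> 0) (P a))"
    unfolding pot_def
    using sum.remove[OF fB lB, of "\<lambda>a. weight (arr s ''ty'' a \<noteq> 0) (P a)"] ty t0 by simp
  have sc: "(\<Sum>a\<in>St. card (Q a)) = card ?X"
    by (rule sum_card_parts[OF finite_St finite_Pl union_Q dis_Q])
  have w: "(\<Sum>a\<in>St. weight (\<not> c) (Q a)) =
      400 * (2 * (\<Sum>a\<in>St. card (arcs E (Q a))) + (if \<not> c then 1 else 2) * card ?X)"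
    unfolding weight_def sum_distrib_left[symmetric] sum.distrib sc[symmetric] ..
  have "(\<Sum>a\<in>St. weight (\<not> c) (Q a)) + 400 * card ?X \<le> weight c ?X"
  proof (cases c)
    case False
    have "(\<Sum>a\<in>St. card (arcs E (Q a))) \<le> card (arcs E ?X)"
      by (rule sum_arcs_le[OF finite_St finite_Pl union_Q dis_Q])
    then show ?thesis unfolding w using False by (simp add: weight_def)
  next
    case True
    then obtain k where k: "k \<in> St" "k \<noteq> l" using assms l_in_St by blast
    have ne: "Q a \<noteq> {}" if "a \<in> St" for a using parts(4)[OF that] by (simp add: conn_def)
    have "(\<Sum>a\<in>St. card (arcs E (Q a))) + card ?X \<le> card (arcs E ?X)"
    proof (rule sum_arcs_join[OF finite_St finite_Pl union_Q dis_Q k(1) l_in_St k(2) ne[OF k(1)]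
          ne[OF l_in_St]])
      fix a u v assume a: "a \<in> St" and u: "u \<in> Q a" and v: "v \<in> P l - Q a"
      have "\<not> rel G True u v" using parts(5)[OF a u v] True by simp
      moreover have "u \<in> verts G" "v \<in> verts G" "u \<noteq> v"
        using u v parts(12)[OF a] l_bounds(3) verts_eq by auto
      ultimately show "E u v" using rel_True_iff[of u G v] by simp
    qed
    then show ?thesis unfolding w using True by (simp add: weight_def)
  qed
  then show ?thesis using p1 p2 card_Pl by linarith
qed

text \<open>Together with \<open>several_parts\<close> this justifies looking only at the end of the
  first part: any further part would have to start before the end of the node.\<close>

lemma single_part:
  assumes "arr s' ''en'' l = arr s ''en'' l"
  shows "St = {l}" "Q l = P l"
proof -
  have "k = l" if k: "k \<in> St" for k
  proof (rule ccontr)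
    assume "k \<noteq> l"
    then have "l < k" using parts(10)[OF k] by simp
    then have "arr s' ''en'' l \<le> k" using parts(7)[OF l_in_St k] by simp
    then show False using parts(11)[OF k] assms by simp
  qed
  then show "St = {l}" using l_in_St by blast
  then show "Q l = P l" using union_Q by simp
qed

lemma several_parts:
  assumes "arr s' ''en'' l \<noteq> arr s ''en'' l"
  shows "St \<noteq> {l}"
proof -
  have "arr s' ''en'' l \<in> St" using parts(6)[OF l_in_St] assms by simp
  moreover have "l < arr s' ''en'' l" using parts(1)[OF l_in_St] by (simp add: node_def)
  ultimately show ?thesis by auto
qed

lemma tree_inv_drop: "tree_inv s' (arr s ''en'' l) (B - {l}) P"
proof -
  have enB: "\<And>a. a \<in> B \<Longrightarrow> arr s ''en'' a = n \<or> arr s ''en'' a \<in> B"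
    and Bsub: "B \<subseteq> {l..<n}" using tr by (auto simp: tree_inv_def)
  show ?thesis unfolding tree_inv_def
  proof (intro conjI ballI impI)
    show "B - {l} \<subseteq> {arr s ''en'' l..<n}" using other_bounds(1) Bsub by fastforce
    show "arr s ''en'' l \<le> n" by (rule l_bounds)
    show "arr s ''en'' l \<in> B - {l}" if "arr s ''en'' l < n" using enB[OF lB] that l_bounds by auto
  next
    fix a assume "a \<in> B - {l}"
    then have aB: "a \<in> B" "a \<noteq> l" by auto
    have "arr s ''en'' a \<noteq> l" using other_bounds[OF aB] l_bounds by linarith
    moreover have "node_info (P a) (arr s ''fl'' a)" "arr s ''fl'' a \<le> 1"
      "\<exists>c. arr s ''ty'' a = base c" using tr aB by (simp_all add: tree_inv_def)
    ultimately show "node s' a (arr s' ''en'' a) (P a)" "node_info (P a) (arr s' ''fl'' a)"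
       "arr s' ''fl'' a \<le> 1" "\<exists>c. arr s' ''ty'' a = base c"
       "arr s' ''en'' a = n \<or> arr s' ''en'' a \<in> B - {l}"
      using other_same[OF aB] enB[OF aB(1)] by simp_all
  next
    fix a a' assume a: "a \<in> B - {l}" "a' \<in> B - {l}" "a < a'"
    have "arr s ''en'' a \<le> a'" using tr a unfolding tree_inv_def by blast
    then show "arr s' ''en'' a \<le> a'" using other_same(1) a by simp
  next
    fix a a' assume "a \<in> B - {l}" "a' \<in> B - {l}" "a \<noteq> a'"
    then show "P a \<inter> P a' = {}" using tr unfolding tree_inv_def by blast
  qed
qed

lemma conn_inv_drop: "conn_inv s B P \<Longrightarrow> conn_inv s' (B - {l}) P"
  using other_same(2) by (simp add: conn_inv_def)

text \<open>A co-component split that finds a single part saves no arcs. It is paid for by the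
  weight of the node itself, which disappears with the leaf.\<close>

lemma pot_drop: "pot s' (B - {l}) P + 400 * (arr s ''en'' l - l) \<le> pot s B P"
proof -
  have fB: "finite B" using tr finite_subset unfolding tree_inv_def by blast
  have "pot s' (B - {l}) P = (\<Sum>a\<in>B - {l}. weight (arr s ''ty'' a \<noteq> 0) (P a))"
    unfolding pot_def by (rule sum.cong) (use other_same(2) in auto)
  moreover have "400 * card (P l) \<le> weight (arr s ''ty'' l \<noteq> 0) (P l)"
    by (simp add: weight_def)
  ultimately show ?thesis
    using sum.remove[OF fB lB, of "\<lambda>a. weight (arr s ''ty'' a \<noteq> 0) (P a)"] card_Pl
    by (simp add: pot_def)
qed

lemma union_drop: "(\<Union>a\<in>B - {l}. P a) = (\<Union>a\<in>B. P a) - P l"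
  using other_bounds(4) lB by blast

end

lemma result_inv_leaf:
  assumes R: "result_inv s U" and X: "X \<subseteq> U" "U \<subseteq> verts G"
    and lr: "leaf_result X s s'"
  shows "result_inv s' (U - X)"
proof -
  note out = lr[unfolded leaf_result_def, THEN conjunct1]
  note dec = lr[unfolded leaf_result_def, THEN conjunct2]
  have old: "\<And>v. v \<in> U \<Longrightarrow> arr s ''label'' v = 0"
    "\<And>v. v \<in> verts G - U \<Longrightarrow> arr s ''label'' v \<le> reg s ''k'' \<and>
       (arr s ''label'' v = 0 \<longrightarrow> decides_at s v (v \<in> avoidable_set G))"
    "\<And>i. i \<in> {1..reg s ''k''} \<Longrightarrow> good {v \<in> verts G. arr s ''label'' v = i}"
    using R unfolding result_inv_def by blast+
  have kk: "reg s ''k'' \<le> reg s' ''k''" using dec by auto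
  have lX: "arr s' ''label'' v = 0 \<or> arr s' ''label'' v = Suc (reg s ''k'') \<and>
      reg s' ''k'' = Suc (reg s ''k'')" if "v \<in> X" for v
    using dec that by auto
  have same: "{v \<in> verts G. arr s' ''label'' v = i} = {v \<in> verts G. arr s ''label'' v = i}"
    if i: "1 \<le> i" "i \<le> reg s ''k''" for i
  proof -
    have "arr s' ''label'' v = i \<longleftrightarrow> arr s ''label'' v = i" for v
    proof (cases "v \<in> X")
      case True
      then have "arr s ''label'' v = 0" using old(1) X by blast
      then show ?thesis using lX[OF True] i by auto
    next
      case False
      then show ?thesis using out by simp
    qed
    then show ?thesis by simp
  qed
  show ?thesis unfolding result_inv_def
  proof (intro conjI ballI)
    fix v assume "v \<in> U - X"
    then show "arr s' ''label'' v = 0" using old(1) out by auto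
  next
    fix v assume v: "v \<in> verts G - (U - X)"
    have "arr s' ''label'' v \<le> reg s' ''k'' \<and>
        (arr s' ''label'' v = 0 \<longrightarrow> decides_at s' v (v \<in> avoidable_set G))"
    proof (cases "v \<in> X")
      case True
      then show ?thesis using dec by auto
    next
      case False
      then have "v \<in> verts G - U" using v by simp
      from old(2)[OF this] show ?thesis using out False kk by (auto simp: decides_at_def)
    qed
    then show "arr s' ''label'' v \<le> reg s' ''k''"
      "arr s' ''label'' v = 0 \<longrightarrow> decides_at s' v (v \<in> avoidable_set G)" by blast+
  next
    fix i assume i: "i \<in> {1..reg s' ''k''}"
    show "good {v \<in> verts G. arr s' ''label'' v = i}"
    proof (cases "i \<le> reg s ''k''")
      case True
      then show ?thesis using same[of i] old(3)[of i] i by simp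
    next
      case False
      then have ik: "i = Suc (reg s ''k'')" "reg s' ''k'' = Suc (reg s ''k'')" "good X"
        "\<forall>v\<in>X. arr s' ''label'' v = Suc (reg s ''k'')" using dec i by auto
      \<comment> \<open>All earlier labels are at most the old \<open>k\<close>, and pending
        vertices have label 0, so the new label marks no vertex outside \<open>X\<close>.\<close>
      have "{v \<in> verts G. arr s' ''label'' v = i} = X"
      proof (intro set_eqI iffI)
        fix v assume v: "v \<in> {v \<in> verts G. arr s' ''label'' v = i}"
        show "v \<in> X"
        proof (rule ccontr)
          assume vX: "v \<notin> X"
          then have "arr s ''label'' v = Suc (reg s ''k'')" using out v ik by simp
          then show False using old(1)[of v] old(2)[of v] v by (cases "v \<in> U") auto
        qed
      qed (use ik X in auto)
      then show ?thesis using ik(3) by simp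
    qed
  qed
qed

text \<open>The potential is the time credit of the loop rule. \<open>k \<le> l\<close> bounds the
  number of collected parts by the number of finished vertices, so the counter fits into a
  word.\<close>

definition main_inv :: "nat \<Rightarrow> state \<Rightarrow> bool" where
  "main_inv m s \<longleftrightarrow> input s \<and> reg s ''k'' \<le> reg s ''l'' \<and> (\<exists>B P. tree_inv s (reg s ''l'') B P \<and>
     conn_inv s B P \<and> result_inv s (\<Union>a\<in>B. P a) \<and> pot s B P = m)"

lemma main_step_wp:
  assumes inv: "main_inv m s" and lt: "reg s ''l'' < n"
  shows "wp W main_step (\<lambda>t s'. \<exists>m'. main_inv m' s' \<and> m' + t + 4 \<le> m) s"
proof -
  define l where "l = reg s ''l''"
  have n0: "0 < n" using lt by linarith
  obtain B P where inp: "input s" and kl: "reg s ''k'' \<le> l" and tr: "tree_inv s l B P"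
    and ci: "conn_inv s B P" and ri: "result_inv s (\<Union>a\<in>B. P a)" and m: "pot s B P = m"
    using inv unfolding main_inv_def l_def by blast
  have lB: "l \<in> B" using tr lt by (simp add: tree_inv_def l_def)
  define b where "b = arr s ''en'' l"
  define X where "X = P l"
  define f where "f = arr s ''fl'' l"
  have nd: "node s l b X" and info: "node_info X f" and f1: "f \<le> 1"
    and "\<exists>c. arr s ''ty'' l = base c"
    using tr lB by (simp_all add: tree_inv_def b_def X_def f_def)
  then obtain c where ty: "arr s ''ty'' l = base c" by blast
  have ab: "l < b" "b \<le> n" using nd by (auto simp: node_def)
  have cX: "card X = b - l" by (rule node_card[OF nd])
  have Usub: "(\<Union>a\<in>B. P a) \<subseteq> verts G"
    using tr unfolding tree_inv_def node_def verts_eq by blast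
  define s1 where "s1 = s\<lparr>reg := (reg s)(''y'' := f)\<rparr>"
  have a1: "arr s1 = arr s" by (simp add: s1_def)
  have nd1: "node s1 l b X" using nd node_arr_cong[OF a1] by simp
  have inp1: "input s1" using inp by (simp add: input_def s1_def)
  have tr1: "tree_inv s1 l B P" using tr tree_inv_arr_cong[OF a1] by simp
  have ci1: "conn_inv s1 B P" using ci conn_inv_arr_cong[OF a1] by simp
  have m1: "pot s1 B P = m" using m by (simp add: pot_def a1)
  have w1: "wp W (Assign ''y'' (Get ''fl'' (V ''l''))) (\<lambda>t s. t = 3 \<and> s = s1) s"
    using W lt f1 by (simp add: s1_def f_def l_def)
  have w2: "wp W split (\<lambda>t s. t \<le> 150 * (b - l) \<and> (\<exists>St Q. split_result s1 l b X s c St Q) \<and>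
    reg s ''r'' = b \<and> frame split s1 s) s1"
    by (rule split_wp[OF nd1 inp1]) (use ty in \<open>auto simp: s1_def l_def b_def\<close>)
  show ?thesis unfolding main_step_def
  proof (rule wp_seqs[OF w1], elim conjE, simp only:, rule wp_seqs[OF w2], elim conjE exE,
      rule wp_seqs_single)
    fix t2 s2 St Q assume t2: "t2 \<le> 150 * (b - l)" and sp: "split_result s1 l b X s2 c St Q"
      and r2: "reg s2 ''r'' = b" and f2: "frame split s1 s2"
    have inp2: "input s2" by (rule input_frame[OF inp1 f2])
        (auto simp: split_def split_scan_def split_move_def split_copy_def)
    have rs: "reg s2 ''l'' = l" "reg s2 ''k'' = reg s ''k''" "reg s2 ''y'' = f"
      using f2 by (simp_all add: frame_def split_def split_scan_def split_move_def split_copy_def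
          s1_def l_def)
    have as: "arr s2 ''label'' = arr s ''label''" "arr s2 ''answer'' = arr s ''answer''"
      using f2 by (simp_all add: frame_def split_def split_scan_def split_move_def split_copy_def s1_def)
    have en1: "arr s1 ''en'' l = b" "arr s1 ''ty'' l = base c" "arr s1 ''fl'' l = f"
      using ty by (simp_all add: a1 b_def f_def)
    have sp1: "split_result s1 l (arr s1 ''en'' l) (P l) s2 c St Q"
      using sp en1(1) by (simp add: X_def)
    note ctx = n0 tr1 lB en1(2) sp1
    have ri2: "result_inv s2 U \<longleftrightarrow> result_inv s U" for U
      using rs as by (simp add: result_inv_def decides_at_def)
    have en2: "arr s2 ''en'' l \<le> n"
      using parts(2)[OF ctx l_in_St[OF ctx]] en1 ab by simp
    show "wp W (If (Eq (Get ''en'' (V ''l'')) (V ''r'')) (seqs [leaf, Assign ''l'' (V ''r'')]) SKIP)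
      (\<lambda>t' s'. \<exists>m'. main_inv m' s' \<and> m' + (3 + (t2 + t')) + 4 \<le> m) s2"
    proof (cases "arr s2 ''en'' l = b")
      case False
      have ne: "St \<noteq> {l}" by (rule several_parts[OF ctx]) (use False en1 in simp)
      \<comment> \<open>A node that falls into several parts has at least two vertices, so
        overwriting its flag loses nothing.\<close>
      have two: "2 \<le> card (P l) \<or> arr s1 ''fl'' l = 1"
      proof (rule ccontr)
        assume "\<not> ?thesis"
        then have "\<not> 2 \<le> card X" by (simp add: X_def)
        then have "b = Suc l" using cX ab by linarith
        then show False
          using ne l_in_St[OF ctx] parts(10,11)[OF ctx] en1(1) by fastforce
      qed
      let ?B = "(B - {l}) \<union> St" and ?P = "\<lambda>k. if k \<in> St then Q k else P k"
      have "tree_inv s2 l ?B ?P" by (rule tree_inv_split[OF ctx two])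
      moreover have "conn_inv s2 ?B ?P"
        by (rule conn_inv_split[OF ctx]) (use ci1 in \<open>simp add: conn_inv_def\<close>)
      moreover have "result_inv s2 (\<Union>a\<in>?B. ?P a)"
        using ri ri2 union_split[OF ctx] by simp
      ultimately have "\<exists>B' P'. tree_inv s2 (reg s2 ''l'') B' P' \<and> conn_inv s2 B' P' \<and>
          result_inv s2 (\<Union>a\<in>B'. P' a) \<and> pot s2 B' P' = pot s2 ?B ?P"
        unfolding rs(1) by blast
      moreover have "reg s2 ''k'' \<le> reg s2 ''l''" using rs kl by simp
      ultimately have "main_inv (pot s2 ?B ?P) s2"
        unfolding main_inv_def using inp2 by (intro conjI)
      moreover have "pot s2 ?B ?P + 400 * (b - l) \<le> m"
        using pot_split[OF ctx] ne en1(1) m1 by simp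
      ultimately show ?thesis using False W rs r2 en2 ab t2
        by (auto intro!: exI[of _ "pot s2 ?B ?P"])
    next
      case True
      then have eq: "arr s2 ''en'' l = arr s1 ''en'' l" using en1 by simp
      have Sl: "St = {l}" "Q l = X" using single_part[OF ctx eq] by (simp_all add: X_def)
      have nd2: "node s2 l b X" using parts(1)[OF ctx, of l] Sl True by simp
      \<comment> \<open>The node is connected for its own relation because it did not split, and for
        the opposite one by \<open>conn_inv\<close>.\<close>
      have "conn (rel G c) X" using parts(4)[OF ctx, of l] Sl by simp
      moreover have "conn (rel G (\<not> c)) X" using ci1 lB en1(2) by (simp add: conn_inv_def X_def)
      ultimately have cc: "conn (rel G False) X" "conn (rel G True) X" by (cases c; simp)+
      have w3: "wp W leaf (\<lambda>t s. t \<le> 150 * (b - l) \<and>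
        leaf_result X s2 s \<and>
        frame leaf s2 s) s2"
        by (rule leaf_wp[OF nd2 inp2 _ _ _ _ f1 info cc]) (use rs r2 kl lt in \<open>auto simp: l_def\<close>)
      have "wp W (seqs [leaf, Assign ''l'' (V ''r'')])
        (\<lambda>t' s'. \<exists>m'. main_inv m' s' \<and> m' + (3 + (t2 + (5 + t'))) + 4 \<le> m) s2"
      proof (rule wp_seqs[OF w3], elim conjE, rule wp_seqs_single)
        fix t3 s3 assume t3: "t3 \<le> 150 * (b - l)"
          and lr: "leaf_result X s2 s3"
          and f3: "frame leaf s2 s3"
        define s4 where "s4 = s3\<lparr>reg := (reg s3)(''l'' := b)\<rparr>"
        have inp3: "input s3" by (rule input_frame[OF inp2 f3])
            (auto simp: leaf_def leaf_sum_def leaf_decide_def leaf_put_def)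
        have r3: "reg s3 ''r'' = b"
          using f3 r2 by (simp add: frame_def leaf_def leaf_sum_def leaf_decide_def leaf_put_def)
        have a3: "arr s3 ''o'' = arr s2 ''o''" "arr s3 ''d'' = arr s2 ''d''" "arr s3 ''en'' = arr s2 ''en''"
          "arr s3 ''ty'' = arr s2 ''ty''" "arr s3 ''fl'' = arr s2 ''fl''"
          using f3 by (simp_all add: frame_def leaf_def leaf_sum_def leaf_decide_def leaf_put_def)
        have "ord s4 = ord s2" "back_deg s4 = back_deg s2"
          using a3 by (simp_all add: ord_def back_deg_def fun_eq_iff s4_def)
        then have nd4: "node s4 = node s2" by (intro ext) (simp add: node_def segment_def)
        have a4: "arr s4 ''en'' = arr s2 ''en''" "arr s4 ''ty'' = arr s2 ''ty''"
          "arr s4 ''fl'' = arr s2 ''fl''" using a3 by (simp_all add: s4_def)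
        have "tree_inv s4 = tree_inv s2" by (intro ext) (simp add: tree_inv_def nd4 a4)
        then have "tree_inv s4 b (B - {l}) P" using tree_inv_drop[OF ctx] en1(1) by simp
        moreover have "conn_inv s4 (B - {l}) P"
          using conn_inv_drop[OF ctx ci1] a3 by (simp add: conn_inv_def s4_def)
        moreover have "result_inv s4 (\<Union>a\<in>B - {l}. P a)"
          unfolding union_drop[OF ctx]
        proof (rule result_inv_leaf[of s2])
          show "result_inv s2 (\<Union>a\<in>B. P a)" using ri ri2 by simp
          show "leaf_result (P l) s2 s4"
            using lr by (simp add: leaf_result_def s4_def X_def decides_at_def)
        qed (use Usub lB in auto)
        moreover have "reg s4 ''k'' \<le> b" using lr rs kl ab by (auto simp: leaf_result_def s4_def)
        moreover have "input s4" using inp3 by (simp add: input_def s4_def)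
        moreover have "reg s4 ''l'' = b" by (simp add: s4_def)
        ultimately have mi: "main_inv (pot s4 (B - {l}) P) s4"
          unfolding main_inv_def by blast
        have "pot s4 (B - {l}) P = pot s2 (B - {l}) P" using a3 by (simp add: pot_def s4_def)
        then have "pot s4 (B - {l}) P + 400 * (b - l) \<le> m"
          using pot_drop[OF ctx] en1(1) m1 by simp
        \<comment> \<open>Of the 400 per vertex, 150 pay for the split and 150 for the leaf; the
          rest covers the constant costs, as the node is nonempty.\<close>
        then have "pot s4 (B - {l}) P + (3 + (t2 + (5 + (t3 + 2)))) + 4 \<le> m"
          using t2 t3 ab by linarith
        then show "wp W (Assign ''l'' (V ''r''))
          (\<lambda>t' s'. \<exists>m'. main_inv m' s' \<and> m' + (3 + (t2 + (5 + (t3 + t')))) + 4 \<le> m) s3"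
          using mi W r3 ab by (auto simp: s4_def)
      qed
      then have "wp W (seqs [leaf, Assign ''l'' (V ''r'')])
        (\<lambda>t' s'. \<exists>m'. main_inv m' s' \<and> m' + (3 + (t2 + (4 + t' + 1))) + 4 \<le> m) s2"
        by (rule wp_mono) (auto simp: algebra_simps)
      then show ?thesis using True W rs r2 en2 ab
        by (simp del: wp_Seq seqs.simps)
    qed
  qed
qed

definition solved :: "state \<Rightarrow> bool" where
  "solved s \<longleftrightarrow> typical_collection G (output_collection G s) \<and>
     (\<forall>v \<in> verts G - collection_verts (output_collection G s).
       decides_at s v (v \<in> avoidable_set G))"

lemma main_loop_wp:
  assumes inv: "main_inv m s0"
  shows "wp W (While (Less (V ''l'') (V ''n'')) main_step)
    (\<lambda>t s. t \<le> m + 4 \<and> (\<exists>m. main_inv m s) \<and> reg s ''l'' = n) s0"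
proof -
  have le: "reg s ''l'' \<le> n" if "main_inv m s" for m s
    using that unfolding main_inv_def tree_inv_def by blast
  have "wp W (While (Less (V ''l'') (V ''n'')) main_step) (\<lambda>t s'. (\<exists>k'. main_inv k' s' \<and>
      k' + t \<le> m + bcost (Less (V ''l'') (V ''n'')) + 1) \<and>
      \<not> bval (Less (V ''l'') (V ''n'')) s' \<and> frame main_step s0 s') s0"
  proof (rule wp_While[where I = main_inv, OF inv])
    fix s k assume I: "main_inv k s"
    then have rn: "reg s ''n'' = n" using input_n by (simp add: main_inv_def)
    show "bfits W (Less (V ''l'') (V ''n'')) s" using le[OF I] rn W by simp
    assume "bval (Less (V ''l'') (V ''n'')) s"
    then have "reg s ''l'' < n" using rn by simp
    then show "wp W main_step (\<lambda>t s'. \<exists>k'. main_inv k' s' \<and>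
        k' + t + bcost (Less (V ''l'') (V ''n'')) + 1 \<le> k) s"
      by (rule wp_mono[OF main_step_wp[OF I]]) auto
  qed
  then show ?thesis
  proof (rule wp_mono, elim conjE exE)
    fix t s k' assume I: "main_inv k' s"
      and t: "k' + t \<le> m + bcost (Less (V ''l'') (V ''n'')) + 1"
      and nb: "\<not> bval (Less (V ''l'') (V ''n'')) s"
    have "reg s ''n'' = n" using I input_n by (simp add: main_inv_def)
    then have "reg s ''l'' = n" using nb le[OF I] by simp
    then show "t \<le> m + 4 \<and> (\<exists>m. main_inv m s) \<and> reg s ''l'' = n" using t I by auto
  qed
qed

text \<open>With \<open>l = n\<close> no node is pending. Output graphs that differ have different
  labels and are therefore disjoint, and since no label exceeds \<open>k\<close>, a vertex outside
  the collection has label 0 and has been decided.\<close>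

lemma main_inv_final:
  assumes "main_inv m s" "reg s ''l'' = n"
  shows "solved s"
proof -
  obtain B P where "tree_inv s n B P" and ri: "result_inv s (\<Union>a\<in>B. P a)"
    using assms unfolding main_inv_def by auto
  then have "B = {}" by (auto simp: tree_inv_def)
  then have R: "result_inv s {}" using ri by simp
  let ?X = "\<lambda>i. {v \<in> verts G. arr s ''label'' v = i}"
  have vo: "verts (output_subgraph G s i) = ?X i" for i
    by (simp add: output_subgraph_def induced_def)
  have gd: "good (?X i)" if "i \<in> {1..reg s ''k''}" for i
    using R that unfolding result_inv_def by blast
  have "typical_collection G (output_collection G s)"
    unfolding typical_collection_def
  proof (intro conjI ballI impI)
    fix H assume "H \<in> output_collection G s"
    then obtain i where i: "i \<in> {1..reg s ''k''}" "H = induced G (?X i)"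
      by (auto simp: output_collection_def output_subgraph_def)
    have vH: "verts H = ?X i" using i by (simp add: induced_def)
    show "maximal_conn_coconn G H" "connected H" "co_connected H"
      "card (verts H) \<le> card (edges H)" "card (verts H) \<le> card (edges (complement H))"
      "avoidable_set H \<subseteq> avoidable_set G"
      using gd[OF i(1)] unfolding good_def vH unfolding i(2) by blast+
  next
    fix H H' assume H: "H \<in> output_collection G s" "H' \<in> output_collection G s" "H \<noteq> H'"
    then obtain i j where "H = output_subgraph G s i" "H' = output_subgraph G s j"
      by (auto simp: output_collection_def)
    then show "verts H \<inter> verts H' = {}" using H(3) vo by auto
  qed
  moreover have "decides_at s v (v \<in> avoidable_set G)"
    if v: "v \<in> verts G - collection_verts (output_collection G s)" for v
  proof -
    have k: "arr s ''label'' v \<le> reg s ''k''"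
      "arr s ''label'' v = 0 \<Longrightarrow> decides_at s v (v \<in> avoidable_set G)"
      using R v unfolding result_inv_def by blast+
    have "arr s ''label'' v = 0"
    proof (rule ccontr)
      assume "arr s ''label'' v \<noteq> 0"
      then have "arr s ''label'' v \<in> {1..reg s ''k''}" using k by simp
      moreover have "v \<in> verts (output_subgraph G s (arr s ''label'' v))" using v vo by simp
      ultimately have "v \<in> collection_verts (output_collection G s)"
        unfolding collection_verts_def output_collection_def by blast
      then show False using v by simp
    qed
    then show ?thesis by (rule k)
  qed
  ultimately show ?thesis unfolding solved_def by blast
qed

lemma algorithm_wp:
  assumes n0: "0 < n"
  shows "wp W algorithm (\<lambda>t s. t \<le> 1600 * n + 1000 * M + 100 \<and>
    solved s) (input_state adj)"
proof -
  define s0 where "s0 = input_state adj"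
  have inp0: "input s0" using input_state by (simp add: s0_def)
  have z0: "arr s0 ''label'' = (\<lambda>_. 0)" "reg s0 ''k'' = 0"
    by (simp_all add: s0_def input_state_def)
  define s1 where "s1 = s0\<lparr>reg := (reg s0)(''b'' := 0)\<rparr>"
  have w1: "wp W (Assign ''b'' (N 0)) (\<lambda>t s. t = 2 \<and> s = s1) s0" using W by (simp add: s1_def)
  have inp1: "input s1" using inp0 by (simp add: input_def s1_def)
  have w2: "wp W search (\<lambda>t s. (t \<le> 300 * n + 80 * M + 30 \<and> same_outside False s1 s \<and>
    search_order (rel G False) (verts G) (map (\<lambda>k. arr s ''o'' (base False + k)) [0..<n])
      (\<lambda>v. arr s ''d'' (base False + v))) \<and> frame search s1 s) s1"
    by (rule wp_frame, rule search_wp[OF inp1 _ n0]) (simp add: s1_def base_def)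
  have fs: "''n'' \<notin> rmod search" "''k'' \<notin> rmod search" "''off'' \<notin> amod search" "''adj'' \<notin> amod search"
    "''label'' \<notin> amod search"
    by (simp_all add: search_def search_init_def search_step_def search_visit_def search_scan_def)
  have fsp: "''n'' \<notin> rmod split" "''k'' \<notin> rmod split" "''l'' \<notin> rmod split"
    "''off'' \<notin> amod split" "''adj'' \<notin> amod split" "''label'' \<notin> amod split"
    by (simp_all add: split_def split_scan_def split_move_def split_copy_def)
  have "wp W (seqs [
       Assign ''b'' (N 0),
       search,
       Assign ''b'' (V ''n''),
       search,
       main_init,
       split,
       While (Less (V ''l'') (V ''n'')) main_step]) (\<lambda>t s. t \<le> 1600 * n + 1000 * M + 90 \<and>
    solved s) s0"
  proof (rule wp_seqs[OF w1], elim conjE, simp only:, rule wp_seqs[OF w2], elim conjE)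
    fix t2 s2 assume t2: "t2 \<le> 300 * n + 80 * M + 30"
      and so2: "search_order (rel G False) (verts G) (map (\<lambda>k. arr s2 ''o'' (base False + k)) [0..<n])
        (\<lambda>v. arr s2 ''d'' (base False + v))"
      and f2: "frame search s1 s2"
    have inp2: "input s2" by (rule input_frame[OF inp1 f2 fs(1,3,4)])
    define s3 where "s3 = s2\<lparr>reg := (reg s2)(''b'' := n)\<rparr>"
    have w3: "wp W (Assign ''b'' (V ''n'')) (\<lambda>t s. t = 2 \<and> s = s3) s2"
      using W input_n[OF inp2] by (simp add: s3_def)
    have inp3: "input s3" using inp2 by (simp add: input_def s3_def)
    have w4: "wp W search (\<lambda>t s. (t \<le> 300 * n + 80 * M + 30 \<and> same_outside True s3 s \<and>
      search_order (rel G True) (verts G) (map (\<lambda>k. arr s ''o'' (base True + k)) [0..<n])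
        (\<lambda>v. arr s ''d'' (base True + v))) \<and> frame search s3 s) s3"
      by (rule wp_frame, rule search_wp[OF inp3 _ n0]) (simp add: s3_def base_def)
    show "wp W (seqs [
       Assign ''b'' (V ''n''),
       search,
       main_init,
       split,
       While (Less (V ''l'') (V ''n'')) main_step]) (\<lambda>t' s. 2 + (t2 + t') \<le> 1600 * n + 1000 * M + 90 \<and>
      solved s) s2"
    proof (rule wp_seqs[OF w3], elim conjE, simp only:, rule wp_seqs[OF w4], elim conjE)
      fix t4 s4 assume t4: "t4 \<le> 300 * n + 80 * M + 30" and out4: "same_outside True s3 s4"
        and so4: "search_order (rel G True) (verts G) (map (\<lambda>k. arr s4 ''o'' (base True + k)) [0..<n])
          (\<lambda>v. arr s4 ''d'' (base True + v))"
        and f4: "frame search s3 s4"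
      have inp4: "input s4" by (rule input_frame[OF inp3 f4 fs(1,3,4)])
      define s5 where "s5 = s4\<lparr>
        arr := (arr s4)(''en'' := (arr s4 ''en'')(0 := n), ''ty'' := (arr s4 ''ty'')(0 := 0),
          ''fl'' := (arr s4 ''fl'')(0 := 1)),
        reg := (reg s4)(''l'' := 0)\<rparr>"
      have w5: "wp W main_init (\<lambda>t s. t \<le> 11 \<and> s = s5) s4"
        using W input_n[OF inp4] by (simp add: main_init_def s5_def)
      have inp5: "input s5" using inp4 by (simp add: input_def s5_def)
      have z5: "arr s5 ''label'' = (\<lambda>_. 0)" "reg s5 ''k'' = 0"
        using frame_arr[OF f2 fs(5)] frame_arr[OF f4 fs(5)] frame_reg[OF f2 fs(2)]
          frame_reg[OF f4 fs(2)] z0 by (simp_all add: s5_def s3_def s1_def)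
      have nd: "node s5 0 n (verts G)" unfolding node_def
      proof (intro conjI allI)
        fix c show "search_order (rel G c) (verts G) (segment s5 c 0 n) (back_deg s5 c)"
        proof (cases c)
          case True
          have "segment s5 True 0 n = map (\<lambda>k. arr s4 ''o'' (base True + k)) [0..<n]"
            by (simp add: segment_def ord_def s5_def)
          moreover have "back_deg s5 True = (\<lambda>v. arr s4 ''d'' (base True + v))"
            by (simp add: back_deg_def s5_def fun_eq_iff)
          ultimately show ?thesis using so4 True by simp
        next
          case False
          \<comment> \<open>The search of the complement writes only to the upper halves, so the
            order of the graph from the first search is still in place.\<close>
          have o: "arr s4 ''o'' i = arr s2 ''o'' i" "arr s4 ''d'' i = arr s2 ''d'' i" if "i < n" for i
            using out4 that by (simp_all add: same_outside_def base_def s3_def)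
          have "segment s5 False 0 n = map (\<lambda>k. arr s2 ''o'' (base False + k)) [0..<n]"
            using o by (simp add: segment_def ord_def s5_def base_def)
          moreover have "search_order (rel G False) (verts G)
              (map (\<lambda>k. arr s2 ''o'' (base False + k)) [0..<n]) (back_deg s5 False)"
            by (rule search_order_cong[OF so2]) (use o verts_eq in \<open>simp add: back_deg_def s5_def base_def\<close>)
          ultimately show ?thesis using False by simp
        qed
      qed (use n0 verts_eq in auto)
      have en5: "arr s5 ''en'' 0 = n" "arr s5 ''ty'' 0 = base False" "arr s5 ''fl'' 0 = 1" "reg s5 ''l'' = 0"
        by (simp_all add: s5_def base_def)
      let ?P = "\<lambda>_ :: nat. verts G"
      have tr5: "tree_inv s5 0 {0} ?P"
        using nd node_info_verts n0 en5 by (auto simp: tree_inv_def)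
      have w6: "wp W split (\<lambda>t s. t \<le> 150 * (n - 0) \<and>
        (\<exists>St Q. split_result s5 0 n (verts G) s False St Q) \<and>
        reg s ''r'' = n \<and> frame split s5 s) s5"
        by (rule split_wp[OF nd inp5]) (use en5 in auto)
      show "wp W (seqs [
         main_init,
         split,
         While (Less (V ''l'') (V ''n'')) main_step])
        (\<lambda>t' s. 2 + (t2 + (2 + (t4 + t'))) \<le> 1600 * n + 1000 * M + 90 \<and>
        solved s) s4"
      proof (rule wp_seqs[OF w5], elim conjE, simp only:, rule wp_seqs[OF w6], elim conjE exE,
          rule wp_seqs_single)
        fix t5 :: nat and t6 s6 St Q assume t5: "t5 \<le> 11" and t6: "t6 \<le> 150 * (n - 0)"
          and sp: "split_result s5 0 n (verts G) s6 False St Q" and f6: "frame split s5 s6"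
        have sp': "split_result s5 0 (arr s5 ''en'' 0) (?P 0) s6 False St Q" using sp en5 by simp
        have lB: "0 \<in> {0 :: nat}" by simp
        note ctx = n0 tr5 lB en5(2) sp'
        let ?B = "({0} - {0}) \<union> St" and ?Q = "\<lambda>k. if k \<in> St then Q k else ?P k"
        have "tree_inv s6 0 ?B ?Q" by (rule tree_inv_split[OF ctx]) (use en5 in simp)
        \<comment> \<open>Apart from the root there is no node yet, and for the parts of the root
          connectivity comes from the split itself.\<close>
        moreover have "conn_inv s6 ?B ?Q" by (rule conn_inv_split[OF ctx]) (simp add: conn_inv_def)
        moreover have "result_inv s6 (\<Union>a\<in>?B. ?Q a)"
          unfolding union_split[OF ctx]
          using z5 frame_arr[OF f6 fsp(6)] frame_reg[OF f6 fsp(2)] by (simp add: result_inv_def)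
        moreover have "input s6" by (rule input_frame[OF inp5 f6 fsp(1,4,5)])
        moreover have "reg s6 ''l'' = 0" "reg s6 ''k'' = 0"
          using frame_reg[OF f6 fsp(3)] frame_reg[OF f6 fsp(2)] en5 z5 by simp_all
        ultimately have mi: "main_inv (pot s6 ?B ?Q) s6"
          unfolding main_inv_def by (metis le_refl)
        have "pot s6 ?B ?Q \<le> pot s5 {0} ?P" using pot_split[OF ctx] by simp
        \<comment> \<open>The root has type \<open>False\<close>, hence size factor 2, and its arcs
          are the \<open>M\<close> entries of the adjacency lists.\<close>
        also have "pot s5 {0} ?P = 400 * (2 * M + 2 * n)"
          using en5 M_eq(1) verts_eq by (simp add: pot_def weight_def base_def)
        finally have p: "pot s6 ?B ?Q \<le> 800 * M + 800 * n" by simp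
        show "wp W (While (Less (V ''l'') (V ''n'')) main_step)
          (\<lambda>t' s. 2 + (t2 + (2 + (t4 + (t5 + (t6 + t'))))) \<le> 1600 * n + 1000 * M + 90 \<and>
          solved s) s6"
        proof (rule wp_mono[OF main_loop_wp[OF mi]], elim conjE exE)
          fix t s m assume t: "t \<le> pot s6 ?B ?Q + 4" and I: "main_inv m s" "reg s ''l'' = n"
          have "2 + (t2 + (2 + (t4 + (t5 + (t6 + t))))) \<le> 1600 * n + 1000 * M + 90"
            using t p t2 t4 t5 t6 by simp
          then show "2 + (t2 + (2 + (t4 + (t5 + (t6 + t))))) \<le> 1600 * n + 1000 * M + 90 \<and>
            solved s"
            using main_inv_final[OF I] by blast
        qed
      qed
    qed
  qed
  then have main: "wp W (seqs [
       Assign ''b'' (N 0),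
       search,
       Assign ''b'' (V ''n''),
       search,
       main_init,
       split,
       While (Less (V ''l'') (V ''n'')) main_step])
     (\<lambda>t s. bcost (Less (N 0) (V ''n'')) + t + 1 \<le> 1600 * n + 1000 * M + 100 \<and>
    solved s) s0"
    by (rule wp_mono) simp
  have "reg s0 ''n'' = n" by (rule input_n[OF inp0])
  then show ?thesis unfolding s0_def[symmetric] algorithm_def wp_If using main n0 W
    by (simp del: wp_Seq seqs.simps)
qed

end

section \<open>Word size and final constants\<close>

lemma square_le_power4:
  fixes q :: nat
  assumes "2 \<le> q"
  shows "q * q * 4 \<le> q ^ 4"
proof -
  have "4 \<le> q * q" using mult_le_mono[OF assms assms] by simp
  then have "q * q * 4 \<le> q * q * (q * q)" by (rule mult_le_mono2)
  then show ?thesis by (simp add: power4_eq_xxxx mult.assoc)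
qed

theorem theorem11:
  "\<exists>(p :: com) (c :: nat). \<forall>(G :: nat ugraph) adj n m.
     simple_graph G \<longrightarrow> adjacency_lists G adj \<longrightarrow>
     n = card (verts G) \<longrightarrow> m = card (edges G) \<longrightarrow>
     (\<exists>t s. exec ((n + m + 2) ^ c) p (input_state adj) t s \<and>
        t \<le> c * (n + m + 1) \<and>
        typical_collection G (output_collection G s) \<and>
        (\<forall>v \<in> verts G - collection_verts (output_collection G s).
           decides_at s v (v \<in> avoidable_set G)))"
proof (rule exI[of _ algorithm], rule exI[of _ 2000], intro allI impI)
  fix G :: "nat ugraph" and adj n m
  assume G: "simple_graph G" and adj: "adjacency_lists G adj"
    and n: "n = card (verts G)" and m: "m = card (edges G)"
  \<comment> \<open>One constant serves as exponent and as time factor. The value 2000 comes from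
    the running time; as an exponent it exceeds the 4 with which the linear and the quadratic
    requirement on the word size are met.\<close>
  define W where "W = (n + m + 2) ^ (2000 :: nat)"
  have len: "length adj = n" using adj n by (simp add: adjacency_lists_def)
  have W4: "(n + m + 2) ^ 4 \<le> W" unfolding W_def by (rule power_increasing) auto
  have sq: "(n + m + 2) * (n + m + 2) * 4 \<le> (n + m + 2) ^ 4" by (rule square_le_power4) simp
  have lin: "4 * (n + m + 2) \<le> (n + m + 2) * (n + m + 2) * 4" by simp
  have n2: "n * n < (n + m + 2) * (n + m + 2) * 4"
  proof -
    have "n * n \<le> (n + m + 2) * (n + m + 2)" by (rule mult_le_mono) auto
    moreover have "0 < (n + m + 2) * (n + m + 2)" by simp
    ultimately show ?thesis by linarith
  qed
  \<comment> \<open>This equation is proved inside the locale, whose bound on the word size already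
    mentions the length. An interpretation with a word size that meets the bounds by its very form
    breaks the circle.\<close>
  have M2: "length (concat adj) = 2 * m"
  proof -
    interpret g: graph_input G adj "4 * length adj + 2 * length (concat adj) + 8 +
        length adj * length adj"
      by unfold_locales (use G adj in simp_all)
    show ?thesis using g.M_eq(2) m by simp
  qed
  interpret graph_input G adj W
  proof
    show "4 * length adj + 2 * length (concat adj) + 8 \<le> W"
      unfolding len M2 using order_trans[OF lin order_trans[OF sq W4]] by simp
    show "length adj * length adj < W"
      unfolding len by (rule less_le_trans[OF n2 order_trans[OF sq W4]])
  qed (use G adj in simp_all)
  show "\<exists>t s. exec ((n + m + 2) ^ 2000) algorithm (input_state adj) t s \<and>
        t \<le> 2000 * (n + m + 1) \<and>
        typical_collection G (output_collection G s) \<and>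
        (\<forall>v \<in> verts G - collection_verts (output_collection G s).
           decides_at s v (v \<in> avoidable_set G))"
  proof (cases "n = 0")
    case False
    have "0 < length adj" using False len by simp
    from algorithm_wp[OF this] obtain t s where "exec W algorithm (input_state adj) t s"
      "t \<le> 1600 * length adj + 1000 * length (concat adj) + 100"
      "solved s"
      unfolding wp_def by blast
    \<comment> \<open>The adjacency lists contain every edge twice, so \<open>1000 * M\<close>
      becomes \<open>2000 * m\<close>.\<close>
    moreover from this(2) have "t \<le> 2000 * (n + m + 1)" using len M2 by simp
    ultimately show ?thesis unfolding W_def solved_def by blast
  next
    case True
    then have "verts G = {}" using n G by (simp add: simple_graph_def)
    have "reg (input_state adj) ''n'' = 0" using True len by (simp add: input_state_def)
    then have "wp W algorithm (\<lambda>t s. t = 5 \<and> s = input_state adj) (input_state adj)"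
      using W by (simp add: algorithm_def del: wp_Seq seqs.simps)
    then have "exec W algorithm (input_state adj) 5 (input_state adj)" by (auto simp: wp_def)
    moreover have "output_collection G (input_state adj) = {}"
      by (simp add: output_collection_def input_state_def)
    ultimately show ?thesis unfolding W_def
      by (intro exI[of _ 5] exI[of _ "input_state adj"])
        (use \<open>verts G = {}\<close> in \<open>simp add: typical_collection_def\<close>)
  qed
qed

end
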